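(* Let $q\colon\mathbb{C}^+\to\mathbb{C}$ be a quasi-Herglotz function written as $q=h_1-h_2$ with $h_1,h_2$ Herglotz functions. (i) Suppose at least one of $h_1,h_2$ admits, at $z=0$, an asymptotic expansion of some order $M\geq -1$. Then, for an integer $N_0\geq 1$ with $2N_0-1\leq M$, the limit $$\lim_{\varepsilon\to 0^+}\lim_{y\to 0^+}\int_{\varepsilon<|x|<1/\varepsilon} x^{-2N_0}\,\Im\{q(x+\mathrm{i}y)\}\,\mathrm{d}x$$ exists as a finite number if and only if $q$ admits, at $z=0$, an asymptotic expansion of order $2N_0-1$. (ii) Suppose at least one of $h_1,h_2$ admits, at $z=\infty$, an asymptotic expansion of some order $K\geq -1$. Then, for an integer $N_\infty\geq 0$ with $2N_\infty+1\leq K$, the limit $$\lim_{\varepsilon\to 0^+}\lim_{y\to 0^+}\int_{\varepsilon<|x|<1/\varepsilon} x^{2N_\infty}\,\Im\{q(x+\mathrm{i}y)\}\,\mathrm{d}x$$ exists as a finite number if and only if $q$ admits, at $z=\infty$, an asymptotic expansion of order $2N_\infty+1$. Furthermore, the identities $$\lim_{\varepsilon\to 0^+}\lim_{y\to 0^+}\frac{1}{\pi}\int_{\varepsilon<|x|<1/\varepsilon} x^{k}\,\Im\{q(x+\mathrm{i}y)\}\,\mathrm{d}x=\begin{cases} a_{-k-1}, & -2N_0\leq k\leq -3,\\ a_{-k-1}-b_{-k-1}, & -2\leq k\leq 0,\\ -b_{-k-1}, & 1\leq k\leq 2N_\infty\end{cases}$$ hold: for $k=-2N_0,-2N_0+1,\dots,-2$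 if there exists an integer $N_0$ as in (i) (i.e. $q$ admits an expansion at $0$ of order $2N_0-1$ under the hypothesis of (i)); for $k=0,1,\dots,2N_\infty$ if there exists an integer $N_\infty$ as in (ii); and for $k=-1$ if there exist integers $N_0$ and $N_\infty$ as in (i) and (ii) respectively. Here $a_{-1},a_0,\dots,a_{2N_0-1}$ are the coefficients of the expansion of $q$ at $z=0$ and $b_{1},b_0,b_{-1},\dots,b_{-(2N_\infty+1)}$ are the coefficients of the expansion of $q$ at $z=\infty$.
   Context: $\mathbb{C}^+=\{z\in\mathbb{C}:\Im z>0\}$. A Herglotz function is an analytic function $h\colon\mathbb{C}^+\to\mathbb{C}$ with $\Im h(z)\geq 0$ for all $z\in\mathbb{C}^+$. A quasi-Herglotz function is an analytic $q\colon\mathbb{C}^+\to\mathbb{C}$ such that $q=h_1-h_2$ on $\mathbb{C}^+$ for some Herglotz functions $h_1,h_2$. For $\theta\in(0,\pi/2]$, a Stoltz domain is $\{z\in\mathbb{C}^+:\theta<\operatorname{Arg}(z)<\pi-\theta\}$; $z\hat\to 0$ (resp. $z\hat\to\infty$) means $|z|\to 0$ (resp. $|z|\to\infty$) within any Stoltz domain. A function $f$ (Herglotz or quasi-Herglotz) admits at $z=0$ an asymptotic expansion of order $M\geq -1$ if there are real numbers $a_{-1},a_0,\dots,a_M$ with $f(z)=\frac{a_{-1}}{z}+a_0+a_1z+\dots+a_Mz^M+o(z^M)$ as $z\hat\to 0$. It admits at $z=\infty$ an asymptotic expansion of order $K\geq -1$ if there are real numbers $b_1,b_0,b_{-1},\dots,b_{-K}$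 with $f(z)=b_1z+b_0+\frac{b_{-1}}{z}+\dots+\frac{b_{-K}}{z^K}+o(z^{-K})$ as $z\hat\to\infty$. *)

theory Defs
  imports "HOL-Analysis.Analysis"
begin

definition upper_half :: "complex set" where
  "upper_half = {z. Im z > 0}"

definition herglotz :: "(complex \<Rightarrow> complex) \<Rightarrow> bool" where
  "herglotz h \<longleftrightarrow> h holomorphic_on upper_half \<and> (\<forall>z\<in>upper_half. Im (h z) \<ge> 0)"

definition quasi_herglotz :: "(complex \<Rightarrow> complex) \<Rightarrow> bool" where
  "quasi_herglotz q \<longleftrightarrow> q holomorphic_on upper_half \<and>
     (\<exists>h1 h2. herglotz h1 \<and> herglotz h2 \<and> (\<forall>z\<in>upper_half. q z = h1 z - h2 z))"

definition stoltz :: "real \<Rightarrow> complex set" where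
  "stoltz \<theta> = {z. Im z > 0 \<and> \<theta> < Arg z \<and> Arg z < pi - \<theta>}"

definition has_expansion_at_0 :: "(complex \<Rightarrow> complex) \<Rightarrow> int \<Rightarrow> (int \<Rightarrow> real) \<Rightarrow> bool" where
  "has_expansion_at_0 f M a \<longleftrightarrow>
     (\<forall>\<theta>. 0 < \<theta> \<and> \<theta> \<le> pi/2 \<longrightarrow>
        ((\<lambda>z. (f z - (\<Sum>k\<in>{-1..M}. complex_of_real (a k) * z powi k)) / z powi M) \<longlongrightarrow> 0)
          (at 0 within stoltz \<theta>))"

definition admits_expansion_at_0 :: "(complex \<Rightarrow> complex) \<Rightarrow> int \<Rightarrow> bool" where
  "admits_expansion_at_0 f M \<longleftrightarrow> (\<exists>a. has_expansion_at_0 f M a)"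

definition has_expansion_at_inf :: "(complex \<Rightarrow> complex) \<Rightarrow> int \<Rightarrow> (int \<Rightarrow> real) \<Rightarrow> bool" where
  "has_expansion_at_inf f K b \<longleftrightarrow>
     (\<forall>\<theta>. 0 < \<theta> \<and> \<theta> \<le> pi/2 \<longrightarrow>
        ((\<lambda>z. (f z - (\<Sum>k\<in>{-K..1}. complex_of_real (b k) * z powi k)) / z powi (-K)) \<longlongrightarrow> 0)
          (inf at_infinity (principal (stoltz \<theta>))))"

definition admits_expansion_at_inf :: "(complex \<Rightarrow> complex) \<Rightarrow> int \<Rightarrow> bool" where
  "admits_expansion_at_inf f K \<longleftrightarrow> (\<exists>b. has_expansion_at_inf f K b)"

definition sym_int :: "(complex \<Rightarrow> complex) \<Rightarrow> int \<Rightarrow> real \<Rightarrow> real \<Rightarrow> real" where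
  "sym_int q k \<epsilon> y = integral {x. \<epsilon> < \<bar>x\<bar> \<and> \<bar>x\<bar> < 1/\<epsilon>} (\<lambda>x. x powi k * Im (q (Complex x y)))"

definition iterated_limit :: "(real \<Rightarrow> real \<Rightarrow> real) \<Rightarrow> real \<Rightarrow> bool" where
  "iterated_limit F L \<longleftrightarrow>
     (\<exists>g. (\<forall>\<^sub>F \<epsilon> in at_right 0. ((\<lambda>y. F \<epsilon> y) \<longlongrightarrow> g \<epsilon>) (at_right 0)) \<and> (g \<longlongrightarrow> L) (at_right 0))"

end

theory Submission
  imports
    Defs
    "HOL-Probability.Helly_Selection"
    "HOL-Probability.Sinc_Integral"
    "HOL-Complex_Analysis.Cauchy_Integral_Formula"
begin

text \<open>
  A Herglotz function is determined by real numbers $\alpha, \beta, \gamma$ and a finite measure $\nu$ without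
  mass at $0$ through Nevanlinna's representation
  $h(z) = \alpha + \beta z - \gamma / z + \int (1 + x z) / (x - z) \, d\nu(x)$, obtained from Schwarz's formula on
  circles of radius tending to $1$ in the disc model and Helly selection for the boundary measures.
  Stieltjes inversion identifies the inner limit over $y$ with $\pi$ times a truncated moment of
  $(1 + x^2) \, d\nu(x)$. On the other hand $h$ has an expansion of order $2N - 1$ at $0$ exactly when
  $x^{-2N}$ is $\nu$-integrable, and then the coefficients are moments. If this holds for one of $h_1, h_2$, then
  positivity of the other measure turns convergence of the truncated moments of $q$ into integrability.
  The substitution $z \mapsto -1/z$ exchanges $0$ and $\infty$, maps $\nu$ to its image under
  $x \mapsto -1/x$ and swaps $\beta$ and $\gamma$.
\<close>

section \<open>Limits of integrals\<close>

text \<open>Twice integrability against \<nu> must be recovered from mere convergence, once of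
  truncated moments and once of expansions; both times Fatou's lemma on nonnegative integrands does
  it. Hence the equivalences concern even powers of x and odd orders. For expansions the test is
  made on z = iy: the coefficients are real, so the term of even exponent next to the top drops out
  of the real part of the normalised error, and a Poisson integral remains whose integrand
  increases, as y decreases to 0, to the next even inverse power. Each such step gains two powers,
  so the converse runs by induction. The atoms at 0 and infinity are split off as \<gamma> and
  \<beta> because truncated integrals do not see them in the limit while the coefficients contain
  them. They explain the identities at k = -2 and k = 0: one expansion yields the moment plus the
  contribution of an atom, and the extra coefficient of the other expansion removes it. At k = -1
  the weight \<open>1 / x + x\<close> has one half controlled at each end, and the constant
  \<alpha>, common to both expansions, cancels.\<close>

lemma integral_dominated_convergence_within:
  fixes s :: "'b::first_countable_topology \<Rightarrow> 'a \<Rightarrow> 'c::{banach, second_countable_topology}"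
  assumes "f \<in> borel_measurable M" "\<And>t. s t \<in> borel_measurable M" "integrable M w"
    and lim: "AE x in M. ((\<lambda>t. s t x) \<longlongrightarrow> f x) (at a within S)"
    and bound: "\<forall>\<^sub>F t in at a within S. AE x in M. norm (s t x) \<le> w x"
  shows "((\<lambda>t. \<integral>x. s t x \<partial>M) \<longlongrightarrow> (\<integral>x. f x \<partial>M)) (at a within S)"
proof (unfold tendsto_at_iff_sequentially, intro allI impI)
  fix X :: "nat \<Rightarrow> 'b"
  assume X: "\<forall>i. X i \<in> S - {a}" "X \<longlonglongrightarrow> a"
  have "filterlim X (at a within S) sequentially"
    using X by (auto simp: filterlim_at)
  with bound have "\<forall>\<^sub>F n in sequentially. AE x in M. norm (s (X n) x) \<le> w x"
    by (auto simp: filterlim_iff)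
  \<comment> \<open>The bound holds only near \<open>a\<close>; the sequence is therefore shifted by
    N, and the shift is undone at the end.\<close>
  then obtain N where N: "\<And>n. n \<ge> N \<Longrightarrow> AE x in M. norm (s (X n) x) \<le> w x"
    by (auto simp: eventually_sequentially)
  have "(\<lambda>n. \<integral>x. s (X (n + N)) x \<partial>M) \<longlonglongrightarrow> (\<integral>x. f x \<partial>M)"
  proof (rule integral_dominated_convergence[where w=w])
    show "AE x in M. (\<lambda>i. s (X (i + N)) x) \<longlonglongrightarrow> f x"
      using lim
    proof eventually_elim
      case (elim x)
      then have "(\<lambda>i. s (X i) x) \<longlonglongrightarrow> f x"
        using X by (auto simp: tendsto_at_iff_sequentially o_def)
      then show ?case
        by (rule LIMSEQ_ignore_initial_segment)
    qed
  qed (use assms N in auto)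
  then show "((\<lambda>t. \<integral>x. s t x \<partial>M) \<circ> X) \<longlonglongrightarrow> (\<integral>x. f x \<partial>M)"
    unfolding o_def by (rule LIMSEQ_offset)
qed

text \<open>Fatou's lemma bounds the integral of the limit by L. Both passages from a limit to a
  finite moment rest on this: for truncated moments and for Poisson integrals along the imaginary
  axis.\<close>

lemma integrable_Fatou:
  fixes u :: "nat \<Rightarrow> 'a \<Rightarrow> real"
  assumes int: "\<And>n. integrable M (u n)" and nonneg: "\<And>n. AE x in M. 0 \<le> u n x"
    and [measurable]: "f \<in> borel_measurable M"
    and lim: "AE x in M. (\<lambda>n. u n x) \<longlonglongrightarrow> f x"
    and conv: "(\<lambda>n. \<integral>x. u n x \<partial>M) \<longlonglongrightarrow> L"
  shows "integrable M f"
proof -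
  have meas[measurable]: "u n \<in> borel_measurable M" for n
    using int by auto
  have "(\<integral>\<^sup>+x. norm (f x) \<partial>M) = (\<integral>\<^sup>+x. liminf (\<lambda>n. ennreal (u n x)) \<partial>M)"
  proof (rule nn_integral_cong_AE)
    have "AE x in M. \<forall>n. 0 \<le> u n x"
      using nonneg by (simp add: AE_all_countable)
    then show "AE x in M. ennreal (norm (f x)) = liminf (\<lambda>n. ennreal (u n x))"
      using lim
    proof eventually_elim
      case (elim x)
      then have "0 \<le> f x" by (auto intro: LIMSEQ_le_const)
      moreover have "(\<lambda>n. ennreal (u n x)) \<longlonglongrightarrow> ennreal (f x)"
        using elim by (auto intro: tendsto_ennrealI)
      ultimately show ?case
        by (simp add: lim_imp_Liminf)
    qed
  qed
  also have "\<dots> \<le> liminf (\<lambda>n. \<integral>\<^sup>+x. ennreal (u n x) \<partial>M)"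
    by (rule nn_integral_liminf) simp
  also have "\<dots> = liminf (\<lambda>n. ennreal (\<integral>x. u n x \<partial>M))"
    by (simp add: nn_integral_eq_integral int nonneg)
  also have "\<dots> = ennreal L"
    by (rule lim_imp_Liminf) (auto intro: tendsto_ennrealI conv)
  also have "\<dots> < \<infinity>" by simp
  finally show ?thesis
    by (auto simp: integrable_iff_bounded)
qed

section \<open>Positive real part in the disc\<close>

text \<open>Cauchy's formula in the angle t: the derivative \<i> * cis t of the path supplies the
  factor \<open>cis t\<close>, and \<i> cancels against 2 * pi * \<i>.\<close>

lemma has_integral_circle_Cauchy:
  fixes g :: "complex \<Rightarrow> complex"
  assumes "g holomorphic_on cball 0 1" "norm w < 1"
  shows "((\<lambda>t. g (cis t) * (cis t / (cis t - w))) has_integral (2 * pi * g w)) {0..2*pi}"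
proof -
  have "((\<lambda>u. g u / (u - w)) has_contour_integral (2 * of_real pi * \<i> * g w)) (part_circlepath 0 1 0 (2*pi))"
    using Cauchy_integral_circlepath_simple[OF assms(1), of w] assms(2) by (simp add: circlepath_def)
  then have "((\<lambda>t. g (cis t) / (cis t - w) * \<i> * cis t) has_integral (2 * of_real pi * \<i> * g w)) {0..2*pi}"
    by (subst (asm) has_contour_integral_part_circlepath_iff) auto
  then have "((\<lambda>t. (-\<i>) * (g (cis t) / (cis t - w) * \<i> * cis t)) has_integral (-\<i>) * (2 * of_real pi * \<i> * g w)) {0..2*pi}"
    by (rule has_integral_mult_right)
  then show ?thesis
    by (simp add: mult_ac)
qed

lemma cis_diff_nonzero: "norm w < 1 \<Longrightarrow> cis t - w \<noteq> 0" "norm w < 1 \<Longrightarrow> 1 - w * cis t \<noteq> 0"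
  subgoal by (metis eq_iff_diff_eq_0 less_irrefl norm_cis)
  subgoal by (metis eq_iff_diff_eq_0 less_irrefl norm_cis norm_mult norm_one mult.right_neutral)
  done

text \<open>Cauchy's kernel k = \<open>cis t / (cis t - w)\<close> reproduces f, whereas the
  conjugate of f integrates against the same kernel to the conjugate of f 0. Adding both and
  subtracting the mean of Re f leaves 2 * Re f * (k - 1/2), and 2 * k - 1 is Schwarz's
  kernel.\<close>

lemma has_integral_Schwarz:
  assumes f: "f holomorphic_on cball 0 1" and w: "norm w < 1"
  shows "((\<lambda>t. of_real (Re (f (cis t))) * ((cis t + w) / (cis t - w))) has_integral
           (2 * pi * (f w - \<i> * Im (f 0)))) {0..2*pi}"
proof -
  note nz = cis_diff_nonzero[OF w]
  have F: "((\<lambda>t. f (cis t) * (cis t / (cis t - w))) has_integral (2 * pi * f w)) {0..2*pi}"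
    by (rule has_integral_circle_Cauchy) fact+
  have F0: "((\<lambda>t. f (cis t)) has_integral (2 * pi * f 0)) {0..2*pi}"
    using has_integral_circle_Cauchy[OF f, of 0] by simp
  have nz1: "1 - cnj w * z \<noteq> 0" if "norm z \<le> 1" for z
  proof
    assume "1 - cnj w * z = 0"
    then have "norm (cnj w * z) = 1" by (metis eq_iff_diff_eq_0 norm_one)
    moreover have "norm (cnj w * z) \<le> norm w * 1"
      unfolding norm_mult using that by (intro mult_mono) auto
    ultimately show False using w by simp
  qed
  \<comment> \<open>On the circle the conjugate of \<open>cis t\<close> is its inverse, so
    conjugating 1 / (1 - cnj w * cis t) gives Cauchy's kernel at w. The unconjugated quotient is
    holomorphic on the closed disc and has value f 0 at the centre.\<close>
  have "(\<lambda>z. f z / (1 - cnj w * z)) holomorphic_on cball 0 1"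
    by (intro holomorphic_intros f) (use nz1 in auto)
  from has_integral_circle_Cauchy[OF this, of 0]
  have "((\<lambda>t. f (cis t) / (1 - cnj w * cis t)) has_integral (2 * pi * f 0)) {0..2*pi}"
    by simp
  then have "((\<lambda>t. cnj (f (cis t) / (1 - cnj w * cis t))) has_integral cnj (2 * pi * f 0)) {0..2*pi}"
    by (subst has_integral_cnj[unfolded o_def])
  moreover have "cnj (f (cis t) / (1 - cnj w * cis t)) = cnj (f (cis t)) * (cis t / (cis t - w))" for t
  proof -
    have cc: "cis t * cnj (cis t) = 1"
      by (simp add: cis_cnj cis_mult)
    moreover have "1 - w * cnj (cis t) \<noteq> 0" using nz(2)[of "-t"] by (simp add: cis_cnj)
    moreover have "cis t * (1 - w * cnj (cis t)) = cis t - w"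
      using cc by (simp add: algebra_simps)
    ultimately show ?thesis using nz(1)[of t] cc
      by (simp add: field_simps)
  qed
  ultimately have G: "((\<lambda>t. cnj (f (cis t)) * (cis t / (cis t - w))) has_integral (2 * pi * cnj (f 0))) {0..2*pi}"
    by simp
  have G0: "((\<lambda>t. cnj (f (cis t))) has_integral (2 * pi * cnj (f 0))) {0..2*pi}"
    using F0 by (subst has_integral_cnj[unfolded o_def, symmetric]) simp
  have "((\<lambda>t. f (cis t) * (cis t / (cis t - w)) + cnj (f (cis t)) * (cis t / (cis t - w))
           - (f (cis t) + cnj (f (cis t))) * (1/2)) has_integral
         (2 * pi * f w + 2 * pi * cnj (f 0) - (2 * pi * f 0 + 2 * pi * cnj (f 0)) * (1/2))) {0..2*pi}"
    by (intro has_integral_diff has_integral_add has_integral_mult_left F G F0 G0)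
  moreover have "2 * pi * f w + 2 * pi * cnj (f 0) - (2 * pi * f 0 + 2 * pi * cnj (f 0)) * (1/2)
      = 2 * pi * (f w - \<i> * Im (f 0))"
    by (simp add: complex_eq_iff algebra_simps)
  moreover have "f (cis t) * (cis t / (cis t - w)) + cnj (f (cis t)) * (cis t / (cis t - w))
           - (f (cis t) + cnj (f (cis t))) * (1/2) = of_real (Re (f (cis t))) * ((cis t + w) / (cis t - w))" for t
  proof -
    have 1: "f (cis t) * k + cnj (f (cis t)) * k - (f (cis t) + cnj (f (cis t))) * (1/2) =
        (f (cis t) + cnj (f (cis t))) * (k - 1/2)" for k
      by algebra
    have 2: "f (cis t) + cnj (f (cis t)) = 2 * of_real (Re (f (cis t)))"
      by (simp add: complex_add_cnj)
    have 3: "cis t / (cis t - w) - 1/2 = (cis t + w) / (cis t - w) * (1/2)"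
      using nz(1)[of t] by (simp add: field_simps)
    show ?thesis
      unfolding 1 3 unfolding 2 using nz(1)[of t] by (simp add: field_simps)
  qed
  ultimately show ?thesis by simp
qed


text \<open>Dividing the boundary values of Re f by their mean Re (f 0) turns them into densities of
  probability measures, to which Helly selection applies. The angle is kept as a real number, so the
  limit is a distribution on the line; the kernel only sees \<open>cis t\<close>.\<close>

lemma herglotz_disc_representation:
  assumes f: "f holomorphic_on ball 0 1" and nonneg: "\<And>w. norm w < 1 \<Longrightarrow> 0 \<le> Re (f w)"
  obtains M where "real_distribution M"
    "\<And>w. norm w < 1 \<Longrightarrow> f w = \<i> * Im (f 0) + Re (f 0) * (\<integral>t. (cis t + w) / (cis t - w) \<partial>M)"
proof -
  define m where "m = Re (f 0)"
  have m0: "0 \<le> m" using nonneg[of 0] by (simp add: m_def)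
  \<comment> \<open>Shrinking by r n < 1 makes f (r n * w) holomorphic on the closed disc, where
    Schwarz's formula is available.\<close>
  define r :: "nat \<Rightarrow> real" where "r n = 1 - inverse (real (Suc n))" for n
  have r: "0 \<le> r n" "r n < 1" for n
    by (auto simp: r_def field_simps)
  have r_lim: "r \<longlonglongrightarrow> 1"
    unfolding r_def using tendsto_diff[OF tendsto_const[of 1] LIMSEQ_inverse_real_of_nat] by simp
  define g where "g n t = Re (f (r n * cis t))" for n t
  have r_in: "norm (of_real (r n) * z) < 1" if "norm z \<le> 1" for n and z :: complex
  proof -
    have "norm (of_real (r n) * z) \<le> r n * 1"
      unfolding norm_mult using that r[of n] by (intro mult_mono) auto
    then show ?thesis using r(2)[of n] by linarith
  qed
  have g0: "0 \<le> g n t" for n t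
    unfolding g_def by (rule nonneg) (simp add: r_in)
  have fr: "(\<lambda>w. f (r n * w)) holomorphic_on cball 0 1" for n
    using r_in by (intro holomorphic_on_compose_gen[OF _ f, unfolded o_def] holomorphic_intros) auto
  have cont_g: "continuous_on UNIV (g n)" for n
  proof -
    have "continuous_on UNIV ((\<lambda>w. f (r n * w)) \<circ> cis)"
      by (intro continuous_on_compose continuous_on_subset[OF holomorphic_on_imp_continuous_on[OF fr[of n]]]
            continuous_intros continuous_on_cis) auto
    then show ?thesis unfolding g_def o_def by (intro continuous_intros)
  qed
  have meas_g[measurable]: "g n \<in> borel_measurable borel" for n
    using cont_g by (rule borel_measurable_continuous_onI)
  have gi: "((\<lambda>t. of_real (g n t) * ((cis t + w) / (cis t - w))) has_integral
       (2 * pi * (f (r n * w) - \<i> * Im (f 0)))) {0..2*pi}" if "norm w < 1" for n and w :: complex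
    using has_integral_Schwarz[OF fr[of n] that] by (simp add: g_def)
  have cont_K: "continuous_on UNIV (\<lambda>t. (cis t + w) / (cis t - w))" if "norm w < 1" for w :: complex
    by (intro continuous_intros continuous_on_cis) (use cis_diff_nonzero that in auto)
  have g_int: "integral {0..2*pi} (g n) = 2 * pi * m" for n
  proof -
    have "((\<lambda>t. of_real (g n t)) has_integral (2 * pi * (f 0 - \<i> * Im (f 0)))) {0..2*pi}"
      using gi[of 0 n] by simp
    moreover have "2 * pi * (f 0 - \<i> * Im (f 0)) = of_real (2 * pi * m)"
      by (simp add: complex_eq_iff m_def)
    ultimately have "((\<lambda>t. complex_of_real (g n t)) has_integral (of_real (2 * pi * m))) {0..2*pi}"
      by simp
    from has_integral_Re[OF this] show ?thesis by (simp add: integral_unique)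
  qed
  show ?thesis
  proof (cases "m = 0")
    case True
    have "f w = \<i> * Im (f 0)" if w: "norm w < 1" for w
    proof -
      \<comment> \<open>Continuous nonnegative boundary values with mean 0 vanish, so Schwarz's
        formula leaves only the imaginary constant.\<close>
      have "f (r n * w) = \<i> * Im (f 0)" for n
      proof -
        have "g n t = 0" if "t \<in> {0..2*pi}" for t
        proof -
          have "integral (cbox 0 (2*pi)) (g n) = 0" using g_int[of n] True by simp
          then show ?thesis
            using integral_eq_0_iff[of 0 "2*pi" "g n"] continuous_on_subset[OF cont_g[of n]] g0 that
            by auto
        qed
        then have "((\<lambda>t. of_real (g n t) * ((cis t + w) / (cis t - w))) has_integral 0) {0..2*pi}"
          by (intro has_integral_is_0) auto
        from has_integral_unique[OF this gi[OF w, of n]] show ?thesis by simp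
      qed
      moreover have "(\<lambda>n. f (r n * w)) \<longlonglongrightarrow> f (1 * w)"
      proof (rule continuous_on_tendsto_compose[OF holomorphic_on_imp_continuous_on[OF f]])
        show "(\<lambda>n. of_real (r n) * w) \<longlonglongrightarrow> 1 * w"
          using tendsto_mult[OF tendsto_of_real[OF r_lim] tendsto_const[of w]] by simp
      qed (use w r_in in auto)
      ultimately have "(\<lambda>n::nat. \<i> * Im (f 0)) \<longlonglongrightarrow> f w" by simp
      then show ?thesis
        by (rule LIMSEQ_unique) (rule tendsto_const)
    qed
    \<comment> \<open>Any distribution serves here, because it is multiplied by Re (f 0) =
      0.\<close>
    moreover have "real_distribution (return borel (0::real))"
      by (simp add: real_distribution_def real_distribution_axioms_def prob_space_return)
    ultimately show ?thesis
      using True[unfolded m_def] by (intro that[of "return borel 0"]) (assumption, simp only: of_real_0 mult_zero_left add_0_right)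
  next
    case False
    with m0 have m: "m > 0" by simp
    \<comment> \<open>By the mean value in \<open>g_int\<close> this is a probability
      density.\<close>
    define d where "d n t = indicator {0..2*pi} t * g n t / (2 * pi * m)" for n t
    have d0: "0 \<le> d n t" for n t unfolding d_def using g0 m by auto
    have meas_d[measurable]: "d n \<in> borel_measurable borel" for n
      unfolding d_def by measurable
    define \<mu> where "\<mu> n = density lborel (\<lambda>t. ennreal (d n t))" for n
    have int_\<mu>: "(\<integral>t. (cis t + w) / (cis t - w) \<partial>\<mu> n) = (f (r n * w) - \<i> * Im (f 0)) / m" if w: "norm w < 1" for n and w :: complex
    proof -
      have [measurable]: "(\<lambda>t. (cis t + w) / (cis t - w)) \<in> borel_measurable borel"
        by (rule borel_measurable_continuous_onI[OF cont_K[OF w]])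
      have "set_integrable lborel {0..2*pi} (\<lambda>t. of_real (g n t) * ((cis t + w) / (cis t - w)))"
        by (intro borel_integrable_atLeastAtMost' continuous_intros
              continuous_on_subset[OF cont_g[of n]] continuous_on_subset[OF cont_K[OF w]]) auto
      from set_borel_integral_eq_integral(2)[OF this] integral_unique[OF gi[OF w, of n]]
      have *: "(LINT t:{0..2*pi}|lborel. of_real (g n t) * ((cis t + w) / (cis t - w))) =
          2 * pi * (f (r n * w) - \<i> * Im (f 0))" by simp
      have "(\<integral>t. (cis t + w) / (cis t - w) \<partial>\<mu> n) = (\<integral>t. d n t *\<^sub>R ((cis t + w) / (cis t - w)) \<partial>lborel)"
        unfolding \<mu>_def by (rule integral_density) (use d0 in auto)
      also have "\<dots> = (\<integral>t. (1 / (2 * pi * m)) *\<^sub>R (indicator {0..2*pi} t *\<^sub>R (of_real (g n t) * ((cis t + w) / (cis t - w)))) \<partial>lborel)"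
        by (intro Bochner_Integration.integral_cong) (auto simp: d_def indicator_def scaleR_conv_of_real)
      also have "\<dots> = (1 / (2 * pi * m)) *\<^sub>R (2 * pi * (f (r n * w) - \<i> * Im (f 0)))"
        unfolding integral_scaleR_right using * by (simp add: set_lebesgue_integral_def)
      also have "\<dots> = (f (r n * w) - \<i> * Im (f 0)) / m"
        by (simp add: scaleR_conv_of_real)
      finally show ?thesis .
    qed
    have emu: "emeasure (\<mu> n) A = 1" if A: "A \<in> sets borel" "{0..2*pi} \<subseteq> A" for n A
    proof -
      have si: "set_integrable lborel {0..2*pi} (g n)"
        by (intro borel_integrable_atLeastAtMost' continuous_on_subset[OF cont_g[of n]]) auto
      then have int: "integrable lborel (d n)"
        by (simp add: d_def[abs_def] set_integrable_def)
      have "emeasure (\<mu> n) A = (\<integral>\<^sup>+t. ennreal (d n t) * indicator A t \<partial>lborel)"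
        unfolding \<mu>_def using A by (subst emeasure_density) auto
      also have "\<dots> = (\<integral>\<^sup>+t. ennreal (d n t) \<partial>lborel)"
        using A(2) by (intro nn_integral_cong) (auto simp: d_def indicator_def)
      also have "\<dots> = ennreal (\<integral>t. d n t \<partial>lborel)"
        by (rule nn_integral_eq_integral[OF int]) (use d0 in auto)
      also have "(\<integral>t. d n t \<partial>lborel) = (LINT t:{0..2*pi}|lborel. g n t) / (2 * pi * m)"
        by (simp add: d_def[abs_def] set_lebesgue_integral_def)
      also have "\<dots> = 1"
        using set_borel_integral_eq_integral(2)[OF si] g_int[of n] m by simp
      finally show ?thesis by simp
    qed
    have rd: "real_distribution (\<mu> n)" for n
    proof -
      have "prob_space (\<mu> n)"
        by (rule prob_spaceI) (use emu[of UNIV n] in \<open>simp add: \<mu>_def\<close>)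
      then show ?thesis
        by (auto simp: real_distribution_def real_distribution_axioms_def \<mu>_def)
    qed
    have "tight \<mu>"
      unfolding tight_def
    proof (intro conjI allI impI rd)
      fix e :: real assume "e > 0"
      \<comment> \<open>All mass sits on [0, 2 pi], so one interval serves every n; its open left
        end must lie below 0.\<close>
      have "measure (\<mu> n) {-1<..2*pi} > 1 - e" for n
      proof -
        have "measure (\<mu> n) {-1<..2*pi} = 1"
          unfolding measure_def by (subst emu) auto
        then show ?thesis using \<open>e > 0\<close> by simp
      qed
      moreover have "-1 < 2 * pi" using pi_gt_zero by linarith
      ultimately show "\<exists>a b. a < b \<and> (\<forall>n. measure (\<mu> n) {a<..b} > 1 - e)" by blast
    qed
    then obtain s M where s: "strict_mono (s :: nat \<Rightarrow> nat)" and M: "real_distribution M"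
      and wc: "weak_conv_m (\<mu> \<circ> id \<circ> s) M"
      using tight_imp_convergent_subsubsequence[of \<mu> id] by (auto simp: strict_mono_id)
    have "f w = \<i> * Im (f 0) + Re (f 0) * (\<integral>t. (cis t + w) / (cis t - w) \<partial>M)" if w: "norm w < 1" for w
    proof -
      have isC: "isCont (\<lambda>t. (cis t + w) / (cis t - w)) t" for t
        using cont_K[OF w] by (simp add: continuous_on_eq_continuous_at)
      have B: "norm ((cis t + w) / (cis t - w)) \<le> 2 / (1 - norm w)" for t
      proof -
        have "norm (cis t + w) \<le> 2"
          using norm_triangle_ineq[of "cis t" w] w by simp
        moreover have "norm (cis t - w) \<ge> 1 - norm w"
          using norm_triangle_ineq2[of "cis t" w] by simp
        ultimately show ?thesis
          unfolding norm_divide using w by (intro frac_le) auto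
      qed
      \<comment> \<open>For fixed w inside the disc Schwarz's kernel is bounded and continuous in t,
        which is what weak convergence requires.\<close>
      have "(\<lambda>n. \<integral>t. (cis t + w) / (cis t - w) \<partial>((\<mu> \<circ> id \<circ> s) n)) \<longlonglongrightarrow> (\<integral>t. (cis t + w) / (cis t - w) \<partial>M)"
        by (rule weak_conv_imp_integral_bdd_continuous_conv[OF _ M wc isC B]) (simp add: rd)
      then have "(\<lambda>n. (f (r (s n) * w) - \<i> * Im (f 0)) / m) \<longlonglongrightarrow> (\<integral>t. (cis t + w) / (cis t - w) \<partial>M)"
        by (simp add: int_\<mu>[OF w])
      moreover have "(\<lambda>n. f (r n * w)) \<longlonglongrightarrow> f (1 * w)"
      proof (rule continuous_on_tendsto_compose[OF holomorphic_on_imp_continuous_on[OF f]])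
        show "(\<lambda>n. of_real (r n) * w) \<longlonglongrightarrow> 1 * w"
          using tendsto_mult[OF tendsto_of_real[OF r_lim] tendsto_const[of w]] by simp
      qed (use w r_in in auto)
      then have "(\<lambda>n. f (r (s n) * w)) \<longlonglongrightarrow> f w"
        using LIMSEQ_subseq_LIMSEQ[OF _ s] by (simp add: o_def)
      then have "(\<lambda>n. (f (r (s n) * w) - \<i> * Im (f 0)) / m) \<longlonglongrightarrow> (f w - \<i> * Im (f 0)) / m"
        using m by (intro tendsto_intros) auto
      ultimately have "(\<integral>t. (cis t + w) / (cis t - w) \<partial>M) = (f w - \<i> * Im (f 0)) / m"
        by (rule LIMSEQ_unique)
      then show ?thesis using m by (simp add: m_def)
    qed
    with M show ?thesis by (rule that)
  qed
qed

section \<open>The Nevanlinna representation\<close>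

definition nevanlinna_kernel :: "complex \<Rightarrow> real \<Rightarrow> complex" where
  "nevanlinna_kernel z x = (1 + of_real x * z) / (of_real x - z)"

text \<open>The value of the kernel at x = 0 is -1/z and its limit as x goes to infinity is z, so
  \<gamma> and \<beta> are the masses at these two points. Keeping \<gamma> outside \<nu> gives
  negative powers of x their ordinary meaning almost everywhere, and it makes the representation
  symmetric under inversion.\<close>

locale nevanlinna = finite_measure \<nu> for h :: "complex \<Rightarrow> complex" and \<alpha> \<beta> \<gamma> :: real and \<nu> :: "real measure" +
  assumes sets_nu [measurable_cong]: "sets \<nu> = sets borel"
    and AE_nonzero: "AE x in \<nu>. x \<noteq> 0"
    and rep: "\<And>z::complex. 0 < Im z \<Longrightarrow> h z = \<alpha> + \<beta> * z - \<gamma> / z + (\<integral>x. nevanlinna_kernel z x \<partial>\<nu>)"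

lemma nevanlinna_kernel_measurable [measurable]: "nevanlinna_kernel z \<in> borel_measurable borel"
  unfolding nevanlinna_kernel_def by measurable

section \<open>The Cayley transform between disc and half-plane\<close>

lemma Cayley_disc: assumes "norm w < 1" shows "0 < Im (\<i> * (1 + w) / (1 - w))"
proof -
  have "w \<noteq> 1" using assms by auto
  have "(norm w)\<^sup>2 < 1" using assms by (simp add: power_less_one_iff abs_square_less_1)
  then have "(Re w)\<^sup>2 + (Im w)\<^sup>2 < 1" by (simp add: cmod_power2)
  moreover have "Im (\<i> * (1 + w) / (1 - w)) = (1 - (Re w)\<^sup>2 - (Im w)\<^sup>2) / (norm (1 - w))\<^sup>2"
    unfolding cmod_power2 by (simp add: Im_divide power2_eq_square algebra_simps)
  ultimately show ?thesis using \<open>w \<noteq> 1\<close> by simp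
qed

lemma Cayley_half_plane:
  assumes "0 < Im z"
  shows "norm ((z - \<i>) / (z + \<i>)) < 1" "\<i> * (1 + (z - \<i>) / (z + \<i>)) / (1 - (z - \<i>) / (z + \<i>)) = z"
proof -
  have nz: "z + \<i> \<noteq> 0" using assms by (auto simp: complex_eq_iff)
  have "(norm (z - \<i>))\<^sup>2 < (norm (z + \<i>))\<^sup>2"
    using assms unfolding cmod_power2 by (simp add: power2_eq_square algebra_simps)
  then have "norm (z - \<i>) < norm (z + \<i>)" by (simp add: power2_less_imp_less)
  then show "norm ((z - \<i>) / (z + \<i>)) < 1" using nz by (simp add: norm_divide)
  have "1 + (z - \<i>) / (z + \<i>) = 2 * z / (z + \<i>)" "1 - (z - \<i>) / (z + \<i>) = 2 * \<i> / (z + \<i>)"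
    using nz by (simp_all add: field_simps)
  then show "\<i> * (1 + (z - \<i>) / (z + \<i>)) / (1 - (z - \<i>) / (z + \<i>)) = z"
    using nz by simp
qed

text \<open>The Cayley map on the boundary, that is, t to -cot (t/2). Taking \<open>Re\<close> fixes
  the type before the value is known to be real; where \<open>cis t = 1\<close>, division by zero
  makes it 0.\<close>

definition circle_to_line :: "real \<Rightarrow> real" where
  "circle_to_line t = Re (\<i> * (1 + cis t) / (1 - cis t))"

lemma circle_to_line:
  assumes "cis t \<noteq> 1"
  shows "of_real (circle_to_line t) = \<i> * (1 + cis t) / (1 - cis t)"
proof -
  have "cis t * cnj (cis t) = 1" by (simp add: cis_cnj cis_mult)
  moreover have "1 - cnj (cis t) \<noteq> 0" using assms
    by (metis complex_cnj_cnj complex_cnj_one eq_iff_diff_eq_0)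
  ultimately have "cnj (\<i> * (1 + cis t) / (1 - cis t)) = \<i> * (1 + cis t) / (1 - cis t)"
    using assms by (simp add: field_simps)
  then have "\<i> * (1 + cis t) / (1 - cis t) \<in> \<real>"
    using Reals_cnj_iff by blast
  then show ?thesis unfolding circle_to_line_def by simp
qed

text \<open>Schwarz's and Nevanlinna's kernels agree up to \<i> under the Cayley map. The boundary
  points 1 and -1 correspond to infinity and 0 and produce the kernels z and -1/z of the two
  separate atoms.\<close>

lemma Schwarz_kernel_eq:
  assumes "0 < Im z"
  defines "w \<equiv> (z - \<i>) / (z + \<i>)"
  shows "\<i> * ((cis t + w) / (cis t - w)) =
    (if cis t = 1 then z else if cis t = -1 then - 1 / z else nevanlinna_kernel z (circle_to_line t))"
proof -
  have nz: "z + \<i> \<noteq> 0" "z \<noteq> 0" using assms by (auto simp: complex_eq_iff)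
  have w1: "norm w < 1" using Cayley_half_plane(1)[OF assms(1)] w_def by simp
  have *: "\<i> * ((\<zeta> + w) / (\<zeta> - w)) = \<i> * (\<zeta> * (z + \<i>) + (z - \<i>)) / (\<zeta> * (z + \<i>) - (z - \<i>))" for \<zeta>
  proof -
    have "\<zeta> + w = (\<zeta> * (z + \<i>) + (z - \<i>)) / (z + \<i>)" "\<zeta> - w = (\<zeta> * (z + \<i>) - (z - \<i>)) / (z + \<i>)"
      using nz by (simp_all add: w_def field_simps)
    then show ?thesis using nz by simp
  qed
  show ?thesis
  proof (cases "cis t = 1 \<or> cis t = -1")
    case True
    then show ?thesis
      using nz unfolding * by (auto simp: field_simps)
  next
    case False
    define \<zeta> where "\<zeta> = cis t"
    define x where "x = circle_to_line t"
    have x: "of_real x = \<i> * (1 + \<zeta>) / (1 - \<zeta>)" using circle_to_line False by (simp add: x_def \<zeta>_def)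
    have \<zeta>: "1 - \<zeta> \<noteq> 0" using False by (simp add: \<zeta>_def)
    have "cis t - w \<noteq> 0" by (rule cis_diff_nonzero(1)[OF w1])
    then have nz2: "\<zeta> * (z + \<i>) - (z - \<i>) \<noteq> 0"
      using nz by (auto simp: w_def \<zeta>_def field_simps)
    have "(1 - \<zeta>) * (of_real x - z) = \<zeta> * (z + \<i>) - (z - \<i>)"
      unfolding x using \<zeta> by (simp add: field_simps)
    moreover have "(1 - \<zeta>) * (1 + of_real x * z) = \<i> * (\<zeta> * (z + \<i>) + (z - \<i>))"
      unfolding x using \<zeta> by (simp add: field_simps)
    ultimately have "nevanlinna_kernel z x = \<i> * (\<zeta> * (z + \<i>) + (z - \<i>)) / (\<zeta> * (z + \<i>) - (z - \<i>))"
      unfolding nevanlinna_kernel_def using \<zeta> by (metis mult_divide_mult_cancel_left)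
    then show ?thesis using False unfolding * by (simp add: \<zeta>_def x_def)
  qed
qed

text \<open>Composed with the Cayley map, -\<i> * h has nonnegative real part in the disc. The
  masses over the boundary points 1 and -1 become \<beta> and \<gamma>, and the rest of the boundary
  measure is pushed to the line.\<close>

lemma herglotz_imp_nevanlinna:
  assumes "herglotz h"
  shows "\<exists>\<alpha> \<beta> \<gamma> \<nu>. nevanlinna h \<alpha> \<beta> \<gamma> \<nu>"
proof -
  have hol: "h holomorphic_on upper_half" and Im_h: "\<And>z. 0 < Im z \<Longrightarrow> 0 \<le> Im (h z)"
    using assms by (auto simp: herglotz_def upper_half_def)
  define f where "f w = - \<i> * h (\<i> * (1 + w) / (1 - w))" for w
  have "f holomorphic_on ball 0 1"
    unfolding f_def
    by (intro holomorphic_intros holomorphic_on_compose_gen[OF _ hol, unfolded o_def])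
       (use Cayley_disc in \<open>auto simp: upper_half_def\<close>)
  moreover have "0 \<le> Re (f w)" if "norm w < 1" for w
    using Im_h[OF Cayley_disc[OF that]] by (simp add: f_def)
  ultimately obtain M where rd: "real_distribution M" and M: "\<And>w. norm w < 1 \<Longrightarrow>
      f w = \<i> * Im (f 0) + Re (f 0) * (\<integral>t. (cis t + w) / (cis t - w) \<partial>M)"
    using herglotz_disc_representation[of f] by blast
  interpret M: real_distribution M by (fact rd)
  define m where "m = Re (f 0)"
  have m0: "0 \<le> m" using Im_h[of \<i>] by (simp add: m_def f_def)
  define A1 where "A1 = {t. cis t = 1}"
  define A2 where "A2 = {t. cis t = -1}"
  define B where "B = {t. cis t \<noteq> 1 \<and> cis t \<noteq> -1}"
  have [measurable]: "cis \<in> borel_measurable borel"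
    by (intro borel_measurable_continuous_onI continuous_on_cis continuous_intros)
  have [measurable]: "A1 \<in> sets borel" "A2 \<in> sets borel" "B \<in> sets borel"
    unfolding A1_def A2_def B_def by measurable
  have [measurable]: "circle_to_line \<in> borel_measurable borel"
    unfolding circle_to_line_def by measurable
  \<comment> \<open>The density removes the points over infinity and 0 and puts back the factor Re
    (f 0) that was divided out to obtain a probability measure.\<close>
  define D where "D = density M (\<lambda>t. ennreal (m * indicator B t))"
  have [measurable_cong]: "sets D = sets borel" by (simp add: D_def)
  define \<nu> where "\<nu> = distr D borel circle_to_line"
  have "emeasure \<nu> (space \<nu>) = emeasure D (space D)"
    unfolding \<nu>_def by (subst emeasure_distr) (auto)
  also have "\<dots> = (\<integral>\<^sup>+t. ennreal (m * indicator B t) \<partial>M)"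
    unfolding D_def by (subst emeasure_density) auto
  also have "\<dots> \<le> (\<integral>\<^sup>+t. ennreal m \<partial>M)"
    by (intro nn_integral_mono ennreal_leI) (simp add: indicator_def m0)
  also have "\<dots> < \<infinity>" by (simp add: M.emeasure_eq_measure ennreal_mult_less_top)
  finally have fin: "finite_measure \<nu>" by (intro finite_measureI) auto
  have "AE t in D. circle_to_line t \<noteq> 0"
    unfolding D_def
  proof (subst AE_density, simp, intro AE_I2 impI)
    fix t assume "0 < ennreal (m * indicator B t)"
    then have "t \<in> B" by (cases "t \<in> B") auto
    then have *: "cis t \<noteq> 1" "cis t \<noteq> -1" by (auto simp: B_def)
    then have "1 + cis t \<noteq> 0" by (metis add_eq_0_iff)
    then show "circle_to_line t \<noteq> 0"
      using circle_to_line[OF *(1)] * by auto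
  qed
  then have nz: "AE x in \<nu>. x \<noteq> 0"
    unfolding \<nu>_def by (subst AE_distr_iff) auto
  have "h z = of_real (- Im (f 0)) + of_real (m * measure M A1) * z - of_real (m * measure M A2) / z +
      (\<integral>x. nevanlinna_kernel z x \<partial>\<nu>)" if z: "0 < Im z" for z :: complex
  proof -
    define w where "w = (z - \<i>) / (z + \<i>)"
    have w: "norm w < 1" using Cayley_half_plane(1)[OF z] by (simp add: w_def)
    have eq: "\<i> * ((cis t + w) / (cis t - w)) = indicator A1 t *\<^sub>R z + indicator A2 t *\<^sub>R (- 1 / z) +
        indicator B t *\<^sub>R nevanlinna_kernel z (circle_to_line t)" for t
      using Schwarz_kernel_eq[OF z, of t] unfolding w_def A1_def A2_def B_def by (auto simp: indicator_def)
    have bound: "norm ((cis t + w) / (cis t - w)) \<le> 2 / (1 - norm w)" for t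
    proof -
      have "norm (cis t + w) \<le> 2"
        using norm_triangle_ineq[of "cis t" w] w by simp
      moreover have "norm (cis t - w) \<ge> 1 - norm w"
        using norm_triangle_ineq2[of "cis t" w] by simp
      ultimately show ?thesis
        unfolding norm_divide using w by (intro frac_le) auto
    qed
    \<comment> \<open>On B this is \<i> times Schwarz's kernel and inherits its bound.\<close>
    have int3: "integrable M (\<lambda>t. indicator B t *\<^sub>R nevanlinna_kernel z (circle_to_line t))"
    proof (rule M.integrable_const_bound[where B = "2 / (1 - norm w)"])
      have "norm (indicator B t *\<^sub>R nevanlinna_kernel z (circle_to_line t)) \<le> norm ((cis t + w) / (cis t - w))" for t
      proof (cases "t \<in> B")
        case True
        then have "t \<notin> A1" "t \<notin> A2" by (auto simp: A1_def A2_def B_def)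
        then have "norm (\<i> * ((cis t + w) / (cis t - w))) = norm (nevanlinna_kernel z (circle_to_line t))"
          using eq[of t] True by simp
        then show ?thesis using True by (simp add: norm_mult norm_divide)
      qed simp
      then show "AE t in M. norm (indicator B t *\<^sub>R nevanlinna_kernel z (circle_to_line t)) \<le> 2 / (1 - norm w)"
        using bound order_trans by blast
    qed measurable
    have "f w = - \<i> * h z"
      unfolding f_def w_def Cayley_half_plane(2)[OF z] ..
    then have "h z = \<i> * f w" by simp
    also have "\<dots> = of_real (- Im (f 0)) + m * (\<i> * (\<integral>t. (cis t + w) / (cis t - w) \<partial>M))"
      unfolding M[OF w] m_def by (simp add: algebra_simps)
    also have "\<i> * (\<integral>t. (cis t + w) / (cis t - w) \<partial>M) = (\<integral>t. \<i> * ((cis t + w) / (cis t - w)) \<partial>M)"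
      by (rule integral_mult_right_zero[symmetric])
    also have "\<dots> = measure M A1 *\<^sub>R z + measure M A2 *\<^sub>R (-1 / z) +
        (\<integral>t. indicator B t *\<^sub>R nevanlinna_kernel z (circle_to_line t) \<partial>M)"
      unfolding eq using int3 by (simp add: M.emeasure_eq_measure)
    also have "of_real m * \<dots> = of_real (m * measure M A1) * z - of_real (m * measure M A2) / z +
       m *\<^sub>R (\<integral>t. indicator B t *\<^sub>R nevanlinna_kernel z (circle_to_line t) \<partial>M)"
      by (simp add: scaleR_conv_of_real algebra_simps)
    also have "m *\<^sub>R (\<integral>t. indicator B t *\<^sub>R nevanlinna_kernel z (circle_to_line t) \<partial>M) =
        (\<integral>t. (m * indicator B t) *\<^sub>R nevanlinna_kernel z (circle_to_line t) \<partial>M)"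
      by (simp flip: scaleR_scaleR)
    also have "\<dots> = (\<integral>t. nevanlinna_kernel z (circle_to_line t) \<partial>D)"
      unfolding D_def by (rule integral_density[symmetric]) (use m0 in \<open>auto simp: indicator_def\<close>)
    also have "\<dots> = (\<integral>x. nevanlinna_kernel z x \<partial>\<nu>)"
      unfolding \<nu>_def by (rule integral_distr[symmetric]) auto
    finally show ?thesis by (simp add: algebra_simps)
  qed
  moreover have "sets \<nu> = sets borel" by (simp add: \<nu>_def)
  ultimately have "nevanlinna h (- Im (f 0)) (m * measure M A1) (m * measure M A2) \<nu>"
    using fin nz by (simp add: nevanlinna_def nevanlinna_axioms_def)
  then show ?thesis by blast
qed

section \<open>Poisson kernels on truncated lines\<close>

lemma power_int_measurable [measurable]: "(\<lambda>x::real. x powi k) \<in> borel_measurable borel"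
  unfolding power_int_def by (cases "k \<ge> 0") auto

lemma integrable_Cauchy: "integrable lborel (\<lambda>s::real. 1 / (1 + s\<^sup>2))"
  and integral_Cauchy: "(\<integral>s. 1 / (1 + s\<^sup>2) \<partial>lborel) = pi"
  using integrable_inverse_1_plus_square LBINT_inverse_1_plus_square
  by (simp_all add: set_integrable_def interval_lebesgue_integral_def set_lebesgue_integral_def
      einterval_def inverse_eq_divide)

text \<open>The two halves are the source of the weight 1/2 at the end points of the truncated
  line.\<close>

lemma integral_Cauchy_half:
  "(\<integral>s. indicator {0<..} s * (1 / (1 + s\<^sup>2)) \<partial>lborel) = pi / 2"
  "(\<integral>s. indicator {..<0} s * (1 / (1 + s\<^sup>2)) \<partial>lborel) = pi / 2"
proof -
  show 1: "(\<integral>s. indicator {0<..} s * (1 / (1 + s\<^sup>2)) \<partial>lborel) = pi / 2"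
    using LBINT_I0i_1_div_plus_square
    by (simp add: interval_lebesgue_integral_def set_lebesgue_integral_def einterval_def
        zero_ereal_def greaterThan_def)
  have "(\<integral>s. indicator {..<0} s * (1 / (1 + (s::real)\<^sup>2)) \<partial>lborel) =
     \<bar>-1\<bar> *\<^sub>R (\<integral>s. indicator {..<0} (0 + -1 * s) * (1 / (1 + (0 + -1 * s)\<^sup>2)) \<partial>lborel)"
    by (rule lborel_integral_real_affine) simp
  also have "\<dots> = (\<integral>s. indicator {0<..} s * (1 / (1 + s\<^sup>2)) \<partial>lborel)"
    by (simp add: indicator_def)
  finally show "(\<integral>s. indicator {..<0} s * (1 / (1 + s\<^sup>2)) \<partial>lborel) = pi / 2"
    using 1 by simp
qed

text \<open>The Poisson kernel of the half-plane without its factor 1/pi; its total mass is pi,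
  which the factor 1/pi in the identities compensates.\<close>

definition poisson :: "real \<Rightarrow> real \<Rightarrow> real \<Rightarrow> real" where
  "poisson y t x = y / ((x - t)\<^sup>2 + y\<^sup>2)"

lemma poisson_measurable [measurable (raw)]:
  assumes [measurable]: "f \<in> borel_measurable M" "g \<in> borel_measurable M"
  shows "(\<lambda>w. poisson y (f w) (g w)) \<in> borel_measurable M"
  unfolding poisson_def by measurable

lemma poisson_nonneg: "0 < y \<Longrightarrow> 0 \<le> poisson y t x"
  by (simp add: poisson_def)

lemma poisson_le: "0 < y \<Longrightarrow> poisson y t x \<le> 1 / y"
proof -
  assume y: "0 < y"
  have "y / ((x - t)\<^sup>2 + y\<^sup>2) \<le> y / y\<^sup>2"
    using y by (intro divide_left_mono) (auto intro!: mult_pos_pos add_nonneg_pos)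
  then show ?thesis using y by (simp add: poisson_def power2_eq_square)
qed

text \<open>
  The growth of $1 + x^2$ is absorbed by the decay of the kernel; this gives a bound uniform in $x$
  and in small $y$ for the dominated convergence in the Stieltjes inversion.
\<close>

lemma poisson_growth:
  assumes "0 < y" "\<bar>t\<bar> \<le> R"
  shows "(1 + x\<^sup>2) * poisson y t x \<le> (1 + 2 * R\<^sup>2) * poisson y t x + 2 * y"
proof -
  have "0 \<le> (x - 2 * t)\<^sup>2" by simp
  then have "x\<^sup>2 \<le> 2 * t\<^sup>2 + 2 * (x - t)\<^sup>2" by (simp add: power2_eq_square algebra_simps)
  moreover have "t\<^sup>2 \<le> R\<^sup>2" using assms(2) by (metis abs_ge_zero power2_abs power_mono)
  ultimately have "1 + x\<^sup>2 \<le> (1 + 2 * R\<^sup>2) + 2 * (x - t)\<^sup>2" by linarith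
  from mult_right_mono[OF this poisson_nonneg[OF assms(1), of t x]]
  have "(1 + x\<^sup>2) * poisson y t x \<le> (1 + 2 * R\<^sup>2) * poisson y t x + 2 * ((x - t)\<^sup>2 * poisson y t x)"
    by (simp add: algebra_simps)
  moreover have "(x - t)\<^sup>2 * poisson y t x \<le> y"
  proof -
    have "0 < (x - t)\<^sup>2 + y\<^sup>2" using assms by (auto intro: add_nonneg_pos)
    then show ?thesis
      unfolding poisson_def using assms by (simp add: field_simps mult_right_mono)
  qed
  ultimately show ?thesis by linarith
qed

lemma poisson_substitution:
  assumes "0 < y"
  shows "y * poisson y (x + y * s) x = 1 / (1 + s\<^sup>2)"
proof -
  have "(x - (x + y * s))\<^sup>2 + y\<^sup>2 = y\<^sup>2 * (1 + s\<^sup>2)" by (simp add: power2_eq_square algebra_simps)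
  then show ?thesis using assms by (simp add: poisson_def power2_eq_square)
qed

text \<open>With t = x + y * s the dependence on y moves from the kernel into the argument of
  \<psi>, so dominated convergence can use the fixed density 1 / (1 + s^2).\<close>

lemma integral_poisson_substitution:
  assumes "0 < y"
  shows "(\<integral>t. \<psi> t * poisson y t x \<partial>lborel) = (\<integral>s. \<psi> (x + y * s) * (1 / (1 + s\<^sup>2)) \<partial>lborel)"
proof -
  have "(\<integral>t. \<psi> t * poisson y t x \<partial>lborel) =
      \<bar>y\<bar> *\<^sub>R (\<integral>s. \<psi> (x + y * s) * poisson y (x + y * s) x \<partial>lborel)"
    using assms by (intro lborel_integral_real_affine) simp
  also have "\<dots> = (\<integral>s. \<psi> (x + y * s) * (y * poisson y (x + y * s) x) \<partial>lborel)"
    using assms by (simp flip: integral_mult_right_zero) (simp add: algebra_simps)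
  finally show ?thesis by (simp only: poisson_substitution[OF assms])
qed

lemma integrable_poisson: "0 < y \<Longrightarrow> integrable lborel (\<lambda>t. poisson y t x)"
proof -
  assume y: "0 < y"
  have "integrable lborel (\<lambda>s. poisson y (x + y * s) x)"
  proof -
    have "integrable lborel (\<lambda>s::real. (1 / y) * (1 / (1 + s\<^sup>2)))"
      by (intro integrable_mult_right integrable_Cauchy)
    then show ?thesis
      using y by (simp flip: poisson_substitution[OF y, of x])
  qed
  then show ?thesis
    using lborel_integrable_real_affine_iff[of y "\<lambda>t. poisson y t x" x] y by simp
qed

lemma integral_poisson: "0 < y \<Longrightarrow> (\<integral>t. poisson y t x \<partial>lborel) = pi"
  using integral_poisson_substitution[of y "\<lambda>_. 1" x] integral_Cauchy by simp

section \<open>Truncated lines and their end points\<close>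

lemma less_one_divide_self:
  fixes \<epsilon> :: real
  assumes "0 < \<epsilon>" "\<epsilon> < 1"
  shows "\<epsilon> < 1 / \<epsilon>"
proof -
  have "\<epsilon> * \<epsilon> < 1 * 1" using assms by (intro mult_strict_mono) auto
  then show ?thesis using assms by (simp add: field_simps)
qed

definition truncated_line :: "real \<Rightarrow> real set" where
  "truncated_line \<epsilon> = {x. \<epsilon> < \<bar>x\<bar> \<and> \<bar>x\<bar> < 1 / \<epsilon>}"

text \<open>At an end point only half of the mass of the Poisson kernel falls into the truncated line.\<close>

definition truncation_weight :: "real \<Rightarrow> real \<Rightarrow> real" where
  "truncation_weight \<epsilon> x =
     (if x \<in> truncated_line \<epsilon> then 1 else if \<bar>x\<bar> = \<epsilon> \<or> \<bar>x\<bar> = 1 / \<epsilon> then 1/2 else 0)"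

lemma truncated_line_sets [measurable]: "truncated_line \<epsilon> \<in> sets borel"
  unfolding truncated_line_def by measurable

lemma truncation_weight_measurable [measurable]: "truncation_weight \<epsilon> \<in> borel_measurable borel"
  unfolding truncation_weight_def by measurable

lemma truncation_weight_bounds: "0 \<le> truncation_weight \<epsilon> x" "truncation_weight \<epsilon> x \<le> 1"
  by (auto simp: truncation_weight_def)

lemma truncation_weight_0: "0 < \<epsilon> \<Longrightarrow> truncation_weight \<epsilon> 0 = 0"
  by (auto simp: truncation_weight_def truncated_line_def)

lemma truncation_weight_tendsto:
  assumes "x \<noteq> 0"
  shows "((\<lambda>\<epsilon>. truncation_weight \<epsilon> x) \<longlongrightarrow> 1) (at_right 0)"
proof (rule tendsto_eventually)
  have "0 < min \<bar>x\<bar> (1 / \<bar>x\<bar>)" using assms by simp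
  then have "\<forall>\<^sub>F \<epsilon> in at_right 0. \<epsilon> < min \<bar>x\<bar> (1 / \<bar>x\<bar>)"
    by (intro order_tendstoD(2)[of _ 0]) auto
  then show "\<forall>\<^sub>F \<epsilon> in at_right 0. truncation_weight \<epsilon> x = 1"
    using eventually_at_right_less[of 0]
  proof eventually_elim
    case (elim \<epsilon>)
    then have "x \<in> truncated_line \<epsilon>"
      using assms by (auto simp: truncated_line_def field_simps)
    then show ?case by (simp add: truncation_weight_def)
  qed
qed

text \<open>The set lies to the right of e and of -E and to the left of -e and of E. The bound on u
  keeps the shifted point from reaching another end point.\<close>

lemma indicator_truncated_line_shift:
  fixes e E u x :: real
  assumes e: "0 < e" "e < E" and u: "\<bar>u\<bar> < min e (E - e)" "u \<noteq> 0"
    and x: "x = e \<or> x = - e \<or> x = E \<or> x = - E"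
  shows "(e < \<bar>x + u\<bar> \<and> \<bar>x + u\<bar> < E) \<longleftrightarrow> (if x = e \<or> x = - E then 0 < u else u < 0)"
  using assms by (smt (verit))

text \<open>After rescaling, the indicator of the truncated line at x + y * s tends to 1 inside, to
  0 outside, and at an end point to the indicator of a half-line in s. Integration against 1 / (1 +
  s^2) gives pi, 0 and pi/2.\<close>

lemma poisson_truncated_tendsto:
  assumes \<epsilon>: "0 < \<epsilon>" "\<epsilon> < 1"
    and [measurable]: "\<phi> \<in> borel_measurable borel"
    and cont: "\<And>x. x \<noteq> 0 \<Longrightarrow> isCont \<phi> x"
    and C: "\<And>t. t \<in> truncated_line \<epsilon> \<Longrightarrow> \<bar>\<phi> t\<bar> \<le> C"
  shows "((\<lambda>y. \<integral>t. (indicator (truncated_line \<epsilon>) t * \<phi> t) * poisson y t x \<partial>lborel) \<longlongrightarrow>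
     pi * (truncation_weight \<epsilon> x * \<phi> x)) (at_right 0)"
proof -
  define A where "A = truncated_line \<epsilon>"
  have [measurable]: "A \<in> sets borel" by (simp add: A_def)
  note \<epsilon>1 = less_one_divide_self[OF \<epsilon>]
  define e :: "real \<Rightarrow> real" where "e s = (if x \<in> A then 1 else if x = \<epsilon> \<or> x = - (1/\<epsilon>) then indicator {0<..} s
     else if x = - \<epsilon> \<or> x = 1 / \<epsilon> then indicator {..<0} s else 0)" for s
  have [measurable]: "e \<in> borel_measurable borel" unfolding e_def by measurable
  have ev: "\<forall>\<^sub>F y in at_right 0. indicator A (x + y * s) = e s" if s: "s \<noteq> 0" for s
  proof -
    have lim: "((\<lambda>y. x + y * s) \<longlongrightarrow> x) (at_right 0)"
      by (rule tendsto_eq_intros tendsto_ident_at | simp)+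
    have "open A"
      unfolding A_def truncated_line_def by (intro open_Collect_conj open_Collect_less continuous_intros)
    have "open {x. \<bar>x\<bar> < \<epsilon> \<or> \<bar>x\<bar> > 1/\<epsilon>}"
      by (intro open_Collect_disj open_Collect_less continuous_intros)
    consider "x \<in> A" | "\<bar>x\<bar> < \<epsilon> \<or> \<bar>x\<bar> > 1/\<epsilon>" | "x = \<epsilon> \<or> x = - \<epsilon> \<or> x = 1/\<epsilon> \<or> x = - (1/\<epsilon>)"
      unfolding A_def truncated_line_def mem_Collect_eq by (smt (verit))
    then show ?thesis
    proof cases
      case 1
      from topological_tendstoD[OF lim \<open>open A\<close> this] show ?thesis
        by eventually_elim (use 1 in \<open>simp add: e_def\<close>)
    next
      case 2
      from topological_tendstoD[OF lim \<open>open {x. _}\<close>] 2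
      have "\<forall>\<^sub>F y in at_right 0. \<bar>x + y * s\<bar> < \<epsilon> \<or> \<bar>x + y * s\<bar> > 1/\<epsilon>" by simp
      then show ?thesis
        by eventually_elim (use 2 \<epsilon> \<epsilon>1 in \<open>auto simp: e_def A_def truncated_line_def\<close>)
    next
      case 3
      have "((\<lambda>y. \<bar>y * s\<bar>) \<longlongrightarrow> 0) (at_right 0)"
        by (rule tendsto_eq_intros tendsto_ident_at | simp)+
      then have "\<forall>\<^sub>F y in at_right 0. \<bar>y * s\<bar> < min \<epsilon> (1/\<epsilon> - \<epsilon>)"
        by (rule order_tendstoD) (use \<epsilon> \<epsilon>1 in auto)
      then show ?thesis
        using eventually_at_right_less[of 0]
      proof eventually_elim
        case (elim y)
        have "x \<notin> A" using 3 \<epsilon> by (auto simp: A_def truncated_line_def)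
        have "y * s \<noteq> 0" using elim s by simp
        have "x + y * s \<in> A \<longleftrightarrow> (if x = \<epsilon> \<or> x = - (1/\<epsilon>) then 0 < y * s else y * s < 0)"
          unfolding A_def truncated_line_def mem_Collect_eq
          by (rule indicator_truncated_line_shift[OF \<epsilon>(1) \<epsilon>1 elim(1) \<open>y * s \<noteq> 0\<close> 3])
        moreover have "0 < y * s \<longleftrightarrow> 0 < s" "y * s < 0 \<longleftrightarrow> s < 0"
          using elim by (auto simp: zero_less_mult_iff mult_less_0_iff)
        ultimately show ?case
          using 3 \<open>x \<notin> A\<close> by (auto simp: e_def indicator_def)
      qed
    qed
  qed
  have C0: "0 \<le> C"
  proof -
    have "1 \<in> truncated_line \<epsilon>" using \<epsilon> by (simp add: truncated_line_def)
    from C[OF this] show ?thesis by linarith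
  qed
  have "((\<lambda>y. \<integral>s. (indicator A (x + y * s) * \<phi> (x + y * s)) * (1 / (1 + s\<^sup>2)) \<partial>lborel) \<longlongrightarrow>
      (\<integral>s. (e s * \<phi> x) * (1 / (1 + s\<^sup>2)) \<partial>lborel)) (at_right 0)"
  proof (rule integral_dominated_convergence_within[where w = "\<lambda>s. C * (1 / (1 + s\<^sup>2))"])
    show "integrable lborel (\<lambda>s::real. C * (1 / (1 + s\<^sup>2)))"
      by (intro integrable_mult_right integrable_Cauchy)
    have "norm ((indicator A (x + y * s) * \<phi> (x + y * s)) * (1 / (1 + s\<^sup>2))) \<le> C * (1 / (1 + s\<^sup>2))" for y s
    proof -
      have "\<bar>indicator A (x + y * s) * \<phi> (x + y * s)\<bar> \<le> C"
        using C[of "x + y * s"] C0 by (auto simp: indicator_def A_def)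
      then have "\<bar>indicator A (x + y * s) * \<phi> (x + y * s)\<bar> * (1 / (1 + s\<^sup>2)) \<le> C * (1 / (1 + s\<^sup>2))"
        by (intro mult_right_mono) auto
      moreover have "\<bar>1 / (1 + s\<^sup>2)\<bar> = 1 / (1 + s\<^sup>2)" by (intro abs_of_nonneg) auto
      ultimately show ?thesis unfolding real_norm_def abs_mult by simp
    qed
    then show "\<forall>\<^sub>F y in at_right 0. AE s in lborel.
        norm ((indicator A (x + y * s) * \<phi> (x + y * s)) * (1 / (1 + s\<^sup>2))) \<le> C * (1 / (1 + s\<^sup>2))"
      by simp
    have lims: "((\<lambda>y. (indicator A (x + y * s) * \<phi> (x + y * s)) * (1 / (1 + s\<^sup>2))) \<longlongrightarrow>
          (e s * \<phi> x) * (1 / (1 + s\<^sup>2))) (at_right 0)" if "s \<noteq> 0" for s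
    \<comment> \<open>\<phi> may be discontinuous at 0, as negative powers are; there the indicator
      vanishes for all small y, and no limit of \<phi> is taken.\<close>
    proof (cases "x = 0")
      case True
      then have "e s = 0" using \<epsilon> by (auto simp: e_def A_def truncated_line_def)
      have "\<forall>\<^sub>F y in at_right 0. (indicator A (x + y * s) * \<phi> (x + y * s)) * (1 / (1 + s\<^sup>2)) =
          (e s * \<phi> x) * (1 / (1 + s\<^sup>2))"
        using ev[OF that] by eventually_elim (simp add: \<open>e s = 0\<close>)
      then show ?thesis by (rule tendsto_eventually)
    next
      case False
      have "((\<lambda>y. x + y * s) \<longlongrightarrow> x) (at_right 0)"
        by (rule tendsto_eq_intros tendsto_ident_at | simp)+
      then have "((\<lambda>y. \<phi> (x + y * s)) \<longlongrightarrow> \<phi> x) (at_right 0)"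
        by (rule isCont_tendsto_compose[OF cont[OF False]])
      moreover have "((\<lambda>y. indicator A (x + y * s)) \<longlongrightarrow> e s) (at_right 0)"
        by (rule tendsto_eventually[OF ev[OF that]])
      ultimately show ?thesis by (intro tendsto_mult tendsto_const)
    qed
    show "AE s in lborel. ((\<lambda>y. (indicator A (x + y * s) * \<phi> (x + y * s)) * (1 / (1 + s\<^sup>2))) \<longlongrightarrow>
          (e s * \<phi> x) * (1 / (1 + s\<^sup>2))) (at_right 0)"
      using AE_lborel_singleton[of "0::real"] by eventually_elim (rule lims)
  qed measurable
  moreover have "(\<integral>s. (e s * \<phi> x) * (1 / (1 + s\<^sup>2)) \<partial>lborel) = \<phi> x * (\<integral>s. e s * (1 / (1 + s\<^sup>2)) \<partial>lborel)"
    by (subst integral_mult_right_zero[symmetric]) (simp add: algebra_simps)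
  moreover have "(\<integral>s. e s * (1 / (1 + s\<^sup>2)) \<partial>lborel) = pi * truncation_weight \<epsilon> x"
  proof -
    have "0 < 1 / \<epsilon>" using \<epsilon> by simp
    then have weight: "truncation_weight \<epsilon> x =
        (if x \<in> A then 1 else if x = \<epsilon> \<or> x = - (1/\<epsilon>) \<or> x = - \<epsilon> \<or> x = 1 / \<epsilon> then 1/2 else 0)"
      using \<epsilon> unfolding truncation_weight_def A_def[symmetric] by (smt (verit))
    have "x \<in> A \<or> (x \<notin> A \<and> (x = \<epsilon> \<or> x = - (1/\<epsilon>))) \<or>
        (x \<notin> A \<and> \<not> (x = \<epsilon> \<or> x = - (1/\<epsilon>)) \<and> (x = - \<epsilon> \<or> x = 1 / \<epsilon>)) \<or>
        (x \<notin> A \<and> \<not> (x = \<epsilon> \<or> x = - (1/\<epsilon>)) \<and> \<not> (x = - \<epsilon> \<or> x = 1 / \<epsilon>))"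
      by blast
    then show ?thesis
      using integral_Cauchy integral_Cauchy_half
      by (elim disjE) (simp_all add: weight e_def[abs_def], blast)
  qed
  ultimately have "((\<lambda>y. \<integral>s. (indicator A (x + y * s) * \<phi> (x + y * s)) * (1 / (1 + s\<^sup>2)) \<partial>lborel) \<longlongrightarrow>
      pi * (truncation_weight \<epsilon> x * \<phi> x)) (at_right 0)"
    by (simp add: algebra_simps)
  moreover have "\<forall>\<^sub>F y in at_right 0. (\<integral>s. (indicator A (x + y * s) * \<phi> (x + y * s)) * (1 / (1 + s\<^sup>2)) \<partial>lborel) =
      (\<integral>t. (indicator A t * \<phi> t) * poisson y t x \<partial>lborel)"
    using eventually_at_right_less[of 0]
    by eventually_elim (simp add: integral_poisson_substitution)
  ultimately show ?thesis
    unfolding A_def by (rule Lim_transform_eventually)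
qed

section \<open>Stieltjes inversion\<close>

text \<open>In the first form everything but 1 / (x - z) is real, so the imaginary part can be read
  off; the second form is bounded uniformly in x.\<close>

lemma nevanlinna_kernel_eq:
  assumes "0 < Im z"
  shows "nevanlinna_kernel z x = (1 + (of_real x)\<^sup>2) / (of_real x - z) - of_real x"
    and "nevanlinna_kernel z x = z + (1 + z\<^sup>2) / (of_real x - z)"
proof -
  have "of_real x - z \<noteq> 0" using assms by (auto simp: complex_eq_iff)
  then show "nevanlinna_kernel z x = (1 + (of_real x)\<^sup>2) / (of_real x - z) - of_real x"
    and "nevanlinna_kernel z x = z + (1 + z\<^sup>2) / (of_real x - z)"
    by (simp_all add: nevanlinna_kernel_def field_simps power2_eq_square)
qed

lemma Im_inverse_diff: "0 < y \<Longrightarrow> Im (1 / (of_real x - Complex t y)) = poisson y t x"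
  by (simp add: Im_divide poisson_def)

lemma Im_nevanlinna_kernel:
  assumes "0 < y"
  shows "Im (nevanlinna_kernel (Complex t y) x) = (1 + x\<^sup>2) * poisson y t x"
proof -
  have eq: "nevanlinna_kernel (Complex t y) x = of_real (1 + x\<^sup>2) * (1 / (of_real x - Complex t y)) - of_real x"
    using nevanlinna_kernel_eq(1)[of "Complex t y" x] assms by simp
  show ?thesis
    unfolding eq minus_complex.sel times_complex.sel Re_complex_of_real Im_complex_of_real Im_inverse_diff[OF assms]
    by simp
qed

lemma Im_le_norm_diff: "0 < Im z \<Longrightarrow> Im z \<le> norm (of_real x - z)"
  using abs_Im_le_cmod[of "of_real x - z"] by simp

lemma norm_nevanlinna_kernel_le:
  assumes "0 < Im z"
  shows "norm (nevanlinna_kernel z x) \<le> norm z + (1 + (norm z)\<^sup>2) / Im z"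
proof -
  have "norm (1 + z\<^sup>2) \<le> 1 + (norm z)\<^sup>2"
    using norm_triangle_ineq[of 1 "z\<^sup>2"] by (simp add: norm_power)
  then have "norm ((1 + z\<^sup>2) / (of_real x - z)) \<le> (1 + (norm z)\<^sup>2) / Im z"
    unfolding norm_divide using Im_le_norm_diff[OF assms, of x] assms by (intro frac_le) auto
  then show ?thesis
    unfolding nevanlinna_kernel_eq(2)[OF assms] using norm_triangle_ineq order_trans by (smt (verit))
qed

lemma truncated_line_bounded: "0 < \<epsilon> \<Longrightarrow> x \<in> truncated_line \<epsilon> \<Longrightarrow> \<bar>x\<bar> \<le> 1 / \<epsilon>"
  by (simp add: truncated_line_def)

lemma emeasure_truncated_line: "0 < \<epsilon> \<Longrightarrow> emeasure lborel (truncated_line \<epsilon>) < \<infinity>"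
proof -
  assume "0 < \<epsilon>"
  then have "emeasure lborel (truncated_line \<epsilon>) \<le> emeasure lborel {- (1/\<epsilon>)..1/\<epsilon>}"
    by (intro emeasure_mono) (auto simp: truncated_line_def)
  also have "\<dots> < \<infinity>" using \<open>0 < \<epsilon>\<close> by simp
  finally show ?thesis .
qed

lemma integrable_truncated_line:
  fixes f :: "real \<Rightarrow> real"
  assumes "0 < \<epsilon>" and [measurable]: "f \<in> borel_measurable borel"
    and "\<And>t. t \<in> truncated_line \<epsilon> \<Longrightarrow> \<bar>f t\<bar> \<le> C"
  shows "integrable lborel (\<lambda>t. indicator (truncated_line \<epsilon>) t * f t)"
proof (rule Bochner_Integration.integrable_bound[where f = "\<lambda>t. indicator (truncated_line \<epsilon>) t * C"])
  show "integrable lborel (\<lambda>t. indicator (truncated_line \<epsilon>) t * C)"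
    using emeasure_truncated_line[OF assms(1)]
    by (intro integrable_mult_left integrable_real_indicator) auto
  show "AE x in lborel. norm (indicator (truncated_line \<epsilon>) x * f x) \<le> norm (indicator (truncated_line \<epsilon>) x * C)"
    using assms(3) by (intro AE_I2) (auto simp: indicator_def intro: order_trans[OF _ abs_ge_self])
qed measurable

lemma abs_power_int_truncated_le:
  assumes \<epsilon>: "0 < \<epsilon>" and t: "t \<in> truncated_line \<epsilon>"
  shows "\<bar>t powi k\<bar> \<le> (1 / \<epsilon>) ^ nat \<bar>k\<bar>"
proof -
  have t': "\<epsilon> < \<bar>t\<bar>" "\<bar>t\<bar> < 1 / \<epsilon>" using t by (auto simp: truncated_line_def)
  show ?thesis
  proof (cases "k \<ge> 0")
    case True
    then have "\<bar>t powi k\<bar> = \<bar>t\<bar> ^ nat \<bar>k\<bar>" by (simp add: power_int_def power_abs)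
    also have "\<dots> \<le> (1 / \<epsilon>) ^ nat \<bar>k\<bar>" using t' by (intro power_mono) auto
    finally show ?thesis .
  next
    case False
    then have "\<bar>t powi k\<bar> = (1 / \<bar>t\<bar>) ^ nat \<bar>k\<bar>"
      by (simp add: power_int_def power_abs inverse_eq_divide power_divide)
    also have "\<dots> \<le> (1 / \<epsilon>) ^ nat \<bar>k\<bar>"
      using t' \<epsilon> by (intro power_mono divide_left_mono) auto
    finally show ?thesis .
  qed
qed

lemma truncation_weight_nonzero:
  assumes "0 < \<epsilon>" "\<epsilon> < 1" "truncation_weight \<epsilon> x \<noteq> 0"
  shows "\<epsilon> \<le> \<bar>x\<bar>" "\<bar>x\<bar> \<le> 1 / \<epsilon>"
  using assms(3) less_one_divide_self[OF assms(1,2)]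
  by (auto simp: truncation_weight_def truncated_line_def split: if_splits)

section \<open>Inner limits and truncated moments of one function\<close>

context nevanlinna
begin

lemma integrable_kernel: "0 < Im z \<Longrightarrow> integrable \<nu> (nevanlinna_kernel z)"
  by (rule integrable_const_bound[OF AE_I2[OF norm_nevanlinna_kernel_le]]) auto

lemma Im_eq:
  assumes y: "0 < y"
  shows "Im (h (Complex t y)) = \<beta> * y + \<gamma> * poisson y t 0 + (\<integral>x. (1 + x\<^sup>2) * poisson y t x \<partial>\<nu>)"
proof -
  define z where "z = Complex t y"
  have z: "0 < Im z" using y by (simp add: z_def)
  have "Im (h z) = \<beta> * y + Im (- (\<gamma> / z)) + Im (\<integral>x. nevanlinna_kernel z x \<partial>\<nu>)"
    unfolding rep[OF z] by (simp add: z_def)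
  also have "Im (- (\<gamma> / z)) = \<gamma> * poisson y t 0"
    by (simp add: z_def Im_divide poisson_def)
  also have "Im (\<integral>x. nevanlinna_kernel z x \<partial>\<nu>) = (\<integral>x. Im (nevanlinna_kernel z x) \<partial>\<nu>)"
    using integrable_kernel[OF z] by simp
  finally show ?thesis
    unfolding z_def by (simp add: Im_nevanlinna_kernel[OF y])
qed

text \<open>Fubini for the Poisson representation of Im h. The weight 1 + x^2 need not be
  \<nu>-integrable, but for t in a bounded set the Poisson kernel makes up for it.\<close>

lemma truncated_integral:
  assumes \<epsilon>: "0 < \<epsilon>" and y: "0 < y" and \<phi>[measurable]: "\<phi> \<in> borel_measurable borel"
    and C: "\<And>t. t \<in> truncated_line \<epsilon> \<Longrightarrow> \<bar>\<phi> t\<bar> \<le> C"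
  shows "integrable lborel (\<lambda>t. indicator (truncated_line \<epsilon>) t * (\<phi> t * Im (h (Complex t y))))" (is ?int)
    and "(\<integral>t. indicator (truncated_line \<epsilon>) t * (\<phi> t * Im (h (Complex t y))) \<partial>lborel) =
      y * (\<beta> * (\<integral>t. indicator (truncated_line \<epsilon>) t * \<phi> t \<partial>lborel)) +
      \<gamma> * (\<integral>t. (indicator (truncated_line \<epsilon>) t * \<phi> t) * poisson y t 0 \<partial>lborel) +
      (\<integral>x. (1 + x\<^sup>2) * (\<integral>t. (indicator (truncated_line \<epsilon>) t * \<phi> t) * poisson y t x \<partial>lborel) \<partial>\<nu>)" (is ?eq)
proof -
  define A where "A = truncated_line \<epsilon>"
  have [measurable]: "A \<in> sets borel" by (simp add: A_def)
  interpret pair_sigma_finite lborel \<nu> by standard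
  define f where "f t x = (indicator A t * \<phi> t) * ((1 + x\<^sup>2) * poisson y t x)" for t x
  \<comment> \<open>This is \<open>poisson_growth\<close> for |t| at most 1/\<epsilon>, with the
    crude bound 1/y for the kernel; here y is fixed.\<close>
  define D where "D = C * ((1 + 2 * (1/\<epsilon>)\<^sup>2) * (1 / y) + 2 * y)"
  have f_meas[measurable]: "case_prod f \<in> borel_measurable (lborel \<Otimes>\<^sub>M \<nu>)"
    unfolding f_def by measurable
  have bound: "\<bar>f t x\<bar> \<le> indicator A t * D" for t x
  proof (cases "t \<in> A")
    case True
    then have t: "\<bar>t\<bar> \<le> 1 / \<epsilon>" using truncated_line_bounded[OF \<epsilon>] by (simp add: A_def)
    have nn: "0 \<le> (1 + x\<^sup>2) * poisson y t x" using poisson_nonneg[OF y] by simp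
    have "(1 + x\<^sup>2) * poisson y t x \<le> (1 + 2 * (1/\<epsilon>)\<^sup>2) * poisson y t x + 2 * y"
      by (rule poisson_growth[OF y t])
    also have "\<dots> \<le> (1 + 2 * (1/\<epsilon>)\<^sup>2) * (1 / y) + 2 * y"
      by (intro add_right_mono mult_left_mono poisson_le[OF y]) auto
    finally have "\<bar>\<phi> t\<bar> * ((1 + x\<^sup>2) * poisson y t x) \<le> D"
      unfolding D_def using C[of t] True nn by (intro mult_mono) (auto simp: A_def)
    then show ?thesis using True poisson_nonneg[OF y, of t x] by (simp add: f_def abs_mult)
  qed (simp add: f_def)
  have int_f: "integrable (lborel \<Otimes>\<^sub>M \<nu>) (case_prod f)"
  proof (rule Bochner_Integration.integrable_bound)
    show "integrable (lborel \<Otimes>\<^sub>M \<nu>) (\<lambda>(t, x). indicator A t * D)"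
    proof (rule Fubini_integrable)
      show "integrable lborel (\<lambda>t. \<integral>x. norm (case (t, x) of (t, x) \<Rightarrow> indicator A t * D) \<partial>\<nu>)"
        using emeasure_truncated_line[OF \<epsilon>]
        by (simp add: abs_mult A_def[symmetric])
    qed auto
    show "AE p in lborel \<Otimes>\<^sub>M \<nu>. norm (case_prod f p) \<le> norm (case p of (t, x) \<Rightarrow> indicator A t * D)"
      using bound by (intro AE_I2) (auto intro: order_trans[OF _ abs_ge_self])
  qed measurable
  have int1: "integrable lborel (\<lambda>t. indicator A t * \<phi> t)"
    unfolding A_def by (rule integrable_truncated_line[OF \<epsilon> \<phi> C])
  have int2: "integrable lborel (\<lambda>t. (indicator A t * \<phi> t) * poisson y t 0)"
  proof -
    have "integrable lborel (\<lambda>t. indicator A t * (\<phi> t * poisson y t 0))"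
      unfolding A_def
    proof (rule integrable_truncated_line[OF \<epsilon>, of _ "C * (1 / y)"])
      fix t assume t: "t \<in> truncated_line \<epsilon>"
      show "\<bar>\<phi> t * poisson y t 0\<bar> \<le> C * (1 / y)"
        unfolding abs_mult using C[OF t] poisson_le[OF y, of t 0] poisson_nonneg[OF y, of t 0]
        by (intro mult_mono) auto
    qed measurable
    then show ?thesis by (simp add: mult.assoc)
  qed
  have int3: "integrable lborel (\<lambda>t. \<integral>x. f t x \<partial>\<nu>)"
    using integrable_fst'[OF int_f] by simp
  have eq: "indicator A t * (\<phi> t * Im (h (Complex t y))) =
     (y * \<beta>) * (indicator A t * \<phi> t) + \<gamma> * ((indicator A t * \<phi> t) * poisson y t 0) + (\<integral>x. f t x \<partial>\<nu>)" for t
    unfolding Im_eq[OF y] f_def integral_mult_right_zero by (simp add: algebra_simps)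
  show ?int
    unfolding A_def[symmetric] eq
    by (intro Bochner_Integration.integrable_add integrable_mult_right int1 int2 int3)
  have "(\<integral>t. \<integral>x. f t x \<partial>\<nu> \<partial>lborel) = (\<integral>x. \<integral>t. f t x \<partial>lborel \<partial>\<nu>)"
    by (rule Fubini_integral[OF int_f, symmetric])
  also have "\<dots> = (\<integral>x. (1 + x\<^sup>2) * (\<integral>t. (indicator A t * \<phi> t) * poisson y t x \<partial>lborel) \<partial>\<nu>)"
    by (simp add: f_def mult.left_commute flip: integral_mult_right_zero)
  finally show ?eq
    unfolding A_def[symmetric] eq using int1 int2 int3
    by (simp add: Bochner_Integration.integral_add algebra_simps)
qed

text \<open>The \<beta> term carries a factor y, and the \<gamma> term vanishes because the
  truncated line stays away from 0. Only the integral over \<nu> survives.\<close>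

lemma truncated_integral_tendsto:
  assumes \<epsilon>: "0 < \<epsilon>" "\<epsilon> < 1" and \<phi>[measurable]: "\<phi> \<in> borel_measurable borel"
    and cont: "\<And>x. x \<noteq> 0 \<Longrightarrow> isCont \<phi> x"
    and C: "\<And>t. t \<in> truncated_line \<epsilon> \<Longrightarrow> \<bar>\<phi> t\<bar> \<le> C"
  shows "((\<lambda>y. \<integral>t. indicator (truncated_line \<epsilon>) t * (\<phi> t * Im (h (Complex t y))) \<partial>lborel) \<longlongrightarrow>
      pi * (\<integral>x. truncation_weight \<epsilon> x * (\<phi> x * (1 + x\<^sup>2)) \<partial>\<nu>)) (at_right 0)"
proof -
  define A where "A = truncated_line \<epsilon>"
  have [measurable]: "A \<in> sets borel" by (simp add: A_def)
  define R where "R = 1 / \<epsilon>"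
  have R: "0 < R" using \<epsilon> by (simp add: R_def)
  define P where "P y x = (\<integral>t. (indicator A t * \<phi> t) * poisson y t x \<partial>lborel)" for y x
  have P_meas[measurable]: "P y \<in> borel_measurable borel" for y
    unfolding P_def by measurable
  have P_lim: "((\<lambda>y. P y x) \<longlongrightarrow> pi * (truncation_weight \<epsilon> x * \<phi> x)) (at_right 0)" for x
    unfolding P_def A_def by (rule poisson_truncated_tendsto[OF \<epsilon> \<phi> cont C])
  have C0: "0 \<le> C"
  proof -
    have "1 \<in> truncated_line \<epsilon>" using \<epsilon> by (simp add: truncated_line_def)
    from C[OF this] show ?thesis by linarith
  qed
  \<comment> \<open>The bound of \<open>poisson_growth\<close> integrated over t: pi is the mass of
    the Poisson kernel, 2 * R the length of an interval containing the truncated line, and y < 1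
    makes the result independent of y.\<close>
  define K where "K = C * ((1 + 2 * R\<^sup>2) * pi) + (2 * C) * (2 * R)"
  have P_bound: "\<bar>(1 + x\<^sup>2) * P y x\<bar> \<le> K" if y: "0 < y" "y < 1" for x y
  proof -
    define g where "g t = C * ((1 + 2 * R\<^sup>2) * poisson y t x) + (2 * y * C) * indicator {-R..R} t" for t
    have int_g: "integrable lborel g"
      unfolding g_def using R
      by (intro Bochner_Integration.integrable_add integrable_mult_right integrable_poisson y integrable_real_indicator) auto
    have "\<bar>(1 + x\<^sup>2) * P y x\<bar> = \<bar>\<integral>t. (indicator A t * \<phi> t) * ((1 + x\<^sup>2) * poisson y t x) \<partial>lborel\<bar>"
      unfolding P_def by (simp add: mult.left_commute flip: integral_mult_right_zero)
    also have "\<dots> \<le> (\<integral>t. g t \<partial>lborel)"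
    proof (rule order_trans[OF integral_abs_bound integral_mono'[OF int_g]])
      fix t
      have nn: "0 \<le> (1 + x\<^sup>2) * poisson y t x" using poisson_nonneg[OF y(1)] by simp
      show g0: "0 \<le> g t" unfolding g_def using C0 y poisson_nonneg[OF y(1), of t x] by (auto simp: indicator_def)
      show "\<bar>indicator A t * \<phi> t * ((1 + x\<^sup>2) * poisson y t x)\<bar> \<le> g t"
      proof (cases "t \<in> A")
        case True
        then have t: "\<bar>t\<bar> \<le> R" using truncated_line_bounded[OF \<epsilon>(1)] by (simp add: A_def R_def)
        have "\<bar>\<phi> t\<bar> * ((1 + x\<^sup>2) * poisson y t x) \<le> C * ((1 + 2 * R\<^sup>2) * poisson y t x + 2 * y)"
          using poisson_growth[OF y(1) t] C[of t] True nn C0 by (intro mult_mono) (auto simp: A_def)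
        moreover have "indicator {-R..R} t = (1::real)" using t by (auto simp: indicator_def)
        moreover have "\<bar>indicator A t * \<phi> t * ((1 + x\<^sup>2) * poisson y t x)\<bar> = \<bar>\<phi> t\<bar> * ((1 + x\<^sup>2) * poisson y t x)"
          using True poisson_nonneg[OF y(1), of t x] by (simp add: abs_mult)
        ultimately show ?thesis by (simp add: g_def distrib_left mult_ac)
      qed (use g0 in simp)
    qed
    also have "\<dots> = C * ((1 + 2 * R\<^sup>2) * pi) + (2 * y * C) * (2 * R)"
      unfolding g_def using R
      by (subst Bochner_Integration.integral_add)
         (auto intro!: integrable_mult_right integrable_poisson y simp: integral_poisson[OF y(1)])
    also have "\<dots> \<le> K"
      unfolding K_def using C0 y R by (intro add_left_mono mult_right_mono) (auto simp: mult_left_le)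
    finally show ?thesis .
  qed
  have "((\<lambda>y. \<integral>x. (1 + x\<^sup>2) * P y x \<partial>\<nu>) \<longlongrightarrow> (\<integral>x. (1 + x\<^sup>2) * (pi * (truncation_weight \<epsilon> x * \<phi> x)) \<partial>\<nu>)) (at_right 0)"
  proof (rule integral_dominated_convergence_within[where w = "\<lambda>_. K"])
    have "\<forall>\<^sub>F y in at_right 0. (0::real) < y \<and> y < 1"
      unfolding eventually_at_right_field using zero_less_one by blast
    then show "\<forall>\<^sub>F y in at_right 0. AE x in \<nu>. norm ((1 + x\<^sup>2) * P y x) \<le> K"
      by eventually_elim (use P_bound in auto)
    show "AE x in \<nu>. ((\<lambda>y. (1 + x\<^sup>2) * P y x) \<longlongrightarrow> (1 + x\<^sup>2) * (pi * (truncation_weight \<epsilon> x * \<phi> x))) (at_right 0)"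
      by (intro AE_I2 tendsto_mult tendsto_const P_lim)
  qed (auto simp: integrable_const)
  moreover have "((\<lambda>y. y * (\<beta> * (\<integral>t. indicator A t * \<phi> t \<partial>lborel))) \<longlongrightarrow> 0 * (\<beta> * (\<integral>t. indicator A t * \<phi> t \<partial>lborel))) (at_right 0)"
    by (intro tendsto_mult tendsto_const tendsto_ident_at)
  moreover have "((\<lambda>y. \<gamma> * P y 0) \<longlongrightarrow> \<gamma> * (pi * (truncation_weight \<epsilon> 0 * \<phi> 0))) (at_right 0)"
    by (intro tendsto_mult tendsto_const P_lim)
  ultimately have "((\<lambda>y. y * (\<beta> * (\<integral>t. indicator A t * \<phi> t \<partial>lborel)) + \<gamma> * P y 0 + (\<integral>x. (1 + x\<^sup>2) * P y x \<partial>\<nu>)) \<longlongrightarrow>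
     0 * (\<beta> * (\<integral>t. indicator A t * \<phi> t \<partial>lborel)) + \<gamma> * (pi * (truncation_weight \<epsilon> 0 * \<phi> 0)) +
     (\<integral>x. (1 + x\<^sup>2) * (pi * (truncation_weight \<epsilon> x * \<phi> x)) \<partial>\<nu>)) (at_right 0)"
    by (intro tendsto_add)
  moreover have "(\<integral>x. (1 + x\<^sup>2) * (pi * (truncation_weight \<epsilon> x * \<phi> x)) \<partial>\<nu>) =
     pi * (\<integral>x. truncation_weight \<epsilon> x * (\<phi> x * (1 + x\<^sup>2)) \<partial>\<nu>)"
    by (subst integral_mult_right_zero[symmetric]) (simp add: mult_ac)
  ultimately have lim: "((\<lambda>y. y * (\<beta> * (\<integral>t. indicator A t * \<phi> t \<partial>lborel)) + \<gamma> * P y 0 + (\<integral>x. (1 + x\<^sup>2) * P y x \<partial>\<nu>)) \<longlongrightarrow>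
     pi * (\<integral>x. truncation_weight \<epsilon> x * (\<phi> x * (1 + x\<^sup>2)) \<partial>\<nu>)) (at_right 0)"
    using truncation_weight_0[OF \<epsilon>(1)] by simp
  have "\<forall>\<^sub>F y in at_right 0. y * (\<beta> * (\<integral>t. indicator A t * \<phi> t \<partial>lborel)) + \<gamma> * P y 0 + (\<integral>x. (1 + x\<^sup>2) * P y x \<partial>\<nu>) =
     (\<integral>t. indicator (truncated_line \<epsilon>) t * (\<phi> t * Im (h (Complex t y))) \<partial>lborel)"
    using eventually_at_right_less[of 0]
    by eventually_elim (simp add: truncated_integral(2)[OF \<epsilon>(1) _ \<phi> C] P_def A_def)
  with lim show ?thesis by (rule Lim_transform_eventually)
qed

lemma sym_int_integrable:
  assumes "0 < \<epsilon>" "0 < y"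
  shows "set_integrable lborel (truncated_line \<epsilon>) (\<lambda>t. t powi k * Im (h (Complex t y)))"
  using truncated_integral(1)[OF assms power_int_measurable abs_power_int_truncated_le[OF assms(1)]]
  by (simp add: set_integrable_def)

lemma sym_int_eq:
  assumes "0 < \<epsilon>" "0 < y"
  shows "sym_int h k \<epsilon> y = (\<integral>t. indicator (truncated_line \<epsilon>) t * (t powi k * Im (h (Complex t y))) \<partial>lborel)"
  using set_borel_integral_eq_integral(2)[OF sym_int_integrable[OF assms, of k]]
  by (simp add: sym_int_def set_lebesgue_integral_def truncated_line_def)

text \<open>This is 1/pi times the inner limit over y, with half weight on atoms at the end
  points.\<close>

definition truncated_moment :: "int \<Rightarrow> real \<Rightarrow> real" where
  "truncated_moment k \<epsilon> = (\<integral>x. truncation_weight \<epsilon> x * (x powi k * (1 + x\<^sup>2)) \<partial>\<nu>)"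

text \<open>The value is a genuine moment only where the integrand is integrable; otherwise the
  integral defaults to 0.\<close>

definition moment :: "int \<Rightarrow> real" where
  "moment k = (\<integral>x. x powi k * (1 + x\<^sup>2) \<partial>\<nu>)"

lemma sym_int_tendsto:
  assumes \<epsilon>: "0 < \<epsilon>" "\<epsilon> < 1"
  shows "((\<lambda>y. sym_int h k \<epsilon> y) \<longlongrightarrow> pi * truncated_moment k \<epsilon>) (at_right 0)"
proof -
  have "((\<lambda>y. \<integral>t. indicator (truncated_line \<epsilon>) t * (t powi k * Im (h (Complex t y))) \<partial>lborel) \<longlongrightarrow>
      pi * truncated_moment k \<epsilon>) (at_right 0)"
    unfolding truncated_moment_def
    by (rule truncated_integral_tendsto[OF \<epsilon> _ _ abs_power_int_truncated_le])
       (use \<epsilon> in \<open>auto intro!: continuous_intros\<close>)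
  moreover have "\<forall>\<^sub>F y in at_right 0.
      (\<integral>t. indicator (truncated_line \<epsilon>) t * (t powi k * Im (h (Complex t y))) \<partial>lborel) = sym_int h k \<epsilon> y"
    using eventually_at_right_less[of 0] by eventually_elim (simp add: sym_int_eq \<epsilon>)
  ultimately show ?thesis by (rule Lim_transform_eventually)
qed

lemma truncated_moment_tendsto:
  assumes "integrable \<nu> (\<lambda>x. x powi k * (1 + x\<^sup>2))"
  shows "(truncated_moment k \<longlongrightarrow> moment k) (at_right 0)"
  unfolding truncated_moment_def moment_def
proof (rule integral_dominated_convergence_within[where w = "\<lambda>x. norm (x powi k * (1 + x\<^sup>2))"])
  show "AE x in \<nu>. ((\<lambda>\<epsilon>. truncation_weight \<epsilon> x * (x powi k * (1 + x\<^sup>2))) \<longlongrightarrow> x powi k * (1 + x\<^sup>2)) (at_right 0)"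
    using AE_nonzero
  proof eventually_elim
    case (elim x)
    show ?case using tendsto_mult[OF truncation_weight_tendsto[OF elim] tendsto_const] by simp
  qed
  have "norm (truncation_weight \<epsilon> x * (x powi k * (1 + x\<^sup>2))) \<le> norm (x powi k * (1 + x\<^sup>2))" for \<epsilon> x
    using truncation_weight_bounds[of \<epsilon> x] unfolding norm_mult by (intro mult_left_le_one_le) auto
  then show "\<forall>\<^sub>F \<epsilon> in at_right 0. AE x in \<nu>.
      norm (truncation_weight \<epsilon> x * (x powi k * (1 + x\<^sup>2))) \<le> norm (x powi k * (1 + x\<^sup>2))"
    by simp
  show "integrable \<nu> (\<lambda>x. norm (x powi k * (1 + x\<^sup>2)))" using assms by (rule integrable_norm)
qed measurable

lemma integrable_truncated:
  assumes \<epsilon>: "0 < \<epsilon>" "\<epsilon> < 1"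
  shows "integrable \<nu> (\<lambda>x. truncation_weight \<epsilon> x * (x powi k * (1 + x\<^sup>2)))"
proof (rule integrable_const_bound)
  have "norm (truncation_weight \<epsilon> x * (x powi k * (1 + x\<^sup>2))) \<le> (2/\<epsilon>) ^ nat \<bar>k\<bar> * (1 + (1/\<epsilon>)\<^sup>2)" for x
  proof (cases "truncation_weight \<epsilon> x = 0")
    case False
    note x = truncation_weight_nonzero[OF \<epsilon> False]
    \<comment> \<open>The weight is also nonzero at the end points, which the open set for
      \<epsilon> excludes. Halving \<epsilon> includes them, whence the constant
      2/\<epsilon>.\<close>
    have "x \<in> truncated_line (\<epsilon> / 2)" using x \<epsilon> by (auto simp: truncated_line_def field_simps)
    then have "\<bar>x powi k\<bar> \<le> (2/\<epsilon>) ^ nat \<bar>k\<bar>"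
      using abs_power_int_truncated_le[of "\<epsilon>/2" x k] \<epsilon> by simp
    moreover have "x\<^sup>2 \<le> (1/\<epsilon>)\<^sup>2" using x by (metis abs_ge_zero power2_abs power_mono)
    then have "\<bar>1 + x\<^sup>2\<bar> \<le> 1 + (1/\<epsilon>)\<^sup>2" by simp
    moreover have "\<bar>truncation_weight \<epsilon> x\<bar> \<le> 1" using truncation_weight_bounds[of \<epsilon> x] by simp
    ultimately have "\<bar>truncation_weight \<epsilon> x\<bar> * (\<bar>x powi k\<bar> * \<bar>1 + x\<^sup>2\<bar>) \<le> 1 * ((2/\<epsilon>) ^ nat \<bar>k\<bar> * (1 + (1/\<epsilon>)\<^sup>2))"
      using \<epsilon> by (intro mult_mono) auto
    then show ?thesis by (simp add: abs_mult)
  qed (use \<epsilon> in simp)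
  then show "AE x in \<nu>. norm (truncation_weight \<epsilon> x * (x powi k * (1 + x\<^sup>2))) \<le> (2/\<epsilon>) ^ nat \<bar>k\<bar> * (1 + (1/\<epsilon>)\<^sup>2)"
    by simp
qed measurable

text \<open>For even k the integrands are nonnegative, so a finite limit of their integrals bounds
  the full moment by Fatou's lemma.\<close>

lemma integrable_moment_of_tendsto:
  assumes "even k" and lim: "(truncated_moment k \<longlongrightarrow> L) (at_right 0)"
  shows "integrable \<nu> (\<lambda>x. x powi k * (1 + x\<^sup>2))"
proof -
  \<comment> \<open>The shift by 2 keeps every X n strictly below 1, as
    \<open>integrable_truncated\<close> demands.\<close>
  define X where "X n = 1 / real (n + 2)" for n
  have X: "filterlim X (at_right 0) sequentially"
    unfolding filterlim_at
  proof
    have "(\<lambda>n. inverse (real (Suc (n + 1)))) \<longlonglongrightarrow> 0"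
      using LIMSEQ_ignore_initial_segment[OF LIMSEQ_inverse_real_of_nat, of 1] by simp
    then show "X \<longlonglongrightarrow> 0"
      unfolding X_def by (simp add: inverse_eq_divide add_ac)
  qed (simp add: X_def)
  show ?thesis
  proof (rule integrable_Fatou)
    show "integrable \<nu> (\<lambda>x. truncation_weight (X n) x * (x powi k * (1 + x\<^sup>2)))" for n
      by (rule integrable_truncated) (auto simp: X_def)
    have "0 \<le> x powi k" for x :: real
      using assms(1) by (auto simp: power_int_def even_nat_iff zero_le_power_eq)
    then show "AE x in \<nu>. 0 \<le> truncation_weight (X n) x * (x powi k * (1 + x\<^sup>2))" for n
      using truncation_weight_bounds(1) by simp
    show "(\<lambda>n. \<integral>x. truncation_weight (X n) x * (x powi k * (1 + x\<^sup>2)) \<partial>\<nu>) \<longlonglongrightarrow> L"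
      using filterlim_compose[OF lim X] by (simp add: truncated_moment_def)
    show "AE x in \<nu>. (\<lambda>n. truncation_weight (X n) x * (x powi k * (1 + x\<^sup>2))) \<longlonglongrightarrow> x powi k * (1 + x\<^sup>2)"
      using AE_nonzero
    proof eventually_elim
      case (elim x)
      show ?case
        using tendsto_mult[OF filterlim_compose[OF truncation_weight_tendsto[OF elim] X] tendsto_const] by simp
    qed
  qed measurable
qed

end

section \<open>Asymptotic expansions at the origin\<close>

text \<open>Nontangential approach in quantitative form: |z| / Im z stays bounded, which supplies
  the dominating functions for limits in Stoltz domains.\<close>

lemma stoltz_sin_le:
  assumes "z \<in> stoltz \<theta>" "0 < \<theta>" "\<theta> \<le> pi / 2"
  shows "sin \<theta> * norm z \<le> Im z"
proof -
  have A: "\<theta> < Arg z" "Arg z < pi - \<theta>" and z: "z \<noteq> 0" using assms(1) by (auto simp: stoltz_def)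
  have "sin \<theta> \<le> sin (Arg z)"
  proof (cases "Arg z \<le> pi / 2")
    case True
    then show ?thesis using A assms(2) by (intro sin_monotone_2pi_le) auto
  next
    case False
    then have "sin \<theta> \<le> sin (pi - Arg z)"
      using A assms(2) by (intro sin_monotone_2pi_le) auto
    then show ?thesis by simp
  qed
  then have "norm z * sin \<theta> \<le> norm z * sin (Arg z)" by (intro mult_left_mono) auto
  also have "\<dots> = Im z"
    using rcis_cmod_Arg[of z] by (metis Im_rcis)
  finally show ?thesis by (simp add: mult.commute)
qed

lemma stoltz_quotient_le:
  assumes "z \<in> stoltz \<theta>" "0 < \<theta>" "\<theta> \<le> pi / 2"
  shows "norm z / Im z \<le> 1 / sin \<theta>"
proof -
  have "0 < sin \<theta>" using assms by (intro sin_gt_zero) auto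
  moreover have "0 < Im z" using assms by (simp add: stoltz_def)
  ultimately show ?thesis using stoltz_sin_le[OF assms] by (simp add: field_simps)
qed

lemma eventually_stoltz: "\<forall>\<^sub>F z in at a within stoltz \<theta>. z \<in> stoltz \<theta>"
  by (auto simp: eventually_at_filter)

text \<open>An expansion may be tested along z = iy. The angle must be below pi/2, since at pi/2 the
  domain is empty.\<close>

lemma filterlim_imaginary_axis:
  assumes "0 < \<theta>" "\<theta> < pi / 2"
  shows "filterlim (Complex 0) (at 0 within stoltz \<theta>) (at_right 0)"
  unfolding filterlim_at
proof
  show "((Complex 0) \<longlongrightarrow> 0) (at_right 0)"
  proof (rule tendsto_eq_rhs)
    show "((Complex 0) \<longlongrightarrow> Complex 0 0) (at_right 0)"
      by (intro tendsto_Complex tendsto_const tendsto_ident_at)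
  qed (simp add: complex_eq_iff)
  show "\<forall>\<^sub>F y in at_right 0. Complex 0 y \<in> stoltz \<theta> \<and> Complex 0 y \<noteq> 0"
    using eventually_at_right_less[of 0]
  proof eventually_elim
    case (elim y)
    have "Arg (Complex 0 y) = pi / 2"
      by (rule Arg_unique[of y]) (use elim in \<open>auto simp: complex_eq_iff exp_eq_polar\<close>)
    then show ?case using elim assms by (auto simp: stoltz_def complex_eq_iff)
  qed
qed

section \<open>Calculus of expansions\<close>

lemma has_expansion_at_0_cong:
  assumes "\<And>z. 0 < Im z \<Longrightarrow> f z = g z" "\<And>k. -1 \<le> k \<Longrightarrow> k \<le> M \<Longrightarrow> a k = b k"
  shows "has_expansion_at_0 f M a \<longleftrightarrow> has_expansion_at_0 g M b"
proof -
  have "((\<lambda>z. (f z - (\<Sum>k\<in>{-1..M}. complex_of_real (a k) * z powi k)) / z powi M) \<longlongrightarrow> 0) (at 0 within stoltz \<theta>) \<longleftrightarrow>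
     ((\<lambda>z. (g z - (\<Sum>k\<in>{-1..M}. complex_of_real (b k) * z powi k)) / z powi M) \<longlongrightarrow> 0) (at 0 within stoltz \<theta>)" for \<theta>
  proof (rule filterlim_cong[OF refl refl])
    show "\<forall>\<^sub>F z in at 0 within stoltz \<theta>. (f z - (\<Sum>k\<in>{-1..M}. complex_of_real (a k) * z powi k)) / z powi M =
        (g z - (\<Sum>k\<in>{-1..M}. complex_of_real (b k) * z powi k)) / z powi M"
      using eventually_stoltz by eventually_elim (use assms in \<open>simp add: stoltz_def\<close>)
  qed
  then show ?thesis by (simp add: has_expansion_at_0_def)
qed

lemma has_expansion_at_0_diff:
  assumes "has_expansion_at_0 f M a" "has_expansion_at_0 g M b"
  shows "has_expansion_at_0 (\<lambda>z. f z - g z) M (\<lambda>k. a k - b k)"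
  unfolding has_expansion_at_0_def
proof (intro allI impI)
  fix \<theta> :: real assume \<theta>: "0 < \<theta> \<and> \<theta> \<le> pi / 2"
  have "((\<lambda>z. (f z - (\<Sum>k\<in>{-1..M}. complex_of_real (a k) * z powi k)) / z powi M -
       (g z - (\<Sum>k\<in>{-1..M}. complex_of_real (b k) * z powi k)) / z powi M) \<longlongrightarrow> 0 - 0) (at 0 within stoltz \<theta>)"
    using assms \<theta> unfolding has_expansion_at_0_def by (intro tendsto_diff) auto
  then show "((\<lambda>z. (f z - g z - (\<Sum>k\<in>{-1..M}. complex_of_real (a k - b k) * z powi k)) / z powi M) \<longlongrightarrow> 0)
      (at 0 within stoltz \<theta>)"
    by (simp add: diff_divide_distrib[symmetric] left_diff_distrib sum_subtractf algebra_simps)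
qed

lemma has_expansion_at_0_mono:
  assumes "has_expansion_at_0 f M a" "-1 \<le> M'" "M' \<le> M"
  shows "has_expansion_at_0 f M' a"
  unfolding has_expansion_at_0_def
proof (intro allI impI)
  fix \<theta> :: real assume \<theta>: "0 < \<theta> \<and> \<theta> \<le> pi / 2"
  let ?F = "at 0 within stoltz \<theta>"
  define R where "R z = (f z - (\<Sum>k\<in>{-1..M}. complex_of_real (a k) * z powi k)) / z powi M" for z
  have R: "(R \<longlongrightarrow> 0) ?F" using assms(1) \<theta> by (simp add: has_expansion_at_0_def R_def[abs_def])
  have pow: "((\<lambda>z::complex. z powi j) \<longlongrightarrow> 0) ?F" if "0 < j" for j
  proof -
    have "((\<lambda>z::complex. z ^ nat j) \<longlongrightarrow> 0 ^ nat j) ?F"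
      by (intro tendsto_power tendsto_ident_at)
    then show ?thesis using that by (simp add: power_int_def power_0_left)
  qed
  \<comment> \<open>Division by the lower power turns the old remainder and every omitted term into
    multiples of nonnegative powers of z; the only zeroth power occurs for M = M' and multiplies R,
    which itself tends to 0.\<close>
  have L: "((\<lambda>z. R z * z powi (M - M') + (\<Sum>k\<in>{M'<..M}. complex_of_real (a k) * z powi (k - M'))) \<longlongrightarrow>
     0 + (\<Sum>k\<in>{M'<..M}. complex_of_real (a k) * 0)) ?F"
  proof (intro tendsto_add tendsto_sum tendsto_mult tendsto_const pow)
    show "((\<lambda>z. R z * z powi (M - M')) \<longlongrightarrow> 0) ?F"
    proof (cases "M = M'")
      case True
      then show ?thesis using R by simp
    next
      case False
      then show ?thesis using tendsto_mult[OF R pow[of "M - M'"]] assms by simp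
    qed
  qed auto
  have ev: "\<forall>\<^sub>F z in ?F. R z * z powi (M - M') + (\<Sum>k\<in>{M'<..M}. complex_of_real (a k) * z powi (k - M')) =
      (f z - (\<Sum>k\<in>{-1..M'}. complex_of_real (a k) * z powi k)) / z powi M'"
    using eventually_stoltz
  proof eventually_elim
    case (elim z)
    then have z: "z \<noteq> 0" by (auto simp: stoltz_def)
    have "{-1..M} = {-1..M'} \<union> {M'<..M}" using assms by auto
    then have "(\<Sum>k\<in>{-1..M}. complex_of_real (a k) * z powi k) =
        (\<Sum>k\<in>{-1..M'}. complex_of_real (a k) * z powi k) + (\<Sum>k\<in>{M'<..M}. complex_of_real (a k) * z powi k)"
      by (simp only:) (rule sum.union_disjoint, auto)
    moreover have "(\<Sum>k\<in>{M'<..M}. complex_of_real (a k) * z powi k) =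
        (\<Sum>k\<in>{M'<..M}. complex_of_real (a k) * z powi (k - M')) * z powi M'"
      using z by (simp add: sum_distrib_right power_int_diff)
    ultimately show ?case
      unfolding R_def using z by (simp add: power_int_diff field_simps)
  qed
  show "((\<lambda>z. (f z - (\<Sum>k\<in>{-1..M'}. complex_of_real (a k) * z powi k)) / z powi M') \<longlongrightarrow> 0) ?F"
    by (rule Lim_transform_eventually[OF tendsto_eq_rhs[OF L] ev]) simp
qed

text \<open>The difference of the coefficients expands the zero function. Once all lower ones
  vanish, the quotient along the imaginary axis is constantly minus the next one, which must then be
  0.\<close>

lemma has_expansion_at_0_unique:
  assumes a: "has_expansion_at_0 f M a" and b: "has_expansion_at_0 f M b" and "-1 \<le> k" "k \<le> M"
  shows "a k = b k"
proof -
  define c where "c k = a k - b k" for k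
  have c: "has_expansion_at_0 (\<lambda>z. 0) M c"
    using has_expansion_at_0_diff[OF a b] by (simp add: c_def[abs_def])
  \<comment> \<open>The shift by one lets induction over natural numbers start at exponent
    -1.\<close>
  have "c (int n - 1) = 0" if "int n - 1 \<le> M" for n
    using that
  proof (induction n rule: less_induct)
    case (less n)
    have "has_expansion_at_0 (\<lambda>z. 0) (int n - 1) c"
      by (rule has_expansion_at_0_mono[OF c]) (use less.prems in auto)
    moreover have "has_expansion_at_0 (\<lambda>z. 0) (int n - 1) c \<longleftrightarrow>
        has_expansion_at_0 (\<lambda>z. 0) (int n - 1) (\<lambda>k. if k = int n - 1 then c (int n - 1) else 0)"
    proof (rule has_expansion_at_0_cong)
      fix k assume k: "- 1 \<le> k" "k \<le> int n - 1"
      show "c k = (if k = int n - 1 then c (int n - 1) else 0)"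
        using less.IH[of "nat (k + 1)"] less.prems k by auto
    qed simp
    ultimately have "((\<lambda>z. (0 - (\<Sum>k\<in>{-1..int n - 1}. complex_of_real (if k = int n - 1 then c (int n - 1) else 0) * z powi k))
         / z powi (int n - 1)) \<longlongrightarrow> 0) (at 0 within stoltz (pi/4))"
      unfolding has_expansion_at_0_def using pi_gt_zero by simp
    from filterlim_compose[OF this filterlim_imaginary_axis]
    have lim: "((\<lambda>y. (0 - (\<Sum>k\<in>{-1..int n - 1}. complex_of_real (if k = int n - 1 then c (int n - 1) else 0) * (Complex 0 y) powi k))
         / (Complex 0 y) powi (int n - 1)) \<longlongrightarrow> 0) (at_right 0)"
      using pi_gt_zero by simp
    have "\<forall>\<^sub>F y in at_right 0. (0 - (\<Sum>k\<in>{-1..int n - 1}. complex_of_real (if k = int n - 1 then c (int n - 1) else 0) * (Complex 0 y) powi k))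
         / (Complex 0 y) powi (int n - 1) = - complex_of_real (c (int n - 1))"
      using eventually_at_right_less[of 0]
    proof eventually_elim
      case (elim y)
      then have "Complex 0 y \<noteq> 0" by (simp add: complex_eq_iff)
      then show ?case by (simp add: if_distrib if_distribR sum.delta cong: if_cong)
    qed
    with lim have "((\<lambda>y::real. - complex_of_real (c (int n - 1))) \<longlongrightarrow> 0) (at_right 0)"
      by (rule Lim_transform_eventually)
    then show ?case by (simp add: tendsto_const_iff)
  qed
  from this[of "nat (k + 1)"] show ?thesis using assms(3,4) by (simp add: c_def)
qed

lemma sum_expansion_split:
  fixes z :: complex
  shows "(\<Sum>k\<in>{-1..int m - 1}. complex_of_real (a k) * z powi k) =
     complex_of_real (a (-1)) / z + (\<Sum>j<m. complex_of_real (a (int j)) * z ^ j)"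
proof (induction m)
  case 0
  have "{-1..int 0 - 1} = {-1}" by auto
  then show ?case by (simp add: power_int_def inverse_eq_divide)
next
  case (Suc m)
  have "{-1..int (Suc m) - 1} = insert (int m) {-1..int m - 1}" by auto
  then show ?case using Suc by (simp add: add_ac)
qed

text \<open>The geometric expansion of 1 / (x - z) in powers of z / x with exact remainder; each
  step uses 1 / (x - z) = 1/x + (z/x) / (x - z).\<close>

lemma nevanlinna_kernel_expansion:
  assumes "x \<noteq> 0" "0 < Im z"
  shows "nevanlinna_kernel z x = of_real (1 / x) + (\<Sum>j=1..n. z ^ j * of_real ((1 + x\<^sup>2) / x ^ Suc j)) +
     z ^ Suc n * (of_real ((1 + x\<^sup>2) / x ^ Suc n) / (of_real x - z))"
proof (induction n)
  case 0
  have "of_real x - z \<noteq> 0" "complex_of_real x \<noteq> 0" using assms by (auto simp: complex_eq_iff)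
  then show ?case unfolding nevanlinna_kernel_def by (simp add: field_simps power2_eq_square)
next
  case (Suc n)
  have nz: "of_real x - z \<noteq> 0" "complex_of_real x \<noteq> 0" using assms by (auto simp: complex_eq_iff)
  have "of_real ((1 + x\<^sup>2) / x ^ Suc n) / (of_real x - z) =
     of_real ((1 + x\<^sup>2) / x ^ Suc (Suc n)) + z * (of_real ((1 + x\<^sup>2) / x ^ Suc (Suc n)) / (of_real x - z))"
    using nz by (simp add: field_simps)
  then show ?case
    unfolding Suc by (simp add: algebra_simps)
qed

section \<open>From inverse moments to expansions\<close>

context nevanlinna
begin

text \<open>\<nu> is finite, so 1 plus the m-th inverse power dominates all lower ones.\<close>

lemma integrable_inverse_power_mono:
  assumes "integrable \<nu> (\<lambda>x. 1 / x ^ m)" "j \<le> m"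
  shows "integrable \<nu> (\<lambda>x. 1 / x ^ j)"
proof (rule Bochner_Integration.integrable_bound[where f = "\<lambda>x. 1 + \<bar>1 / x ^ m\<bar>"])
  show "integrable \<nu> (\<lambda>x. 1 + \<bar>1 / x ^ m\<bar>)"
    using assms(1) by (intro Bochner_Integration.integrable_add integrable_abs) auto
  have "norm (1 / x ^ j) \<le> norm (1 + \<bar>1 / x ^ m\<bar>)" for x :: real
  proof -
    define w where "w = \<bar>1 / x\<bar>"
    have "w ^ j \<le> 1 + w ^ m"
    proof (cases "w \<le> 1")
      case True
      then have "w ^ j \<le> 1" by (simp add: w_def power_le_one)
      then show ?thesis by (simp add: w_def add_increasing2)
    next
      case False
      then have "w ^ j \<le> w ^ m" using assms(2) by (intro power_increasing) auto
      then show ?thesis by simp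
    qed
    then show ?thesis by (simp add: w_def power_abs power_one_over)
  qed
  then show "AE x in \<nu>. norm (1 / x ^ j) \<le> norm (1 + \<bar>1 / x ^ m\<bar>)" by simp
qed measurable

text \<open>The quotient is the sum of the inverse powers j and j - 2; hence the lower bound on j,
  below which growth at infinity would matter.\<close>

lemma integrable_weighted_inverse_power:
  assumes "integrable \<nu> (\<lambda>x. 1 / x ^ m)" "2 \<le> j" "j \<le> m"
  shows "integrable \<nu> (\<lambda>x. (1 + x\<^sup>2) / x ^ j)"
proof -
  obtain i where j: "j = i + 2" using assms(2) by (metis add.commute le_Suc_ex)
  have "integrable \<nu> (\<lambda>x. 1 / x ^ j + 1 / x ^ i)"
    using assms j by (intro Bochner_Integration.integrable_add integrable_inverse_power_mono[OF assms(1)]) auto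
  moreover have "AE x in \<nu>. 1 / x ^ j + 1 / x ^ i = (1 + x\<^sup>2) / x ^ j"
    using AE_nonzero by eventually_elim (simp add: j power_add field_simps power2_eq_square)
  ultimately show ?thesis
    by (subst (asm) integrable_cong_AE) auto
qed

lemma integrable_weighted_inverse_power_iff:
  assumes "2 \<le> m"
  shows "integrable \<nu> (\<lambda>x. x powi (- int m) * (1 + x\<^sup>2)) \<longleftrightarrow> integrable \<nu> (\<lambda>x. 1 / x ^ m)"
proof -
  have eq: "x powi (- int m) * (1 + x\<^sup>2) = (1 + x\<^sup>2) / x ^ m" for x :: real
    by (simp add: power_int_minus field_simps)
  show ?thesis
    unfolding eq
  proof
    assume *: "integrable \<nu> (\<lambda>x. (1 + x\<^sup>2) / x ^ m)"
    show "integrable \<nu> (\<lambda>x. 1 / x ^ m)"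
    proof (rule Bochner_Integration.integrable_bound[OF *])
      show "AE x in \<nu>. norm (1 / x ^ m) \<le> norm ((1 + x\<^sup>2) / x ^ m)"
        by (intro AE_I2) (auto simp: norm_divide intro!: divide_right_mono)
    qed measurable
  qed (use assms integrable_weighted_inverse_power in auto)
qed

text \<open>Term by term integration of the kernel expansion: z^j with j at least 1 has weight (1 +
  x^2) / x^(j + 1). The constant term 1/x lacks the factor 1 + x^2, so exponent 0 is not a
  \<open>moment\<close>; \<alpha>, \<beta> and -\<gamma> enter at exponents 0, 1 and -1.\<close>

definition coefficient :: "int \<Rightarrow> real" where
  "coefficient j = (if j = -1 then - \<gamma> else if j = 0 then \<alpha> + (\<integral>x. 1 / x \<partial>\<nu>)
     else if j = 1 then \<beta> + moment (-2) else moment (- j - 1))"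

lemma remainder_integrable:
  assumes "integrable \<nu> (\<lambda>x. 1 / x ^ m)" "2 \<le> m" "0 < Im z"
  shows "integrable \<nu> (\<lambda>x. of_real ((1 + x\<^sup>2) / x ^ m) / (of_real x - z))"
proof (rule Bochner_Integration.integrable_bound[where f = "\<lambda>x. ((1 + x\<^sup>2) / x ^ m) * (1 / Im z)"])
  show "integrable \<nu> (\<lambda>x. ((1 + x\<^sup>2) / x ^ m) * (1 / Im z))"
    by (intro integrable_mult_left integrable_weighted_inverse_power[OF assms(1)]) (use assms in auto)
  have "norm (complex_of_real ((1 + x\<^sup>2) / x ^ m) / (of_real x - z)) \<le> norm (((1 + x\<^sup>2) / x ^ m) * (1 / Im z))" for x
  proof -
    have "norm (complex_of_real ((1 + x\<^sup>2) / x ^ m)) / norm (of_real x - z) \<le> norm ((1 + x\<^sup>2) / x ^ m) / Im z"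
      using Im_le_norm_diff[OF assms(3), of x] assms(3) by (intro frac_le) (auto simp only: norm_of_real real_norm_def)
    then show ?thesis using assms(3) by (simp add: norm_divide norm_mult abs_mult)
  qed
  then show "AE x in \<nu>. norm (complex_of_real ((1 + x\<^sup>2) / x ^ m) / (of_real x - z)) \<le> norm (((1 + x\<^sup>2) / x ^ m) * (1 / Im z))"
    by simp
qed measurable

lemma remainder_eq:
  assumes int: "integrable \<nu> (\<lambda>x. 1 / x ^ m)" and m: "2 \<le> m" and z: "0 < Im z"
  shows "h z - (\<Sum>k\<in>{-1..int m - 1}. complex_of_real (coefficient k) * z powi k) =
    z ^ m * (\<integral>x. of_real ((1 + x\<^sup>2) / x ^ m) / (of_real x - z) \<partial>\<nu>)"
proof -
  obtain n where n: "m = Suc n" "1 \<le> n" using m by (cases m) auto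
  have int1: "integrable \<nu> (\<lambda>x. complex_of_real (1 / x))"
    using integrable_inverse_power_mono[OF int, of 1] m by (intro integrable_of_real) simp
  have intj: "integrable \<nu> (\<lambda>x. complex_of_real ((1 + x\<^sup>2) / x ^ Suc j))" if "j \<in> {1..n}" for j
    by (intro integrable_of_real integrable_weighted_inverse_power[OF int]) (use that n in auto)
  have intsum: "integrable \<nu> (\<lambda>x. \<Sum>j=1..n. z ^ j * complex_of_real ((1 + x\<^sup>2) / x ^ Suc j))"
    by (intro Bochner_Integration.integrable_sum integrable_mult_right intj)
  have momj: "(\<integral>x. (1 + x\<^sup>2) / x ^ Suc j \<partial>\<nu>) = moment (- int j - 1)" for j
    unfolding moment_def
    by (intro Bochner_Integration.integral_cong refl)
       (simp add: power_int_diff power_int_minus field_simps)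
  have "(\<integral>x. nevanlinna_kernel z x \<partial>\<nu>) = (\<integral>x. of_real (1 / x) + (\<Sum>j=1..n. z ^ j * of_real ((1 + x\<^sup>2) / x ^ Suc j)) +
     z ^ m * (of_real ((1 + x\<^sup>2) / x ^ m) / (of_real x - z)) \<partial>\<nu>)"
  proof (rule integral_cong_AE)
    show "AE x in \<nu>. nevanlinna_kernel z x = of_real (1 / x) + (\<Sum>j=1..n. z ^ j * of_real ((1 + x\<^sup>2) / x ^ Suc j)) +
       z ^ m * (of_real ((1 + x\<^sup>2) / x ^ m) / (of_real x - z))"
      using AE_nonzero unfolding n(1) by eventually_elim (rule nevanlinna_kernel_expansion[OF _ z])
  qed measurable
  also have "\<dots> = (\<integral>x. of_real (1 / x) + (\<Sum>j=1..n. z ^ j * of_real ((1 + x\<^sup>2) / x ^ Suc j)) \<partial>\<nu>) +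
     (\<integral>x. z ^ m * (of_real ((1 + x\<^sup>2) / x ^ m) / (of_real x - z)) \<partial>\<nu>)"
    by (intro Bochner_Integration.integral_add Bochner_Integration.integrable_add int1 intsum integrable_mult_right
        remainder_integrable[OF int m z])
  also have "(\<integral>x. of_real (1 / x) + (\<Sum>j=1..n. z ^ j * of_real ((1 + x\<^sup>2) / x ^ Suc j)) \<partial>\<nu>) =
     (\<integral>x. of_real (1 / x) \<partial>\<nu>) + (\<integral>x. (\<Sum>j=1..n. z ^ j * of_real ((1 + x\<^sup>2) / x ^ Suc j)) \<partial>\<nu>)"
    by (rule Bochner_Integration.integral_add[OF int1 intsum])
  also have "(\<integral>x. (\<Sum>j=1..n. z ^ j * of_real ((1 + x\<^sup>2) / x ^ Suc j)) \<partial>\<nu>) =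
     (\<Sum>j=1..n. \<integral>x. z ^ j * of_real ((1 + x\<^sup>2) / x ^ Suc j) \<partial>\<nu>)"
    by (intro Bochner_Integration.integral_sum integrable_mult_right intj)
  finally have *: "(\<integral>x. nevanlinna_kernel z x \<partial>\<nu>) = of_real (\<integral>x. 1 / x \<partial>\<nu>) + (\<Sum>j=1..n. z ^ j * of_real (moment (- int j - 1))) +
     z ^ m * (\<integral>x. of_real ((1 + x\<^sup>2) / x ^ m) / (of_real x - z) \<partial>\<nu>)"
    unfolding integral_mult_right_zero integral_complex_of_real momj .
  \<comment> \<open>Exponents 0 and 1 are split off because \<open>coefficient\<close> has separate
    cases there.\<close>
  have set_eq: "{..<m} = insert 0 (insert 1 {2..n})" unfolding n(1) using n(2) by auto
  have sum_m: "sum f {..<m} = f 0 + (f 1 + sum f {2..n})" for f :: "nat \<Rightarrow> complex"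
    unfolding set_eq by (subst sum.insert; simp)+
  have sum_n: "sum f {1..n} = f 1 + sum f {2..n}" for f :: "nat \<Rightarrow> complex"
    using sum.atLeast_Suc_atMost[OF n(2), of f] by (simp add: numeral_2_eq_2)
  have tail: "(\<Sum>j=2..n. complex_of_real (coefficient (int j)) * z ^ j) =
      (\<Sum>j=2..n. z ^ j * of_real (moment (- int j - 1)))"
    by (intro sum.cong refl) (simp add: coefficient_def)
  show ?thesis
    unfolding sum_expansion_split rep[OF z] * sum_m sum_n tail by (simp add: coefficient_def algebra_simps)
qed

text \<open>After division by z^(m - 1) the remainder integrates the weight (1 + x^2) / x^m against
  z / (x - z). In a Stoltz domain this factor is bounded by 1 / sin \<theta>, and it tends to 0 for
  each x other than 0.\<close>

lemma expansion_of_integrable: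
  assumes int: "integrable \<nu> (\<lambda>x. 1 / x ^ m)" and m: "2 \<le> m"
  shows "has_expansion_at_0 h (int m - 1) coefficient"
  unfolding has_expansion_at_0_def
proof (intro allI impI)
  fix \<theta> :: real assume \<theta>: "0 < \<theta> \<and> \<theta> \<le> pi / 2"
  let ?F = "at 0 within stoltz \<theta>"
  define W where "W x = (1 + x\<^sup>2) / x ^ m" for x :: real
  have [measurable]: "W \<in> borel_measurable borel" unfolding W_def by measurable
  have L: "((\<lambda>z. \<integral>x. z * (of_real (W x) / (of_real x - z)) \<partial>\<nu>) \<longlongrightarrow> (\<integral>x. 0 \<partial>\<nu>)) ?F"
  proof (rule integral_dominated_convergence_within[where w = "\<lambda>x. norm (W x) * (1 / sin \<theta>)"])
    show "integrable \<nu> (\<lambda>x. norm (W x) * (1 / sin \<theta>))"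
      unfolding W_def by (intro integrable_mult_left integrable_norm integrable_weighted_inverse_power[OF int]) (use m in auto)
    show "\<forall>\<^sub>F z in ?F. AE x in \<nu>. norm (z * (of_real (W x) / (of_real x - z))) \<le> norm (W x) * (1 / sin \<theta>)"
      using eventually_stoltz
    proof eventually_elim
      case (elim z)
      then have z: "0 < Im z" by (simp add: stoltz_def)
      have "norm (z * (of_real (W x) / (of_real x - z))) \<le> norm (W x) * (1 / sin \<theta>)" for x
      proof -
        have "norm (z * (of_real (W x) / (of_real x - z))) = norm (W x) * (norm z / norm (of_real x - z))"
          by (simp add: norm_mult norm_divide)
        also have "\<dots> \<le> norm (W x) * (norm z / Im z)"
          using Im_le_norm_diff[OF z, of x] z by (intro mult_left_mono frac_le) auto
        also have "\<dots> \<le> norm (W x) * (1 / sin \<theta>)"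
          using stoltz_quotient_le[OF elim] \<theta> by (intro mult_left_mono) auto
        finally show ?thesis .
      qed
      then show ?case by simp
    qed
    show "AE x in \<nu>. ((\<lambda>z. z * (of_real (W x) / (of_real x - z))) \<longlongrightarrow> 0) ?F"
      using AE_nonzero
    proof eventually_elim
      case (elim x)
      have "((\<lambda>z. z * (of_real (W x) / (of_real x - z))) \<longlongrightarrow> 0 * (of_real (W x) / (of_real x - 0))) ?F"
        using elim by (intro tendsto_intros tendsto_ident_at) auto
      then show ?case by simp
    qed
  qed measurable
  have ev: "\<forall>\<^sub>F z in ?F. (\<integral>x. z * (of_real (W x) / (of_real x - z)) \<partial>\<nu>) =
      (h z - (\<Sum>k\<in>{-1..int m - 1}. complex_of_real (coefficient k) * z powi k)) / z powi (int m - 1)"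
    using eventually_stoltz
  proof eventually_elim
    case (elim z)
    then have z: "0 < Im z" "z \<noteq> 0" by (auto simp: stoltz_def)
    show ?case
      unfolding remainder_eq[OF int m z(1)] W_def integral_mult_right_zero using z(2)
      by (simp add: power_int_diff)
  qed
  show "((\<lambda>z. (h z - (\<Sum>k\<in>{-1..int m - 1}. complex_of_real (coefficient k) * z powi k)) /
      z powi (int m - 1)) \<longlongrightarrow> 0) ?F"
    by (rule Lim_transform_eventually[OF tendsto_eq_rhs[OF L] ev]) simp
qed

text \<open>z times the kernel tends to 0 wherever x is not 0, so \<nu> contributes nothing to the
  pole and \<gamma> alone determines its coefficient.\<close>

lemma expansion_order_minus_1:
  assumes "a (-1) = - \<gamma>"
  shows "has_expansion_at_0 h (-1) a"
  unfolding has_expansion_at_0_def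
proof (intro allI impI)
  fix \<theta> :: real assume \<theta>: "0 < \<theta> \<and> \<theta> \<le> pi / 2"
  let ?F = "at 0 within stoltz \<theta>"
  have s: "0 < sin \<theta>" using \<theta> by (intro sin_gt_zero) auto
  \<comment> \<open>For |z| < 1 the kernel estimate gives |z|^2 \<le> 1 and (|z| / Im z) * (1 +
    |z|^2) \<le> 2 / sin \<theta>.\<close>
  have "((\<lambda>z. \<integral>x. z * nevanlinna_kernel z x \<partial>\<nu>) \<longlongrightarrow> (\<integral>x. 0 \<partial>\<nu>)) ?F"
  proof (rule integral_dominated_convergence_within[where w = "\<lambda>x. 1 + (1 / sin \<theta>) * 2"])
    have "\<forall>\<^sub>F z in ?F. norm z < 1"
      by (rule order_tendstoD(2)[OF tendsto_norm[OF tendsto_ident_at]]) simp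
    then show "\<forall>\<^sub>F z in ?F. AE x in \<nu>. norm (z * nevanlinna_kernel z x) \<le> 1 + (1 / sin \<theta>) * 2"
      using eventually_stoltz
    proof eventually_elim
      case (elim z)
      then have z: "0 < Im z" by (simp add: stoltz_def)
      have n: "(norm z)\<^sup>2 \<le> 1" using elim by (simp add: power_le_one)
      have "norm (z * nevanlinna_kernel z x) \<le> 1 + (1 / sin \<theta>) * 2" for x
      proof -
        have "norm (z * nevanlinna_kernel z x) \<le> norm z * (norm z + (1 + (norm z)\<^sup>2) / Im z)"
          unfolding norm_mult by (intro mult_left_mono norm_nevanlinna_kernel_le z) auto
        also have "\<dots> = (norm z)\<^sup>2 + (norm z / Im z) * (1 + (norm z)\<^sup>2)"
          by (simp add: power2_eq_square algebra_simps add_divide_distrib)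
        also have "\<dots> \<le> 1 + (1 / sin \<theta>) * 2"
          using n s stoltz_quotient_le[OF elim(2)] \<theta> z by (intro add_mono mult_mono) auto
        finally show ?thesis .
      qed
      then show ?case by simp
    qed
    show "AE x in \<nu>. ((\<lambda>z. z * nevanlinna_kernel z x) \<longlongrightarrow> 0) ?F"
      using AE_nonzero
    proof eventually_elim
      case (elim x)
      have "((\<lambda>z. z * nevanlinna_kernel z x) \<longlongrightarrow> 0 * ((1 + of_real x * 0) / (of_real x - 0))) ?F"
        unfolding nevanlinna_kernel_def using elim by (intro tendsto_intros tendsto_ident_at) auto
      then show ?case by simp
    qed
  qed (auto simp: integrable_const)
  then have int: "((\<lambda>z. \<integral>x. z * nevanlinna_kernel z x \<partial>\<nu>) \<longlongrightarrow> 0) ?F" by simp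
  have "((\<lambda>z. z * (complex_of_real \<alpha> + \<beta> * z)) \<longlongrightarrow> 0 * (complex_of_real \<alpha> + complex_of_real \<beta> * 0)) ?F"
    by (intro tendsto_intros tendsto_ident_at)
  from tendsto_add[OF this int]
  have "((\<lambda>z. z * (complex_of_real \<alpha> + \<beta> * z) + (\<integral>x. z * nevanlinna_kernel z x \<partial>\<nu>)) \<longlongrightarrow> 0) ?F"
    by simp
  moreover have "\<forall>\<^sub>F z in ?F. z * (complex_of_real \<alpha> + \<beta> * z) + (\<integral>x. z * nevanlinna_kernel z x \<partial>\<nu>) =
      (h z - (\<Sum>k\<in>{-1..-1}. complex_of_real (a k) * z powi k)) / z powi (-1)"
    using eventually_stoltz
  proof eventually_elim
    case (elim z)
    then have z: "0 < Im z" "z \<noteq> 0" by (auto simp: stoltz_def)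
    show ?case using z(2) assms unfolding rep[OF z(1)] by (simp add: algebra_simps divide_inverse)
  qed
  ultimately show "((\<lambda>z. (h z - (\<Sum>k\<in>{-1..-1}. complex_of_real (a k) * z powi k)) / z powi (-1)) \<longlongrightarrow> 0) ?F"
    by (rule Lim_transform_eventually)
qed

end

section \<open>Moments from expansions, and inversion\<close>

lemma power_int_neg_inverse:
  fixes x :: "'a::field"
  shows "(- 1 / x) powi (- j) = (-1) powi j * x powi j"
proof -
  have "- 1 / x = inverse (-1 * x)" by (simp add: field_simps)
  then have "(- 1 / x) powi (- j) = (-1 * x) powi j"
    by (simp only: power_int_minus power_int_inverse inverse_inverse_eq)
  then show ?thesis by (simp only: power_int_mult_distrib)
qed

text \<open>Under x to -1/x the weight 1 + x^2 becomes (1 + x^2) / x^2, so the exponent k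
  corresponds to -k - 2 rather than to -k.\<close>

lemma inversion_weight_eq:
  fixes x :: real
  assumes "x \<noteq> 0"
  shows "(- 1 / x) powi (- k - 2) * (1 + (- 1 / x)\<^sup>2) = (-1) powi k * (x powi k * (1 + x\<^sup>2))"
proof -
  have "(- 1 / x) powi (- (k + 2)) = (-1) powi (k + 2) * x powi (k + 2)"
    by (rule power_int_neg_inverse)
  also have "\<dots> = (- 1) powi k * (x powi k * x\<^sup>2)"
    using assms by (simp add: power_int_add)
  finally have "(- 1 / x) powi (- k - 2) = (- 1) powi k * (x powi k * x\<^sup>2)" by simp
  moreover have "x\<^sup>2 * (1 + (- 1 / x)\<^sup>2) = 1 + x\<^sup>2"
    using assms by (simp add: field_simps)
  ultimately show ?thesis by (simp only: mult.assoc)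
qed

section \<open>From expansions to inverse moments, and transport to infinity\<close>

context nevanlinna
begin

text \<open>The inductive step of the converse. The finite inverse moment identifies the remainder
  as an explicit integral. At z = iy one has Re (w / z) = Im w / y, so the real part of the
  normalised error is the Poisson integral below minus a constant, and the error tends to 0.\<close>

lemma poisson_moment_tendsto:
  assumes int: "integrable \<nu> (\<lambda>x. 1 / x ^ (2 * N))"
    and a: "has_expansion_at_0 h (2 * int N + 1) a"
  shows "\<exists>c. ((\<lambda>y. \<integral>x. (1 + x\<^sup>2) / x ^ (2 * N) * poisson y 0 x / y \<partial>\<nu>) \<longlongrightarrow> c) (at_right 0)"
proof -
  define U where "U y = (\<integral>x. (1 + x\<^sup>2) / x ^ (2 * N) * poisson y 0 x / y \<partial>\<nu>)" for y
  define E :: "complex \<Rightarrow> complex" where "E z = (h z - (\<Sum>k\<in>{-1..2 * int N + 1}. complex_of_real (a k) * z powi k)) / z powi (2 * int N + 1)" for z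
  have "(E \<longlongrightarrow> 0) (at 0 within stoltz (pi/4))"
    using a pi_gt_zero unfolding has_expansion_at_0_def E_def[abs_def] by simp
  from filterlim_compose[OF this filterlim_imaginary_axis]
  have "((\<lambda>y. E (Complex 0 y)) \<longlongrightarrow> 0) (at_right 0)"
    using pi_gt_zero by simp
  then have lim: "((\<lambda>y. Re (E (Complex 0 y))) \<longlongrightarrow> 0) (at_right 0)"
    using tendsto_Re by fastforce
  \<comment> \<open>The two top terms are isolated: at z = iy the first is purely imaginary and the
    second a real constant.\<close>
  have E_split: "E z = (h z - (\<Sum>k\<in>{-1..int (2 * N) - 1}. complex_of_real (a k) * z powi k)) / z ^ Suc (2 * N)
       - a (2 * int N) / z - a (2 * int N + 1)" if "z \<noteq> 0" for z :: complex
  proof -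
    have "z powi (2 * int N + 1) = z ^ Suc (2 * N)"
      by (simp add: power_int_def nat_add_distrib nat_mult_distrib)
    moreover have "(\<Sum>k\<in>{-1..2 * int N + 1}. complex_of_real (a k) * z powi k) =
       (\<Sum>k\<in>{-1..int (2 * N) - 1}. complex_of_real (a k) * z powi k) + a (2 * int N) * z ^ (2 * N) + a (2 * int N + 1) * z ^ Suc (2 * N)"
      using sum_expansion_split[of a z "Suc (Suc (2 * N))"] sum_expansion_split[of a z "2 * N"]
      by (simp add: add_ac)
    ultimately show ?thesis
      unfolding E_def using that by (simp add: field_simps)
  qed
  have Re_div: "Re (w / Complex 0 y) = Im w / y" if "0 < y" for w y
    using that by (simp add: Re_divide power2_eq_square)
  have "\<exists>c. \<forall>y>0. Re (E (Complex 0 y)) = U y - c"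
  proof (cases "N = 0")
    case True
    \<comment> \<open>For N = 0 there is no inverse moment to exploit; the kernel itself takes the
      place of the remainder, and only the pole has to be matched. Here \<beta> joins the constant
      c.\<close>
    have a_m1: "a (-1) = - \<gamma>"
      using has_expansion_at_0_unique[OF has_expansion_at_0_mono[OF a, of "-1"] expansion_order_minus_1[of "\<lambda>_. - \<gamma>"], of "-1"]
      by simp
    have "Re (E (Complex 0 y)) = U y - (a 1 - \<beta>)" if y: "0 < y" for y
    proof -
      define z where "z = Complex 0 y"
      have z: "0 < Im z" "z \<noteq> 0" using y by (auto simp: z_def complex_eq_iff)
      have "(\<Sum>k\<in>{-1..int (2 * N) - 1}. complex_of_real (a k) * z powi k) = - \<gamma> / z"
        unfolding sum_expansion_split using True a_m1 by simp
      then have "E z = (\<alpha> + (\<integral>x. nevanlinna_kernel z x \<partial>\<nu>) - a 0) / z + (\<beta> - a 1)"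
        unfolding E_split[OF z(2)] rep[OF z(1)] using True z(2) by (simp add: field_simps)
      then have "Re (E z) = Im (\<integral>x. nevanlinna_kernel z x \<partial>\<nu>) / y + (\<beta> - a 1)"
        using Re_div[OF y] by (simp add: z_def)
      also have "Im (\<integral>x. nevanlinna_kernel z x \<partial>\<nu>) = (\<integral>x. (1 + x\<^sup>2) * poisson y 0 x \<partial>\<nu>)"
        using integrable_kernel[OF z(1)] Im_nevanlinna_kernel[OF y, of 0] by (simp add: z_def flip: integral_Im)
      finally show ?thesis
        using True by (simp add: U_def z_def)
    qed
    then show ?thesis by blast
  next
    case False
    then have N: "2 \<le> 2 * N" by simp
    have coeff: "a k = coefficient k" if "-1 \<le> k" "k \<le> int (2 * N) - 1" for k
      using has_expansion_at_0_unique[OF has_expansion_at_0_mono[OF a, of "int (2 * N) - 1"] expansion_of_integrable[OF int N]] that N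
      by simp
    have "Re (E (Complex 0 y)) = U y - a (2 * int N + 1)" if y: "0 < y" for y
    proof -
      define z where "z = Complex 0 y"
      have z: "0 < Im z" "z \<noteq> 0" using y by (auto simp: z_def complex_eq_iff)
      define I where "I = (\<integral>x. of_real ((1 + x\<^sup>2) / x ^ (2 * N)) / (of_real x - z) \<partial>\<nu>)"
      have "(\<Sum>k\<in>{-1..int (2 * N) - 1}. complex_of_real (a k) * z powi k) =
          (\<Sum>k\<in>{-1..int (2 * N) - 1}. complex_of_real (coefficient k) * z powi k)"
        using coeff by (intro sum.cong) auto
      then have "E z = z ^ (2 * N) * I / z ^ Suc (2 * N) - a (2 * int N) / z - a (2 * int N + 1)"
        unfolding E_split[OF z(2)] I_def using remainder_eq[OF int N z(1)] by simp
      also have "\<dots> = (I - a (2 * int N)) / z - a (2 * int N + 1)"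
        using z(2) by (simp add: field_simps)
      finally have "Re (E z) = Im I / y - a (2 * int N + 1)"
        using Re_div[OF y] by (simp add: z_def)
      also have "Im I = (\<integral>x. Im (of_real ((1 + x\<^sup>2) / x ^ (2 * N)) / (of_real x - z)) \<partial>\<nu>)"
        unfolding I_def by (rule integral_Im[symmetric]) (rule remainder_integrable[OF int N z(1)])
      also have "\<dots> = (\<integral>x. (1 + x\<^sup>2) / x ^ (2 * N) * poisson y 0 x \<partial>\<nu>)"
      proof (intro Bochner_Integration.integral_cong refl)
        fix x
        have "Im (of_real w / (of_real x - z)) = w * poisson y 0 x" for w
          unfolding z_def Im_inverse_diff[OF y, of x 0, symmetric] by (simp add: Im_divide)
        then show "Im (of_real ((1 + x\<^sup>2) / x ^ (2 * N)) / (of_real x - z)) = (1 + x\<^sup>2) / x ^ (2 * N) * poisson y 0 x" .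
      qed
      finally show ?thesis unfolding U_def z_def integral_divide_zero .
    qed
    then show ?thesis by blast
  qed
  then obtain c where c: "\<And>y. 0 < y \<Longrightarrow> Re (E (Complex 0 y)) = U y - c" by blast
  have "((\<lambda>y. Re (E (Complex 0 y)) + c) \<longlongrightarrow> 0 + c) (at_right 0)"
    by (intro tendsto_add lim tendsto_const)
  moreover have "\<forall>\<^sub>F y in at_right 0. Re (E (Complex 0 y)) + c = U y"
    using eventually_at_right_less[of 0] by eventually_elim (simp add: c)
  ultimately have "(U \<longlongrightarrow> 0 + c) (at_right 0)" by (rule Lim_transform_eventually)
  then show ?thesis unfolding U_def by blast
qed

text \<open>Divided by y, the Poisson kernel at 0 is 1 / (x^2 + y^2), which tends to 1 / x^2.
  Fatou's lemma therefore gains two inverse powers per step, starting from finiteness of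
  \<nu>.\<close>

lemma integrable_of_expansion:
  assumes "has_expansion_at_0 h (2 * int N - 1) a"
  shows "integrable \<nu> (\<lambda>x. 1 / x ^ (2 * N))"
  using assms
proof (induction N)
  case 0
  then show ?case by simp
next
  case (Suc N)
  have a: "has_expansion_at_0 h (2 * int N + 1) a" using Suc.prems by (simp add: algebra_simps)
  have int: "integrable \<nu> (\<lambda>x. 1 / x ^ (2 * N))"
    by (rule Suc.IH[OF has_expansion_at_0_mono[OF a]]) auto
  obtain c where c: "((\<lambda>y. \<integral>x. (1 + x\<^sup>2) / x ^ (2 * N) * poisson y 0 x / y \<partial>\<nu>) \<longlongrightarrow> c) (at_right 0)"
    using poisson_moment_tendsto[OF int a] by blast
  define X where "X n = inverse (real (Suc n))" for n
  have X0: "0 < X n" for n by (simp add: X_def)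
  have X: "filterlim X (at_right 0) sequentially"
    unfolding filterlim_at using LIMSEQ_inverse_real_of_nat X0 by (simp add: X_def[abs_def])
  have "integrable \<nu> (\<lambda>x. x powi (- int (2 * Suc N)) * (1 + x\<^sup>2))"
  proof (rule integrable_Fatou)
    show "integrable \<nu> (\<lambda>x. (1 + x\<^sup>2) / x ^ (2 * N) * poisson (X n) 0 x / X n)" for n
    proof (rule Bochner_Integration.integrable_bound)
      \<comment> \<open>The constant is \<open>poisson_growth\<close> at t = 0 and R = 0, with the
        kernel bounded by 1 / X n.\<close>
      show "integrable \<nu> (\<lambda>x. (1 / X n + 2 * X n) / X n * (1 / x ^ (2 * N)))"
        by (intro integrable_mult_right int)
      have "norm ((1 + x\<^sup>2) / x ^ (2 * N) * poisson (X n) 0 x / X n) \<le> norm ((1 / X n + 2 * X n) / X n * (1 / x ^ (2 * N)))" for x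
      proof -
        have "(1 + x\<^sup>2) * poisson (X n) 0 x \<le> 1 / X n + 2 * X n"
          using poisson_growth[OF X0[of n], of 0 0 x] poisson_le[OF X0[of n], of 0 x] by simp
        then have "(1 + x\<^sup>2) * poisson (X n) 0 x * (\<bar>1 / x ^ (2 * N)\<bar> / X n) \<le> (1 / X n + 2 * X n) * (\<bar>1 / x ^ (2 * N)\<bar> / X n)"
          using X0[of n] by (intro mult_right_mono) auto
        then show ?thesis
          using X0[of n] poisson_nonneg[OF X0[of n], of 0 x] by (simp add: abs_mult mult.commute)
      qed
      then show "AE x in \<nu>. norm ((1 + x\<^sup>2) / x ^ (2 * N) * poisson (X n) 0 x / X n) \<le> norm ((1 / X n + 2 * X n) / X n * (1 / x ^ (2 * N)))"
        by simp
    qed measurable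
    show "AE x in \<nu>. 0 \<le> (1 + x\<^sup>2) / x ^ (2 * N) * poisson (X n) 0 x / X n" for n
      using X0[of n] poisson_nonneg[OF X0[of n], of 0] by (intro AE_I2) (auto simp: power_mult)
    show "(\<lambda>n. \<integral>x. (1 + x\<^sup>2) / x ^ (2 * N) * poisson (X n) 0 x / X n \<partial>\<nu>) \<longlonglongrightarrow> c"
      by (rule filterlim_compose[OF c X])
    show "AE x in \<nu>. (\<lambda>n. (1 + x\<^sup>2) / x ^ (2 * N) * poisson (X n) 0 x / X n) \<longlonglongrightarrow> x powi (- int (2 * Suc N)) * (1 + x\<^sup>2)"
      using AE_nonzero
    proof eventually_elim
      case (elim x)
      have X_lim: "X \<longlonglongrightarrow> 0" using X by (simp add: filterlim_at)
      have "(\<lambda>n. (1 + x\<^sup>2) / x ^ (2 * N) * (1 / ((x - 0)\<^sup>2 + (X n)\<^sup>2))) \<longlonglongrightarrow> (1 + x\<^sup>2) / x ^ (2 * N) * (1 / ((x - 0)\<^sup>2 + 0\<^sup>2))"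
        using elim by (intro tendsto_intros X_lim) auto
      moreover have "(1 + x\<^sup>2) / x ^ (2 * N) * (1 / ((x - 0)\<^sup>2 + (X n)\<^sup>2)) = (1 + x\<^sup>2) / x ^ (2 * N) * poisson (X n) 0 x / X n" for n
        using X0[of n] by (simp add: poisson_def)
      moreover have "(1 + x\<^sup>2) / x ^ (2 * N) * (1 / ((x - 0)\<^sup>2 + 0\<^sup>2)) = x powi (- int (2 * Suc N)) * (1 + x\<^sup>2)"
      proof -
        have "x powi (- int (2 * Suc N)) = 1 / x ^ (2 * Suc N)"
          by (simp only: power_int_minus power_int_of_nat inverse_eq_divide)
        then show ?thesis by (simp add: power2_eq_square)
      qed
      ultimately show ?case by (simp only:)
    qed
  qed measurable
  then show ?case
    using integrable_weighted_inverse_power_iff[of "2 * Suc N"] by simp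
qed

text \<open>Inverting x and inverting z have the same effect on the kernel, so the inverted function
  is represented by the image measure.\<close>

lemma inversion: "nevanlinna (\<lambda>z. h (- 1 / z)) \<alpha> \<gamma> \<beta> (distr \<nu> borel (\<lambda>x. - 1 / x))"
proof (intro nevanlinna.intro finite_measureI nevanlinna_axioms.intro)
  have [measurable]: "(\<lambda>x::real. - 1 / x) \<in> borel_measurable \<nu>" by measurable
  show "emeasure (distr \<nu> borel (\<lambda>x. - 1 / x)) (space (distr \<nu> borel (\<lambda>x. - 1 / x))) \<noteq> \<infinity>"
    by (subst emeasure_distr) auto
  show "AE x in distr \<nu> borel (\<lambda>x. - 1 / x). x \<noteq> 0"
    using AE_nonzero by (subst AE_distr_iff) auto
  fix z :: complex assume z: "0 < Im z"
  then have z0: "z \<noteq> 0" by auto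
  have z': "0 < Im (- 1 / z)" using z by (simp add: Im_divide add_pos_nonneg zero_less_divide_iff sum_power2_gt_zero_iff)
  have "(\<integral>x. nevanlinna_kernel z x \<partial>distr \<nu> borel (\<lambda>x. - 1 / x)) = (\<integral>x. nevanlinna_kernel z (- 1 / x) \<partial>\<nu>)"
    by (rule integral_distr) auto
  also have "\<dots> = (\<integral>x. nevanlinna_kernel (- 1 / z) x \<partial>\<nu>)"
  proof (rule integral_cong_AE)
    show "AE x in \<nu>. nevanlinna_kernel z (- 1 / x) = nevanlinna_kernel (- 1 / z) x"
      using AE_nonzero
    proof eventually_elim
      case (elim x)
      have nz: "1 + of_real x * z \<noteq> 0" using z elim by (auto simp: complex_eq_iff)
      have eqs: "of_real (- 1 / x) - z = - (1 + of_real x * z) / of_real x" "1 + of_real (- 1 / x) * z = (of_real x - z) / of_real x"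
        "of_real x - (- 1 / z) = (1 + of_real x * z) / z" "1 + of_real x * (- 1 / z) = - (of_real x - z) / z"
        using elim z0 by (simp_all add: field_simps)
      show ?case
        unfolding nevanlinna_kernel_def eqs using elim z0
          minus_divide_divide[of "z - of_real x" "1 + of_real x * z"] by simp
    qed
  qed measurable
  finally show "h (- 1 / z) = \<alpha> + \<gamma> * z - \<beta> / z + (\<integral>x. nevanlinna_kernel z x \<partial>distr \<nu> borel (\<lambda>x. - 1 / x))"
    unfolding rep[OF z'] using z0 by simp
qed simp

lemma integrable_inversion_iff:
  "integrable (distr \<nu> borel (\<lambda>x. - 1 / x)) (\<lambda>x. x powi (- k - 2) * (1 + x\<^sup>2)) \<longleftrightarrow>
     integrable \<nu> (\<lambda>x. x powi k * (1 + x\<^sup>2))"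
proof -
  have "integrable (distr \<nu> borel (\<lambda>x. - 1 / x)) (\<lambda>x. x powi (- k - 2) * (1 + x\<^sup>2)) \<longleftrightarrow>
      integrable \<nu> (\<lambda>x. (- 1 / x) powi (- k - 2) * (1 + (- 1 / x)\<^sup>2))"
    by (rule integrable_distr_eq) auto
  also have "\<dots> \<longleftrightarrow> integrable \<nu> (\<lambda>x. (-1) powi k * (x powi k * (1 + x\<^sup>2)))"
  proof (rule integrable_cong_AE)
    show "AE x in \<nu>. (- 1 / x) powi (- k - 2) * (1 + (- 1 / x)\<^sup>2) = (-1) powi k * (x powi k * (1 + x\<^sup>2))"
      using AE_nonzero by eventually_elim (rule inversion_weight_eq)
  qed measurable
  also have "\<dots> \<longleftrightarrow> integrable \<nu> (\<lambda>x. x powi k * (1 + x\<^sup>2))"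
    by simp
  finally show ?thesis .
qed

lemma moment_inversion:
  "nevanlinna.moment (distr \<nu> borel (\<lambda>x. - 1 / x)) (- k - 2) = (-1) powi k * moment k"
proof -
  have "nevanlinna.moment (distr \<nu> borel (\<lambda>x. - 1 / x)) (- k - 2) =
      (\<integral>x. (- 1 / x) powi (- k - 2) * (1 + (- 1 / x)\<^sup>2) \<partial>\<nu>)"
    unfolding nevanlinna.moment_def[OF inversion] by (rule integral_distr) auto
  also have "\<dots> = (\<integral>x. (-1) powi k * (x powi k * (1 + x\<^sup>2)) \<partial>\<nu>)"
  proof (rule integral_cong_AE)
    show "AE x in \<nu>. (- 1 / x) powi (- k - 2) * (1 + (- 1 / x)\<^sup>2) = (-1) powi k * (x powi k * (1 + x\<^sup>2))"
      using AE_nonzero by eventually_elim (rule inversion_weight_eq)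
  qed measurable
  finally show ?thesis by (simp add: moment_def)
qed

end

text \<open>The map reflects the argument in pi/2, and Stoltz domains are symmetric about the
  imaginary axis.\<close>

lemma stoltz_inversion:
  assumes "0 < \<theta>" "z \<in> stoltz \<theta>"
  shows "- 1 / z \<in> stoltz \<theta>"
proof -
  have z: "0 < Im z" "\<theta> < Arg z" "Arg z < pi - \<theta>" using assms(2) by (auto simp: stoltz_def)
  then have z0: "z \<noteq> 0" by auto
  have "Arg (- 1 / z) = pi - Arg z"
  proof (rule Arg_unique[of "1 / norm z"])
    have "exp (\<i> * of_real (pi - Arg z)) = - 1 / exp (\<i> * of_real (Arg z))"
      by (simp add: right_diff_distrib exp_diff)
    moreover have "z = of_real (norm z) * exp (\<i> * of_real (Arg z))"
      using Arg_eq[OF z0] .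
    ultimately show "of_real (1 / norm z) * exp (\<i> * of_real (pi - Arg z)) = - 1 / z"
      by (metis divide_divide_eq_left mult.commute mult_minus1_right of_real_1 of_real_divide times_divide_times_eq mult_1)
  qed (use z z0 assms Arg_le_pi in auto)
  moreover have "0 < Im (- 1 / z)"
    using z(1) by (simp add: Im_divide add_pos_nonneg zero_less_divide_iff sum_power2_gt_zero_iff)
  ultimately show ?thesis using z by (simp add: stoltz_def)
qed

lemma filtermap_inversion:
  assumes "0 < \<theta>"
  shows "filtermap (\<lambda>w. - 1 / w) (at 0 within stoltz \<theta>) = inf at_infinity (principal (stoltz \<theta>))"
proof (rule filter_eqI)
  fix P :: "complex \<Rightarrow> bool"
  have "(\<exists>d>0. \<forall>w\<in>stoltz \<theta>. w \<noteq> 0 \<and> dist w 0 < d \<longrightarrow> P (- 1 / w)) \<longleftrightarrow>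
      (\<exists>b>0. \<forall>z. b \<le> norm z \<longrightarrow> z \<in> stoltz \<theta> \<longrightarrow> P z)"
  proof safe
    fix d :: real assume d: "0 < d" "\<forall>w\<in>stoltz \<theta>. w \<noteq> 0 \<and> dist w 0 < d \<longrightarrow> P (- 1 / w)"
    \<comment> \<open>Twice 1/d is taken because a non-strict lower bound on |z| must yield a strict
      upper bound on |1/z|.\<close>
    have "P z" if "2 / d \<le> norm z" "z \<in> stoltz \<theta>" for z
    proof -
      have z0: "z \<noteq> 0" using that by (auto simp: stoltz_def)
      have "norm (- 1 / z) < d"
      proof -
        have "2 \<le> d * norm z" using that d(1) by (simp add: field_simps)
        then have "1 < d * norm z" by linarith
        then show ?thesis using z0 by (simp add: norm_divide field_simps)
      qed
      then have "P (- 1 / (- 1 / z))"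
        using d(2) stoltz_inversion[OF assms that(2)] z0 by (intro d(2)[rule_format]) (auto simp: dist_norm)
      then show ?thesis by simp
    qed
    then show "\<exists>b>0. \<forall>z. b \<le> norm z \<longrightarrow> z \<in> stoltz \<theta> \<longrightarrow> P z"
      using d(1) by (intro exI[of _ "2 / d"]) auto
  next
    fix b :: real assume b: "0 < b" "\<forall>z. b \<le> norm z \<longrightarrow> z \<in> stoltz \<theta> \<longrightarrow> P z"
    have "P (- 1 / w)" if "w \<in> stoltz \<theta>" "w \<noteq> 0" "dist w 0 < 1 / b" for w
    proof (rule b(2)[rule_format])
      show "b \<le> norm (- 1 / w)"
        using that b(1) by (simp add: norm_divide field_simps)
    qed (rule stoltz_inversion[OF assms that(1)])
    then show "\<exists>d>0. \<forall>w\<in>stoltz \<theta>. w \<noteq> 0 \<and> dist w 0 < d \<longrightarrow> P (- 1 / w)"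
      using b(1) by (intro exI[of _ "1 / b"]) auto
  qed
  then show "eventually P (filtermap (\<lambda>w. - 1 / w) (at 0 within stoltz \<theta>)) \<longleftrightarrow>
      eventually P (inf at_infinity (principal (stoltz \<theta>)))"
    by (simp add: eventually_filtermap eventually_at eventually_inf_principal eventually_at_infinity_pos)
qed

text \<open>Powers of -1/w reverse the exponents and bring in the signs (-1)^j; with this rule every
  statement at infinity becomes one at 0.\<close>

lemma has_expansion_at_inf_iff:
  "has_expansion_at_inf f K b \<longleftrightarrow> has_expansion_at_0 (\<lambda>w. f (- 1 / w)) K (\<lambda>j. (-1) powi j * b (- j))"
proof -
  have "((\<lambda>z. (f z - (\<Sum>k\<in>{-K..1}. complex_of_real (b k) * z powi k)) / z powi (-K)) \<longlongrightarrow> 0)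
          (inf at_infinity (principal (stoltz \<theta>))) \<longleftrightarrow>
     ((\<lambda>w. (f (- 1 / w) - (\<Sum>k\<in>{-1..K}. complex_of_real ((-1) powi k * b (- k)) * w powi k)) / w powi K) \<longlongrightarrow> 0)
          (at 0 within stoltz \<theta>)" (is "?l \<longleftrightarrow> ?r") if \<theta>: "0 < \<theta>" for \<theta>
  proof -
    note pow = power_int_neg_inverse[where 'a = complex]
    have sum_eq: "(\<Sum>k\<in>{-K..1}. complex_of_real (b k) * (- 1 / w) powi k) =
        (\<Sum>k\<in>{-1..K}. complex_of_real ((-1) powi k * b (- k)) * w powi k)" if "w \<noteq> 0" for w
    proof (rule sum.reindex_bij_witness[of _ uminus uminus])
      fix k
      show "complex_of_real ((-1) powi (- k) * b (- (- k))) * w powi (- k) = complex_of_real (b k) * (- 1 / w) powi k"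
        using pow[of w "- k"] by (simp add: of_real_power_int)
    qed auto
    have "?l \<longleftrightarrow> ((\<lambda>w. (f (- 1 / w) - (\<Sum>k\<in>{-K..1}. complex_of_real (b k) * (- 1 / w) powi k)) / (- 1 / w) powi (-K)) \<longlongrightarrow> 0)
          (at 0 within stoltz \<theta>)"
      unfolding filtermap_inversion[OF \<theta>, symmetric] filterlim_filtermap ..
    also have "\<dots> \<longleftrightarrow> ((\<lambda>w. (-1) powi K * ((f (- 1 / w) - (\<Sum>k\<in>{-1..K}. complex_of_real ((-1) powi k * b (- k)) * w powi k)) / w powi K)) \<longlongrightarrow> (-1) powi K * 0)
          (at 0 within stoltz \<theta>)"
    proof (rule filterlim_cong)
      have inv: "1 / (-1) powi K = ((-1) powi K :: complex)"
        using power_int_minus_one_mult_self[of K, where 'a = complex] by (simp add: field_simps)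
      show "\<forall>\<^sub>F w in at 0 within stoltz \<theta>. (f (- 1 / w) - (\<Sum>k\<in>{-K..1}. complex_of_real (b k) * (- 1 / w) powi k)) / (- 1 / w) powi (-K)
         = (-1) powi K * ((f (- 1 / w) - (\<Sum>k\<in>{-1..K}. complex_of_real ((-1) powi k * b (- k)) * w powi k)) / w powi K)"
        using eventually_stoltz
      proof eventually_elim
        case (elim w)
        then have w: "w \<noteq> 0" by (auto simp: stoltz_def)
        have "u / ((-1) powi K * w powi K) = (1 / (-1) powi K) * (u / w powi K)" for u by simp
        then show ?case unfolding sum_eq[OF w] pow inv by simp
      qed
    qed auto
    also have "\<dots> \<longleftrightarrow> ?r" by (rule tendsto_mult_left_iff) simp
    finally show ?thesis .
  qed
  then show ?thesis unfolding has_expansion_at_inf_def has_expansion_at_0_def by blast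
qed

lemma admits_expansion_at_inf_iff:
  "admits_expansion_at_inf f K \<longleftrightarrow> admits_expansion_at_0 (\<lambda>w. f (- 1 / w)) K"
proof
  assume "admits_expansion_at_0 (\<lambda>w. f (- 1 / w)) K"
  then obtain a where a: "has_expansion_at_0 (\<lambda>w. f (- 1 / w)) K a"
    by (auto simp: admits_expansion_at_0_def)
  have "(-1) powi j * ((-1) powi (- j) * a (- (- j))) = a j" for j
    by (simp add: power_int_minus flip: mult.assoc)
  then have "has_expansion_at_inf f K (\<lambda>j. (-1) powi j * a (- j))"
    unfolding has_expansion_at_inf_iff using a by (simp only:)
  then show "admits_expansion_at_inf f K" by (auto simp: admits_expansion_at_inf_def)
qed (auto simp: admits_expansion_at_inf_def admits_expansion_at_0_def has_expansion_at_inf_iff)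

section \<open>Differences of two Herglotz functions\<close>

lemma sym_int_diff:
  assumes "nevanlinna h1 \<alpha>1 \<beta>1 \<gamma>1 \<nu>1" "nevanlinna h2 \<alpha>2 \<beta>2 \<gamma>2 \<nu>2"
    and q: "\<And>z. 0 < Im z \<Longrightarrow> q z = h1 z - h2 z" and pos: "0 < \<epsilon>" "0 < y"
  shows "sym_int q k \<epsilon> y = sym_int h1 k \<epsilon> y - sym_int h2 k \<epsilon> y"
proof -
  interpret h1: nevanlinna h1 \<alpha>1 \<beta>1 \<gamma>1 \<nu>1 by fact
  interpret h2: nevanlinna h2 \<alpha>2 \<beta>2 \<gamma>2 \<nu>2 by fact
  have "sym_int q k \<epsilon> y =
      integral (truncated_line \<epsilon>) (\<lambda>x. x powi k * Im (h1 (Complex x y)) - x powi k * Im (h2 (Complex x y)))"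
    unfolding sym_int_def truncated_line_def by (simp add: q pos right_diff_distrib)
  also have "\<dots> = sym_int h1 k \<epsilon> y - sym_int h2 k \<epsilon> y"
    unfolding sym_int_def truncated_line_def[symmetric]
    by (intro Henstock_Kurzweil_Integration.integral_diff set_borel_integral_eq_integral(1)
        h1.sym_int_integrable h2.sym_int_integrable pos)
  finally show ?thesis .
qed

lemma eventually_at_right_0_less_1: "\<forall>\<^sub>F \<epsilon> in at_right 0. (0::real) < \<epsilon> \<and> \<epsilon> < 1"
  unfolding eventually_at_right_field using zero_less_one by blast

locale nevanlinna_pair =
  h1: nevanlinna h1 \<alpha>1 \<beta>1 \<gamma>1 \<nu>1 + h2: nevanlinna h2 \<alpha>2 \<beta>2 \<gamma>2 \<nu>2
  for h1 \<alpha>1 \<beta>1 \<gamma>1 \<nu>1 h2 \<alpha>2 \<beta>2 \<gamma>2 \<nu>2 +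
  fixes q :: "complex \<Rightarrow> complex"
  assumes q_eq: "\<And>z. 0 < Im z \<Longrightarrow> q z = h1 z - h2 z"
begin

lemma sym_int_q_tendsto:
  assumes "0 < \<epsilon>" "\<epsilon> < 1"
  shows "((\<lambda>y. sym_int q k \<epsilon> y) \<longlongrightarrow> pi * h1.truncated_moment k \<epsilon> - pi * h2.truncated_moment k \<epsilon>) (at_right 0)"
proof -
  have "((\<lambda>y. sym_int h1 k \<epsilon> y - sym_int h2 k \<epsilon> y) \<longlongrightarrow>
      pi * h1.truncated_moment k \<epsilon> - pi * h2.truncated_moment k \<epsilon>) (at_right 0)"
    by (intro tendsto_diff h1.sym_int_tendsto h2.sym_int_tendsto assms)
  moreover have "\<forall>\<^sub>F y in at_right 0. sym_int h1 k \<epsilon> y - sym_int h2 k \<epsilon> y = sym_int q k \<epsilon> y"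
    using eventually_at_right_less[of 0]
    by eventually_elim (simp add: sym_int_diff[OF h1.nevanlinna_axioms h2.nevanlinna_axioms q_eq] assms)
  ultimately show ?thesis by (rule Lim_transform_eventually)
qed

text \<open>The inner limit hidden in \<open>iterated_limit\<close> is unique, so for small
  \<epsilon> it must be pi times the difference of the truncated moments.\<close>

lemma truncated_moments_of_iterated_limit:
  assumes "iterated_limit (sym_int q k) L"
  shows "((\<lambda>\<epsilon>. h1.truncated_moment k \<epsilon> - h2.truncated_moment k \<epsilon>) \<longlongrightarrow> L / pi) (at_right 0)"
proof -
  obtain g where g: "\<forall>\<^sub>F \<epsilon> in at_right 0. ((\<lambda>y. sym_int q k \<epsilon> y) \<longlongrightarrow> g \<epsilon>) (at_right 0)"
    and gL: "(g \<longlongrightarrow> L) (at_right 0)"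
    using assms by (auto simp: iterated_limit_def)
  have "\<forall>\<^sub>F \<epsilon> in at_right 0. g \<epsilon> / pi = h1.truncated_moment k \<epsilon> - h2.truncated_moment k \<epsilon>"
    using g eventually_at_right_0_less_1
  proof eventually_elim
    case (elim \<epsilon>)
    then have "g \<epsilon> = pi * h1.truncated_moment k \<epsilon> - pi * h2.truncated_moment k \<epsilon>"
      by (intro tendsto_unique[OF _ elim(1) sym_int_q_tendsto]) auto
    then show ?case by (simp add: field_simps)
  qed
  moreover have "((\<lambda>\<epsilon>. g \<epsilon> / pi) \<longlongrightarrow> L / pi) (at_right 0)"
    by (intro tendsto_divide gL tendsto_const) simp
  ultimately show ?thesis by (rule Lim_transform_eventually[rotated])
qed

abbreviation "moments_finite k \<equiv>
  integrable \<nu>1 (\<lambda>x. x powi k * (1 + x\<^sup>2)) \<and> integrable \<nu>2 (\<lambda>x. x powi k * (1 + x\<^sup>2))"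

lemma iterated_limit_sym_int:
  assumes "moments_finite k"
  shows "iterated_limit (sym_int q k) (pi * h1.moment k - pi * h2.moment k)"
  unfolding iterated_limit_def
proof (intro exI conjI)
  show "\<forall>\<^sub>F \<epsilon> in at_right 0. ((\<lambda>y. sym_int q k \<epsilon> y) \<longlongrightarrow>
      pi * h1.truncated_moment k \<epsilon> - pi * h2.truncated_moment k \<epsilon>) (at_right 0)"
    using eventually_at_right_0_less_1 by eventually_elim (rule sym_int_q_tendsto, auto)
  show "((\<lambda>\<epsilon>. pi * h1.truncated_moment k \<epsilon> - pi * h2.truncated_moment k \<epsilon>) \<longlongrightarrow>
      pi * h1.moment k - pi * h2.moment k) (at_right 0)"
    using assms by (intro tendsto_intros h1.truncated_moment_tendsto h2.truncated_moment_tendsto) auto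
qed

lemma iterated_limit_sym_int_divide:
  assumes "moments_finite k"
  shows "iterated_limit (\<lambda>\<epsilon> y. sym_int q k \<epsilon> y / pi) (h1.moment k - h2.moment k)"
proof -
  obtain g where g: "\<forall>\<^sub>F \<epsilon> in at_right 0. ((\<lambda>y. sym_int q k \<epsilon> y) \<longlongrightarrow> g \<epsilon>) (at_right 0)"
    and gL: "(g \<longlongrightarrow> pi * h1.moment k - pi * h2.moment k) (at_right 0)"
    using iterated_limit_sym_int[OF assms] by (auto simp: iterated_limit_def)
  show ?thesis
    unfolding iterated_limit_def
  proof (intro exI conjI)
    show "\<forall>\<^sub>F \<epsilon> in at_right 0. ((\<lambda>y. sym_int q k \<epsilon> y / pi) \<longlongrightarrow> g \<epsilon> / pi) (at_right 0)"
      using g by eventually_elim (intro tendsto_divide tendsto_const, auto)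
    have "((\<lambda>\<epsilon>. g \<epsilon> / pi) \<longlongrightarrow> (pi * h1.moment k - pi * h2.moment k) / pi) (at_right 0)"
      by (intro tendsto_divide gL tendsto_const) simp
    then show "((\<lambda>\<epsilon>. g \<epsilon> / pi) \<longlongrightarrow> h1.moment k - h2.moment k) (at_right 0)"
      by (simp add: diff_divide_distrib)
  qed
qed

text \<open>The disjunction rules out cancellation of two infinite moments: the finite one can be
  added back, which isolates the truncated moments of the other function.\<close>

lemma iterated_limit_iff:
  assumes "even k"
    and "integrable \<nu>1 (\<lambda>x. x powi k * (1 + x\<^sup>2)) \<or> integrable \<nu>2 (\<lambda>x. x powi k * (1 + x\<^sup>2))"
  shows "(\<exists>L. iterated_limit (sym_int q k) L) \<longleftrightarrow> moments_finite k"
proof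
  assume "\<exists>L. iterated_limit (sym_int q k) L"
  then obtain L where "iterated_limit (sym_int q k) L" ..
  note L = truncated_moments_of_iterated_limit[OF this]
  show "moments_finite k"
    using assms(2)
  proof
    assume int: "integrable \<nu>1 (\<lambda>x. x powi k * (1 + x\<^sup>2))"
    from tendsto_diff[OF h1.truncated_moment_tendsto[OF int] L]
    have "(h2.truncated_moment k \<longlongrightarrow> h1.moment k - L / pi) (at_right 0)" by simp
    with int show ?thesis using h2.integrable_moment_of_tendsto[OF assms(1)] by blast
  next
    assume int: "integrable \<nu>2 (\<lambda>x. x powi k * (1 + x\<^sup>2))"
    from tendsto_add[OF L h2.truncated_moment_tendsto[OF int]]
    have "(h1.truncated_moment k \<longlongrightarrow> L / pi + h2.moment k) (at_right 0)" by simp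
    with int show ?thesis using h1.integrable_moment_of_tendsto[OF assms(1)] by blast
  qed
qed (use iterated_limit_sym_int in blast)

section \<open>Expansions of the difference\<close>

abbreviation "inverse_moments_finite m \<equiv>
  integrable \<nu>1 (\<lambda>x. 1 / x ^ m) \<and> integrable \<nu>2 (\<lambda>x. 1 / x ^ m)"

lemma expansion_q:
  assumes "inverse_moments_finite m" "2 \<le> m"
  shows "has_expansion_at_0 q (int m - 1) (\<lambda>k. h1.coefficient k - h2.coefficient k)"
proof -
  have "has_expansion_at_0 (\<lambda>z. h1 z - h2 z) (int m - 1) (\<lambda>k. h1.coefficient k - h2.coefficient k)"
    using assms by (intro has_expansion_at_0_diff h1.expansion_of_integrable h2.expansion_of_integrable) auto
  then show ?thesis
    by (subst has_expansion_at_0_cong[where g = "\<lambda>z. h1 z - h2 z"]) (auto simp: q_eq)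
qed

text \<open>One of the two functions expands by hypothesis. Combined with an expansion of q this
  expands the other one as well, and both measures then have the inverse moment.\<close>

lemma admits_expansion_q_iff:
  assumes M: "admits_expansion_at_0 h1 M \<or> admits_expansion_at_0 h2 M" "2 * int N - 1 \<le> M" and N: "1 \<le> N"
  shows "integrable \<nu>1 (\<lambda>x. 1 / x ^ (2 * N)) \<or> integrable \<nu>2 (\<lambda>x. 1 / x ^ (2 * N))"
    and "admits_expansion_at_0 q (2 * int N - 1) \<longleftrightarrow> inverse_moments_finite (2 * N)"
proof -
  have mono: "\<exists>a. has_expansion_at_0 f (2 * int N - 1) a" if "admits_expansion_at_0 f M" for f
  proof -
    from that obtain a where "has_expansion_at_0 f M a" by (auto simp: admits_expansion_at_0_def)
    from has_expansion_at_0_mono[OF this _ M(2)] N show ?thesis by auto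
  qed
  show or: "integrable \<nu>1 (\<lambda>x. 1 / x ^ (2 * N)) \<or> integrable \<nu>2 (\<lambda>x. 1 / x ^ (2 * N))"
    using M(1) mono[of h1] mono[of h2] h1.integrable_of_expansion h2.integrable_of_expansion by blast
  show "admits_expansion_at_0 q (2 * int N - 1) \<longleftrightarrow> inverse_moments_finite (2 * N)"
  proof
    assume "admits_expansion_at_0 q (2 * int N - 1)"
    then obtain a where a: "has_expansion_at_0 q (2 * int N - 1) a" by (auto simp: admits_expansion_at_0_def)
    have ex: "int (2 * N) - 1 = 2 * int N - 1" "2 \<le> 2 * N" using N by auto
    show "inverse_moments_finite (2 * N)"
      using or
    proof
      assume int: "integrable \<nu>1 (\<lambda>x. 1 / x ^ (2 * N))"
      have "has_expansion_at_0 (\<lambda>z. h1 z - q z) (2 * int N - 1) (\<lambda>k. h1.coefficient k - a k)"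
        by (rule has_expansion_at_0_diff[OF h1.expansion_of_integrable[OF int ex(2), unfolded ex(1)] a])
      then have "has_expansion_at_0 h2 (2 * int N - 1) (\<lambda>k. h1.coefficient k - a k)"
        by (subst has_expansion_at_0_cong[where g = "\<lambda>z. h1 z - q z"]) (auto simp: q_eq)
      with int show ?thesis using h2.integrable_of_expansion by blast
    next
      assume int: "integrable \<nu>2 (\<lambda>x. 1 / x ^ (2 * N))"
      \<comment> \<open>The sum h2 + q is written as a double difference, so that the rule for
        differences suffices.\<close>
      have "has_expansion_at_0 (\<lambda>z. h2 z - (0 - q z)) (2 * int N - 1) (\<lambda>k. h2.coefficient k - (0 - a k))"
        by (intro has_expansion_at_0_diff[OF h2.expansion_of_integrable[OF int ex(2), unfolded ex(1)]] has_expansion_at_0_diff a)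
           (simp add: has_expansion_at_0_def)
      then have "has_expansion_at_0 h1 (2 * int N - 1) (\<lambda>k. h2.coefficient k - (0 - a k))"
        by (subst has_expansion_at_0_cong[where g = "\<lambda>z. h2 z - (0 - q z)"]) (auto simp: q_eq)
      with int show ?thesis using h1.integrable_of_expansion by blast
    qed
  next
    assume "inverse_moments_finite (2 * N)"
    from expansion_q[OF this] N have "has_expansion_at_0 q (2 * int N - 1) (\<lambda>k. h1.coefficient k - h2.coefficient k)"
      by simp
    then show "admits_expansion_at_0 q (2 * int N - 1)" by (auto simp: admits_expansion_at_0_def)
  qed
qed

lemma moments_finite_negative_iff:
  assumes "2 \<le> m"
  shows "moments_finite (- int m) \<longleftrightarrow> inverse_moments_finite m"
  using assms by (simp add: h1.integrable_weighted_inverse_power_iff h2.integrable_weighted_inverse_power_iff)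

lemma moments_finite_negative:
  assumes "inverse_moments_finite m" "- int m \<le> k" "k \<le> -2"
  shows "moments_finite k"
proof -
  obtain j where j: "k = - int j" using assms(3) by (metis nonpos_int_cases order_trans neg_le_0_iff_le zero_le_numeral)
  then have "2 \<le> j" "j \<le> m" using assms by auto
  then have "inverse_moments_finite j"
    using assms h1.integrable_inverse_power_mono h2.integrable_inverse_power_mono by blast
  with moments_finite_negative_iff[OF \<open>2 \<le> j\<close>] j show ?thesis by simp
qed

lemma coefficient_q:
  assumes "inverse_moments_finite m" "2 \<le> m" "has_expansion_at_0 q (int m - 1) a" "-1 \<le> j" "j \<le> int m - 1"
  shows "a j = h1.coefficient j - h2.coefficient j"
  using has_expansion_at_0_unique[OF assms(3) expansion_q[OF assms(1,2)] assms(4,5)] .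

lemma coefficient_q_minus_1:
  assumes "has_expansion_at_0 q (-1) a"
  shows "a (-1) = \<gamma>2 - \<gamma>1"
proof -
  have "has_expansion_at_0 (\<lambda>z. h1 z - h2 z) (-1) (\<lambda>k. - \<gamma>1 - (- \<gamma>2))"
    by (intro has_expansion_at_0_diff h1.expansion_order_minus_1 h2.expansion_order_minus_1) auto
  then have "has_expansion_at_0 q (-1) (\<lambda>k. - \<gamma>1 - (- \<gamma>2))"
    by (subst has_expansion_at_0_cong[where g = "\<lambda>z. h1 z - h2 z"]) (auto simp: q_eq)
  from has_expansion_at_0_unique[OF assms this, of "-1"] show ?thesis by simp
qed

lemma inversion: "nevanlinna_pair (\<lambda>z. h1 (- 1 / z)) \<alpha>1 \<gamma>1 \<beta>1 (distr \<nu>1 borel (\<lambda>x. - 1 / x))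
    (\<lambda>z. h2 (- 1 / z)) \<alpha>2 \<gamma>2 \<beta>2 (distr \<nu>2 borel (\<lambda>x. - 1 / x)) (\<lambda>z. q (- 1 / z))"
proof (intro nevanlinna_pair.intro nevanlinna_pair_axioms.intro h1.inversion h2.inversion)
  fix z :: complex assume "0 < Im z"
  then have "0 < Im (- 1 / z)"
    by (simp add: Im_divide add_pos_nonneg zero_less_divide_iff sum_power2_gt_zero_iff)
  then show "q (- 1 / z) = h1 (- 1 / z) - h2 (- 1 / z)" by (rule q_eq)
qed

end

section \<open>Coefficients and moments of the inverted function\<close>

context nevanlinna
begin

lemma integrable_inverse_power_inversion_iff:
  assumes "2 \<le> m"
  shows "integrable (distr \<nu> borel (\<lambda>x. - 1 / x)) (\<lambda>x. 1 / x ^ m) \<longleftrightarrow>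
     integrable \<nu> (\<lambda>x. x powi (int m - 2) * (1 + x\<^sup>2))"
proof -
  have "- (int m - 2) - 2 = - int m" by simp
  then show ?thesis
    using nevanlinna.integrable_weighted_inverse_power_iff[OF inversion assms]
      integrable_inversion_iff[of "int m - 2"] by (simp only:)
qed

lemma integral_inverse_inversion: "(\<integral>x. 1 / x \<partial>distr \<nu> borel (\<lambda>x. - 1 / x)) = - (\<integral>x. x \<partial>\<nu>)"
proof -
  have "(\<integral>x. 1 / x \<partial>distr \<nu> borel (\<lambda>x. - 1 / x)) = (\<integral>x. 1 / (- 1 / x) \<partial>\<nu>)"
    by (rule integral_distr) auto
  then show ?thesis by simp
qed

text \<open>Up to the sign (-1)^(k + 1), the coefficient with index k + 1 is the one of z^(-k - 1)
  in the expansion of h at infinity. The roles of \<beta> and \<gamma> are exchanged, so \<gamma>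
  shows up at k = 0.\<close>

lemma coefficient_inversion:
  "nevanlinna.coefficient \<alpha> \<gamma> \<beta> (distr \<nu> borel (\<lambda>x. - 1 / x)) 0 = \<alpha> - (\<integral>x. x \<partial>\<nu>)"
  "0 \<le> k \<Longrightarrow> nevanlinna.coefficient \<alpha> \<gamma> \<beta> (distr \<nu> borel (\<lambda>x. - 1 / x)) (k + 1) =
     (if k = 0 then \<gamma> else 0) + (-1) powi k * moment k"
proof -
  define D where "D = distr \<nu> borel (\<lambda>x. - 1 / x)"
  note coeff = nevanlinna.coefficient_def[OF inversion, folded D_def]
  show "nevanlinna.coefficient \<alpha> \<gamma> \<beta> (distr \<nu> borel (\<lambda>x. - 1 / x)) 0 = \<alpha> - (\<integral>x. x \<partial>\<nu>)"
    unfolding D_def[symmetric] coeff using integral_inverse_inversion[folded D_def] by simp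
  assume "0 \<le> k"
  then show "nevanlinna.coefficient \<alpha> \<gamma> \<beta> (distr \<nu> borel (\<lambda>x. - 1 / x)) (k + 1) =
     (if k = 0 then \<gamma> else 0) + (-1) powi k * moment k"
    unfolding D_def[symmetric] coeff using moment_inversion[of k, folded D_def] by (auto simp: diff_diff_eq)
qed

lemma integrable_id_of_inversion:
  assumes "integrable (distr \<nu> borel (\<lambda>x. - 1 / x)) (\<lambda>x. 1 / x ^ m)" "1 \<le> m"
  shows "integrable \<nu> (\<lambda>x. x)"
proof -
  have "integrable (distr \<nu> borel (\<lambda>x. - 1 / x)) (\<lambda>x. 1 / x)"
    using nevanlinna.integrable_inverse_power_mono[OF inversion assms] by simp
  then have "integrable \<nu> (\<lambda>x. 1 / (- 1 / x))"
    by (subst (asm) integrable_distr_eq) auto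
  then show ?thesis by simp
qed

text \<open>At k = -1 the weight is 1/x + x: one summand is controlled by the expansion at 0, the
  other by the one at infinity, so both are required.\<close>

lemma moment_minus_1:
  assumes "integrable \<nu> (\<lambda>x. 1 / x)" "integrable \<nu> (\<lambda>x. x)"
  shows "integrable \<nu> (\<lambda>x. x powi (-1) * (1 + x\<^sup>2))"
    and "moment (-1) = (\<integral>x. 1 / x \<partial>\<nu>) + (\<integral>x. x \<partial>\<nu>)"
proof -
  \<comment> \<open>At x = 0 both sides are 0 by the convention for division by zero.\<close>
  have eq: "x powi (-1) * (1 + x\<^sup>2) = 1 / x + x" for x :: real
    by (cases "x = 0") (simp_all add: power_int_minus field_simps power2_eq_square)
  show "integrable \<nu> (\<lambda>x. x powi (-1) * (1 + x\<^sup>2))"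
    unfolding eq by (intro Bochner_Integration.integrable_add assms)
  show "moment (-1) = (\<integral>x. 1 / x \<partial>\<nu>) + (\<integral>x. x \<partial>\<nu>)"
    unfolding moment_def eq by (rule Bochner_Integration.integral_add[OF assms])
qed

end

section \<open>The equivalences and the identities\<close>

context nevanlinna_pair
begin

abbreviation "dual_finite m \<equiv>
  integrable (distr \<nu>1 borel (\<lambda>x. - 1 / x)) (\<lambda>x. 1 / x ^ m) \<and>
  integrable (distr \<nu>2 borel (\<lambda>x. - 1 / x)) (\<lambda>x. 1 / x ^ m)"

lemma iterated_limit_iff_expansion_at_0:
  assumes "admits_expansion_at_0 h1 M \<or> admits_expansion_at_0 h2 M" "2 * int N - 1 \<le> M" "1 \<le> N"
  shows "(\<exists>L. iterated_limit (sym_int q (- 2 * int N)) L) \<longleftrightarrow> admits_expansion_at_0 q (2 * int N - 1)"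
proof -
  have k: "- 2 * int N = - int (2 * N)" "even (- int (2 * N))" "2 \<le> 2 * N" using assms by auto
  have "(\<exists>L. iterated_limit (sym_int q (- int (2 * N))) L) \<longleftrightarrow> moments_finite (- int (2 * N))"
    by (rule iterated_limit_iff[OF k(2)])
       (use admits_expansion_q_iff(1)[OF assms] h1.integrable_weighted_inverse_power_iff[OF k(3)]
          h2.integrable_weighted_inverse_power_iff[OF k(3)] in blast)
  then show ?thesis
    unfolding k(1) moments_finite_negative_iff[OF k(3)] admits_expansion_q_iff(2)[OF assms] .
qed

text \<open>Order 2 N + 1 at infinity is order 2 (N + 1) - 1 at 0 after inversion, which accounts
  for \<open>Suc N\<close>; the inverse power 2 (N + 1) of the image measures corresponds to the
  exponent 2 N of the original ones.\<close>

lemma dual_finite_of_expansion: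
  assumes "admits_expansion_at_inf h1 K \<or> admits_expansion_at_inf h2 K" "2 * int N + 1 \<le> K"
  shows "integrable \<nu>1 (\<lambda>x. x powi (2 * int N) * (1 + x\<^sup>2)) \<or> integrable \<nu>2 (\<lambda>x. x powi (2 * int N) * (1 + x\<^sup>2))"
    and "admits_expansion_at_inf q (2 * int N + 1) \<longleftrightarrow> dual_finite (2 * Suc N)"
    and "dual_finite (2 * Suc N) \<longleftrightarrow> moments_finite (2 * int N)"
proof -
  note dual = nevanlinna_pair.admits_expansion_q_iff[OF inversion assms(1)[unfolded admits_expansion_at_inf_iff], of "Suc N"]
  have N: "2 * int (Suc N) - 1 = 2 * int N + 1" "int (2 * Suc N) - 2 = 2 * int N" "2 \<le> 2 * Suc N" by auto
  note iff = h1.integrable_inverse_power_inversion_iff[OF N(3), unfolded N(2)]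
    h2.integrable_inverse_power_inversion_iff[OF N(3), unfolded N(2)]
  show "integrable \<nu>1 (\<lambda>x. x powi (2 * int N) * (1 + x\<^sup>2)) \<or> integrable \<nu>2 (\<lambda>x. x powi (2 * int N) * (1 + x\<^sup>2))"
    using dual(1) assms(2) unfolding iff N(1) by simp
  show "admits_expansion_at_inf q (2 * int N + 1) \<longleftrightarrow> dual_finite (2 * Suc N)"
    unfolding admits_expansion_at_inf_iff using dual(2) assms(2) unfolding N(1) by simp
  show "dual_finite (2 * Suc N) \<longleftrightarrow> moments_finite (2 * int N)"
    unfolding iff ..
qed

lemma iterated_limit_iff_expansion_at_inf:
  assumes "admits_expansion_at_inf h1 K \<or> admits_expansion_at_inf h2 K" "2 * int N + 1 \<le> K"
  shows "(\<exists>L. iterated_limit (sym_int q (2 * int N)) L) \<longleftrightarrow> admits_expansion_at_inf q (2 * int N + 1)"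
  unfolding dual_finite_of_expansion(2,3)[OF assms]
  by (rule iterated_limit_iff) (use dual_finite_of_expansion(1)[OF assms] in auto)

lemma coefficient_inf_1:
  assumes "has_expansion_at_inf q (-1) b"
  shows "b 1 = \<beta>1 - \<beta>2"
  using nevanlinna_pair.coefficient_q_minus_1[OF inversion assms[unfolded has_expansion_at_inf_iff]] by simp

text \<open>For k \<le> -3 the coefficients are pure moments. At k = -2 the coefficient a 1 also
  contains \<beta>1 - \<beta>2, and this is b 1.\<close>

lemma identity_at_0:
  assumes fin: "inverse_moments_finite (2 * N)" and N: "1 \<le> N"
    and a: "has_expansion_at_0 q (2 * int N - 1) a" and b: "has_expansion_at_inf q (-1) b"
    and k: "- 2 * int N \<le> k" "k \<le> -2"
  shows "iterated_limit (\<lambda>\<epsilon> y. sym_int q k \<epsilon> y / pi)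
     (if k \<le> -3 then a (-k-1) else a (-k-1) - b (-k-1))"
proof -
  have "a (-k-1) = h1.coefficient (-k-1) - h2.coefficient (-k-1)"
    by (rule coefficient_q[OF fin]) (use a k N in auto)
  moreover have "b 1 = \<beta>1 - \<beta>2" by (rule coefficient_inf_1[OF b])
  ultimately have "(if k \<le> -3 then a (-k-1) else a (-k-1) - b (-k-1)) = h1.moment k - h2.moment k"
  proof (cases "k = -2")
    case False
    then show ?thesis
      using \<open>a (-k-1) = _\<close> k by (simp add: h1.coefficient_def h2.coefficient_def)
  qed (simp add: h1.coefficient_def h2.coefficient_def)
  moreover have "moments_finite k"
    by (rule moments_finite_negative[OF fin]) (use k in auto)
  ultimately show ?thesis using iterated_limit_sym_int_divide by simp
qed

text \<open>The mirror image of the identities at 0: only at k = 0 does the coefficient at infinity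
  contain \<gamma>1 - \<gamma>2, which is -a (-1).\<close>

lemma identity_at_inf:
  assumes fin: "dual_finite (2 * Suc N)"
    and b: "has_expansion_at_inf q (2 * int N + 1) b" and a: "has_expansion_at_0 q (-1) a"
    and k: "0 \<le> k" "k \<le> 2 * int N"
  shows "iterated_limit (\<lambda>\<epsilon> y. sym_int q k \<epsilon> y / pi)
     (if k = 0 then a (-k-1) - b (-k-1) else - b (-k-1))"
proof -
  interpret dual: nevanlinna_pair "\<lambda>z. h1 (- 1 / z)" \<alpha>1 \<gamma>1 \<beta>1 "distr \<nu>1 borel (\<lambda>x. - 1 / x)"
    "\<lambda>z. h2 (- 1 / z)" \<alpha>2 \<gamma>2 \<beta>2 "distr \<nu>2 borel (\<lambda>x. - 1 / x)" "\<lambda>z. q (- 1 / z)"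
    by (rule inversion)
  have "dual.moments_finite (- k - 2)"
    by (rule dual.moments_finite_negative[OF fin]) (use k in auto)
  then have mf: "moments_finite k"
    unfolding h1.integrable_inversion_iff h2.integrable_inversion_iff .
  have N: "2 * int N + 1 = int (2 * Suc N) - 1" by simp
  have "(-1) powi (k + 1) * b (- (k + 1)) = dual.h1.coefficient (k + 1) - dual.h2.coefficient (k + 1)"
    by (rule dual.coefficient_q[OF fin _ b[unfolded has_expansion_at_inf_iff N]]) (use k in auto)
  moreover have "a (-1) = \<gamma>2 - \<gamma>1" by (rule coefficient_q_minus_1[OF a])
  moreover note h1.coefficient_inversion(2)[OF k(1)] h2.coefficient_inversion(2)[OF k(1)]
  moreover have "- (k + 1) = - k - 1" by simp
  ultimately have *: "(-1) powi (k + 1) * b (- k - 1) = (if k = 0 then - a (-1) else 0) + (-1) powi k * (h1.moment k - h2.moment k)"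
    by (simp only: right_diff_distrib) simp
  \<comment> \<open>Multiplication by (-1)^k clears all signs: the total exponent is 2 k + 1 on the
    left, hence the minus in front of b, and 2 k on the right.\<close>
  have "(-1) powi k * ((-1) powi (k + 1) * b (- k - 1)) = - b (- k - 1)"
    by (simp add: power_int_add flip: mult.assoc)
  moreover have "(-1) powi k * ((-1) powi k * (h1.moment k - h2.moment k)) = h1.moment k - h2.moment k"
    by (simp flip: mult.assoc)
  ultimately have "- b (- k - 1) = (if k = 0 then - a (-1) else 0) + (h1.moment k - h2.moment k)"
    using arg_cong[OF *, of "\<lambda>x. (-1) powi k * x"] by (auto simp: distrib_left split: if_splits)
  then have "(if k = 0 then a (-k-1) - b (-k-1) else - b (-k-1)) = h1.moment k - h2.moment k"
    by auto
  then show ?thesis using iterated_limit_sym_int_divide[OF mf] by simp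
qed

lemma identity_minus_1:
  assumes fin0: "inverse_moments_finite (2 * N)" and N: "1 \<le> N" and fin: "dual_finite (2 * Suc N')"
    and a: "has_expansion_at_0 q (2 * int N - 1) a" and b: "has_expansion_at_inf q (2 * int N' + 1) b"
  shows "iterated_limit (\<lambda>\<epsilon> y. sym_int q (-1) \<epsilon> y / pi) (a 0 - b 0)"
proof -
  interpret dual: nevanlinna_pair "\<lambda>z. h1 (- 1 / z)" \<alpha>1 \<gamma>1 \<beta>1 "distr \<nu>1 borel (\<lambda>x. - 1 / x)"
    "\<lambda>z. h2 (- 1 / z)" \<alpha>2 \<gamma>2 \<beta>2 "distr \<nu>2 borel (\<lambda>x. - 1 / x)" "\<lambda>z. q (- 1 / z)"
    by (rule inversion)
  have a0: "a 0 = h1.coefficient 0 - h2.coefficient 0"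
    by (rule coefficient_q[OF fin0]) (use a N in auto)
  have N': "2 * int N' + 1 = int (2 * Suc N') - 1" by simp
  have "(-1) powi 0 * b (- 0) = dual.h1.coefficient 0 - dual.h2.coefficient 0"
    by (rule dual.coefficient_q[OF fin _ b[unfolded has_expansion_at_inf_iff N']]) auto
  then have b0: "b 0 = dual.h1.coefficient 0 - dual.h2.coefficient 0" by simp
  have i1: "integrable \<nu>1 (\<lambda>x. 1 / x)" "integrable \<nu>2 (\<lambda>x. 1 / x)"
    using fin0 N h1.integrable_inverse_power_mono[of "2 * N" 1] h2.integrable_inverse_power_mono[of "2 * N" 1] by auto
  have i2: "integrable \<nu>1 (\<lambda>x. x)" "integrable \<nu>2 (\<lambda>x. x)"
    using fin h1.integrable_id_of_inversion[of "2 * Suc N'"] h2.integrable_id_of_inversion[of "2 * Suc N'"] by auto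
  \<comment> \<open>The constants \<alpha>1 and \<alpha>2 occur in a 0 and in b 0 alike and cancel;
    what is left is the integral of 1/x plus that of x for each measure.\<close>
  have "a 0 - b 0 = h1.moment (-1) - h2.moment (-1)"
    unfolding a0 b0 h1.coefficient_inversion(1) h2.coefficient_inversion(1) h1.moment_minus_1(2)[OF i1(1) i2(1)] h2.moment_minus_1(2)[OF i1(2) i2(2)]
    by (simp add: h1.coefficient_def h2.coefficient_def)
  moreover have "moments_finite (-1)"
    using h1.moment_minus_1(1)[OF i1(1) i2(1)] h2.moment_minus_1(1)[OF i1(2) i2(2)] by blast
  ultimately show ?thesis using iterated_limit_sym_int_divide by simp
qed

end

text \<open>The coefficients are arbitrary expansions rather than chosen ones, which is legitimate
  by uniqueness. The opposite expansion of order -1 in the identities for k \<le> -2 and for k \<ge>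
  0 fixes the single coefficient b 1 or a (-1) needed at k = -2 or k = 0.\<close>

theorem theorem3p1:
  fixes q h1 h2 :: "complex \<Rightarrow> complex"
  assumes "herglotz h1" and "herglotz h2"
    and "\<forall>z\<in>upper_half. q z = h1 z - h2 z"
  shows
    \<comment> \<open>(i)\<close>
    "(\<forall>M N0::int. M \<ge> -1 \<longrightarrow> (admits_expansion_at_0 h1 M \<or> admits_expansion_at_0 h2 M) \<longrightarrow>
        N0 \<ge> 1 \<longrightarrow> 2*N0 - 1 \<le> M \<longrightarrow>
        ((\<exists>L. iterated_limit (sym_int q (-2*N0)) L) \<longleftrightarrow> admits_expansion_at_0 q (2*N0 - 1)))
   \<and> \<comment> \<open>(ii)\<close>
    (\<forall>K Ninf::int. K \<ge> -1 \<longrightarrow> (admits_expansion_at_inf h1 K \<or> admits_expansion_at_inf h2 K) \<longrightarrow>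
        Ninf \<ge> 0 \<longrightarrow> 2*Ninf + 1 \<le> K \<longrightarrow>
        ((\<exists>L. iterated_limit (sym_int q (2*Ninf)) L) \<longleftrightarrow> admits_expansion_at_inf q (2*Ninf + 1)))
   \<and> \<comment> \<open>identities for k = -2N0, ..., -2\<close>
    (\<forall>M N0::int. \<forall>a b. M \<ge> -1 \<longrightarrow> (admits_expansion_at_0 h1 M \<or> admits_expansion_at_0 h2 M) \<longrightarrow>
        N0 \<ge> 1 \<longrightarrow> 2*N0 - 1 \<le> M \<longrightarrow>
        has_expansion_at_0 q (2*N0 - 1) a \<longrightarrow> has_expansion_at_inf q (-1) b \<longrightarrow>
        (\<forall>k::int. -2*N0 \<le> k \<and> k \<le> -2 \<longrightarrow>
           iterated_limit (\<lambda>\<epsilon> y. sym_int q k \<epsilon> y / pi)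
             (if k \<le> -3 then a (-k-1) else a (-k-1) - b (-k-1))))
   \<and> \<comment> \<open>identities for k = 0, ..., 2Ninf\<close>
    (\<forall>K Ninf::int. \<forall>a b. K \<ge> -1 \<longrightarrow> (admits_expansion_at_inf h1 K \<or> admits_expansion_at_inf h2 K) \<longrightarrow>
        Ninf \<ge> 0 \<longrightarrow> 2*Ninf + 1 \<le> K \<longrightarrow>
        has_expansion_at_inf q (2*Ninf + 1) b \<longrightarrow> has_expansion_at_0 q (-1) a \<longrightarrow>
        (\<forall>k::int. 0 \<le> k \<and> k \<le> 2*Ninf \<longrightarrow>
           iterated_limit (\<lambda>\<epsilon> y. sym_int q k \<epsilon> y / pi)
             (if k = 0 then a (-k-1) - b (-k-1) else - b (-k-1))))
   \<and> \<comment> \<open>identity for k = -1\<close>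
    (\<forall>M N0 K Ninf::int. \<forall>a b. M \<ge> -1 \<longrightarrow> (admits_expansion_at_0 h1 M \<or> admits_expansion_at_0 h2 M) \<longrightarrow>
        N0 \<ge> 1 \<longrightarrow> 2*N0 - 1 \<le> M \<longrightarrow>
        K \<ge> -1 \<longrightarrow> (admits_expansion_at_inf h1 K \<or> admits_expansion_at_inf h2 K) \<longrightarrow>
        Ninf \<ge> 0 \<longrightarrow> 2*Ninf + 1 \<le> K \<longrightarrow>
        has_expansion_at_0 q (2*N0 - 1) a \<longrightarrow> has_expansion_at_inf q (2*Ninf + 1) b \<longrightarrow>
        iterated_limit (\<lambda>\<epsilon> y. sym_int q (-1) \<epsilon> y / pi) (a 0 - b 0))"
proof -
  obtain \<alpha>1 \<beta>1 \<gamma>1 \<nu>1 where h1: "nevanlinna h1 \<alpha>1 \<beta>1 \<gamma>1 \<nu>1"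
    using herglotz_imp_nevanlinna[OF assms(1)] by blast
  obtain \<alpha>2 \<beta>2 \<gamma>2 \<nu>2 where h2: "nevanlinna h2 \<alpha>2 \<beta>2 \<gamma>2 \<nu>2"
    using herglotz_imp_nevanlinna[OF assms(2)] by blast
  interpret nevanlinna_pair h1 \<alpha>1 \<beta>1 \<gamma>1 \<nu>1 h2 \<alpha>2 \<beta>2 \<gamma>2 \<nu>2 q
    using h1 h2 assms(3) by (simp add: nevanlinna_pair_def nevanlinna_pair_axioms_def upper_half_def)
  show ?thesis
  proof (intro conjI allI impI, goal_cases)
    case (1 M N0)
    then obtain n where "N0 = int n" "1 \<le> n" using nonneg_int_cases[of N0] by auto
    with 1 show ?case using iterated_limit_iff_expansion_at_0[of M n] by simp
  next
    case (2 K Ninf)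
    then obtain n where "Ninf = int n" using nonneg_int_cases[of Ninf] by auto
    with 2 show ?case using iterated_limit_iff_expansion_at_inf[of K n] by simp
  next
    case (3 M N0 a b k)
    then obtain n where n: "N0 = int n" "1 \<le> n" using nonneg_int_cases[of N0] by auto
    have "inverse_moments_finite (2 * n)"
      using 3 n admits_expansion_q_iff(2)[of M n] by (auto simp: admits_expansion_at_0_def)
    then show ?case by (rule identity_at_0) (use 3 n in auto)
  next
    case (4 K Ninf a b k)
    then obtain n where n: "Ninf = int n" using nonneg_int_cases[of Ninf] by auto
    have "admits_expansion_at_inf q (2 * int n + 1)" using 4 n by (auto simp: admits_expansion_at_inf_def)
    then have "dual_finite (2 * Suc n)"
      using dual_finite_of_expansion(2)[OF 4(2), of n] 4 n by blast
    then show ?case by (rule identity_at_inf) (use 4 n in auto)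
  next
    case (5 M N0 K Ninf a b)
    then obtain n where n: "N0 = int n" "1 \<le> n" using nonneg_int_cases[of N0] by auto
    obtain n' where n': "Ninf = int n'" using 5 nonneg_int_cases[of Ninf] by auto
    have "inverse_moments_finite (2 * n)"
      using 5 n admits_expansion_q_iff(2)[of M n] by (auto simp: admits_expansion_at_0_def)
    moreover have "admits_expansion_at_inf q (2 * int n' + 1)" using 5 n' by (auto simp: admits_expansion_at_inf_def)
    then have "dual_finite (2 * Suc n')"
      using dual_finite_of_expansion(2)[OF 5(6), of n'] 5 n' by blast
    ultimately show ?case by (intro identity_minus_1[of n n']) (use 5 n n' in auto)
  qed
qed

end
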